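(* Let $u_0 \in \mathrm{Lip}(\mathbb{T})$. Let $T>0$ and $$u \in C\big((-T,T);(\mathrm{Lip}(\mathbb{T}),\sigma_{H^1(\mathbb{T})})\big)\cap C^1\big((-T,T);(L^\infty(\mathbb{T}),\sigma_{L^2(\mathbb{T})})\big)$$ be the existence time and the unique solution, provided by the local well-posedness theorem recalled in the context, of the Camassa-Holm equation $$\partial_t u+\partial_x\Big(\tfrac12 u^2+P\Big)=0,\qquad -(\partial_x^2-1)P=u^2+\tfrac12(\partial_x u)^2,\qquad u(0,\cdot)=u_0 ,$$ on $(-T,T)\times\mathbb{T}$. Let $\xi:(-T,T)\times\mathbb{T}\to\mathbb{T}$ be its flow map, defined by $$\xi(t,x)=x+\int_0^t u(s,\xi(s,x))\,ds .$$ Then $\xi$ belongs to the space $C^{\omega}((-T,T);\mathrm{Lip}(\mathbb{T}))$ of analytic functions from $(-T,T)$ to $\mathrm{Lip}(\mathbb{T})$, where $\mathrm{Lip}(\mathbb{T})$ carries its usual strong (norm) topology.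
   Context: $\mathbb{T}=\mathbb{R}/\mathbb{Z}$ is the one-dimensional torus and $\mathrm{Lip}(\mathbb{T})=W^{1,\infty}(\mathbb{T})$. The notation $(\mathrm{Lip}(\mathbb{T}),\sigma_{H^1(\mathbb{T})})$ (resp. $(L^\infty(\mathbb{T}),\sigma_{L^2(\mathbb{T})})$) means the space $\mathrm{Lip}(\mathbb{T})$ (resp. $L^\infty(\mathbb{T})$) endowed with the topology of $H^1(\mathbb{T})$ (resp. $L^2(\mathbb{T})$). Local well-posedness theorem (De Lellis, Kappeler, Topalov): for every $u_0\in\mathrm{Lip}(\mathbb{T})$ there exist $T>0$ and a unique solution $u\in C((-T,T);(\mathrm{Lip}(\mathbb{T}),\sigma_{H^1(\mathbb{T})}))\cap C^1((-T,T);(L^\infty(\mathbb{T}),\sigma_{L^2(\mathbb{T})}))$ of the Camassa-Holm equation with initial data $u_0$; moreover its flow map $\xi$ is $C^1$ over $(-T,T)$ with values in $\mathrm{Lip}(\mathbb{T})$ endowed with its strong topology. Membership of $\xi$ in a space of functions with values in $\mathrm{Lip}(\mathbb{T})$ is understood through the displacement $x\mapsto \xi(t,x)-x$, which is a periodic function. *)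

theory Defs
  imports "HOL-Analysis.Analysis"
begin

text \<open>Functions on the torus \<open>\<real>/\<int>\<close> are represented by their 1-periodic lifts to
  \<^typ>\<open>real\<close>; elements of \<open>L\<^sup>\<infinity>\<close> by periodic representatives.\<close>

definition Lip_torus :: "(real \<Rightarrow> real) set" where
  "Lip_torus = {f. (\<forall>x. f (x + 1) = f x) \<and> (\<exists>C. C-lipschitz_on UNIV f)}"

definition Linf_torus :: "(real \<Rightarrow> real) set" where
  "Linf_torus = {f. (\<forall>x. f (x + 1) = f x) \<and> f \<in> borel_measurable lebesgue \<and>
                    (\<exists>C. AE x in lebesgue. \<bar>f x\<bar> \<le> C)}"

text \<open>The Sobolev space \<open>W\<^sup>2\<^sup>,\<^sup>\<infinity>\<close>: periodic \<open>C\<^sup>1\<close> functions with Lipschitz derivative.\<close>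

definition W2inf_torus :: "(real \<Rightarrow> real) set" where
  "W2inf_torus = {f \<in> Lip_torus. (\<forall>x. f differentiable at x) \<and> deriv f \<in> Lip_torus}"

text \<open>The infimum is the best Lipschitz constant, which equals the essential supremum of the
  modulus of the derivative; so this is the usual norm of \<open>W\<^sup>1\<^sup>,\<^sup>\<infinity>\<close>. It is only
  meaningful on \<^const>\<open>Lip_torus\<close>.\<close>

definition Lip_norm :: "(real \<Rightarrow> real) \<Rightarrow> real" where
  "Lip_norm f = (SUP x. \<bar>f x\<bar>) + Inf {C. C-lipschitz_on UNIV f}"

definition L2_norm_torus :: "(real \<Rightarrow> real) \<Rightarrow> real" where
  "L2_norm_torus f = sqrt (LINT x:{0..1}|lebesgue. (f x)\<^sup>2)"

text \<open>Used on Lipschitz functions only; these are differentiable almost everywhere, and their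
  almost everywhere derivative is their weak derivative.\<close>

definition H1_norm_torus :: "(real \<Rightarrow> real) \<Rightarrow> real" where
  "H1_norm_torus f = sqrt (LINT x:{0..1}|lebesgue. (f x)\<^sup>2 + (deriv f x)\<^sup>2)"

text \<open>Regularity in time of maps with values in a space \<open>V\<close> of functions topologised by a
  (semi)norm \<open>N\<close>, which need not be the natural norm of \<open>V\<close>.\<close>

definition C0_into ::
  "(real \<Rightarrow> real) set \<Rightarrow> ((real \<Rightarrow> real) \<Rightarrow> real) \<Rightarrow> real set \<Rightarrow> (real \<Rightarrow> real \<Rightarrow> real) \<Rightarrow> bool" where
  "C0_into V N I f \<longleftrightarrow>
     (\<forall>t\<in>I. f t \<in> V \<and> ((\<lambda>s. N (\<lambda>x. f s x - f t x)) \<longlongrightarrow> 0) (at t within I))"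

definition C1_into ::
  "(real \<Rightarrow> real) set \<Rightarrow> ((real \<Rightarrow> real) \<Rightarrow> real) \<Rightarrow> real set \<Rightarrow> (real \<Rightarrow> real \<Rightarrow> real) \<Rightarrow>
   (real \<Rightarrow> real \<Rightarrow> real) \<Rightarrow> bool" where
  "C1_into V N I f f' \<longleftrightarrow>
     C0_into V N I f' \<and>
     (\<forall>t\<in>I. f t \<in> V \<and>
        ((\<lambda>s. N (\<lambda>x. (f s x - f t x) / (s - t) - f' t x)) \<longlongrightarrow> 0) (at t within I))"

definition analytic_into ::
  "(real \<Rightarrow> real) set \<Rightarrow> ((real \<Rightarrow> real) \<Rightarrow> real) \<Rightarrow> real set \<Rightarrow> (real \<Rightarrow> real \<Rightarrow> real) \<Rightarrow> bool" where
  "analytic_into V N I f \<longleftrightarrow>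
     (\<forall>t\<in>I. f t \<in> V) \<and>
     (\<forall>t0\<in>I. \<exists>r>0. \<exists>a :: nat \<Rightarrow> real \<Rightarrow> real. (\<forall>k. a k \<in> V) \<and>
        (\<forall>t\<in>I. \<bar>t - t0\<bar> < r \<longrightarrow>
           (\<lambda>n. N (\<lambda>x. f t x - (\<Sum>k<n. (t - t0) ^ k * a k x))) \<longlonglongrightarrow> 0))"

text \<open>In this class the equation holds at each time as an identity in \<open>L\<^sup>2\<close>, i.e. almost
  everywhere in space, with \<open>ut\<close> the time derivative of \<open>u\<close> taken in \<open>L\<^sup>2\<close>.
  The right-hand side of the elliptic equation is in \<open>L\<^sup>\<infinity>\<close>, so its unique periodic solution
  (even among distributions) lies in \<open>W\<^sup>2\<^sup>,\<^sup>\<infinity>\<close>.\<close>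

definition CH_solution :: "real \<Rightarrow> (real \<Rightarrow> real) \<Rightarrow> (real \<Rightarrow> real \<Rightarrow> real) \<Rightarrow> bool" where
  "CH_solution T u0 u \<longleftrightarrow>
     C0_into Lip_torus H1_norm_torus {-T<..<T} u \<and>
     (\<exists>ut P. C1_into Linf_torus L2_norm_torus {-T<..<T} u ut \<and>
        (\<forall>t\<in>{-T<..<T}.
           P t \<in> W2inf_torus \<and>
           (AE x in lebesgue. ut t x + deriv (\<lambda>y. (u t y)\<^sup>2 / 2 + P t y) x = 0) \<and>
           (AE x in lebesgue.
              - (deriv (deriv (P t)) x - P t x) = (u t x)\<^sup>2 + (deriv (u t) x)\<^sup>2 / 2))) \<and>
     u 0 = u0"

text \<open>\<open>\<xi> t\<close> is the lift to \<^typ>\<open>real\<close> of a self-map of the torus, so that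
  \<open>\<lambda>x. \<xi> t x - x\<close> is periodic.\<close>

definition flow_map :: "real \<Rightarrow> (real \<Rightarrow> real \<Rightarrow> real) \<Rightarrow> (real \<Rightarrow> real \<Rightarrow> real) \<Rightarrow> bool" where
  "flow_map T u \<xi> \<longleftrightarrow>
     (\<forall>t\<in>{-T<..<T}. \<forall>x.
        \<xi> t (x + 1) = \<xi> t x + 1 \<and>
        interval_lebesgue_integrable lborel (ereal 0) (ereal t) (\<lambda>s. u s (\<xi> s x)) \<and>
        \<xi> t x = x + (LBINT s=ereal 0..ereal t. u s (\<xi> s x)))"

text \<open>The existence time and solution provided by the local well-posedness theorem of De Lellis,
  Kappeler and Topalov, with the properties which that theorem asserts: \<open>u\<close> is the only solution
  in its class on \<open>(-T, T)\<close>, and its flow map is \<open>C\<^sup>1\<close> in time for the norm of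
  \<^const>\<open>Lip_torus\<close>.\<close>

definition CH_local_wellposed :: "real \<Rightarrow> (real \<Rightarrow> real) \<Rightarrow> (real \<Rightarrow> real \<Rightarrow> real) \<Rightarrow> bool" where
  "CH_local_wellposed T u0 u \<longleftrightarrow>
     T > 0 \<and> CH_solution T u0 u \<and>
     (\<forall>v. CH_solution T u0 v \<longrightarrow> (\<forall>t\<in>{-T<..<T}. v t = u t)) \<and>
     (\<forall>\<xi>. flow_map T u \<xi> \<longrightarrow>
        (\<exists>\<eta>. C1_into Lip_torus Lip_norm {-T<..<T} (\<lambda>t x. \<xi> t x - x) \<eta>))"

end

theory Submission
  imports Defs "HOL-Analysis.Analysis" "HOL-Library.Periodic_Fun"
begin

text \<open>In Lagrangian variables \<open>v = u \<circ> \<xi>\<close>, \<open>q = \<xi>\<^sub>x\<close>, \<open>w = v\<^sub>x\<close>, \<open>h = w\<^sup>2/q\<close>, \<open>p = P \<circ> \<xi>\<close>,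
  \<open>r = \<partial>\<^sub>xP \<circ> \<xi>\<close> the equation becomes the pointwise system
  \<open>v' = -r\<close>, \<open>q' = w\<close>, \<open>w' = (v\<^sup>2 - p) q + h/2\<close>, \<open>h' = 2 (v\<^sup>2 - p) w\<close>,
  in which, by Green's formula, \<open>p\<close> and \<open>r\<close> are integrals of polynomials in \<open>v, q, h\<close> and
  \<open>e\<close> to the power \<open>\<plusminus>(\<xi> - x)\<close>. A polynomial system propagates bounds of the form \<open>M C\<^sup>k\<close> on its Taylor
  coefficients, uniformly in \<open>x\<close>; those of \<open>q\<close> control the Lipschitz norm of the coefficients of
  \<open>\<xi> - x\<close>. The system requires \<open>q\<close> bounded below. This cannot fail first at a time \<open>c\<close>: \<open>q + h\<close>
  decays at most exponentially, while on an interval \<open>[x, y]\<close> the integral of \<open>h\<close> is controlled by the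
  increments of \<open>\<xi>\<close> and of \<open>\<partial>\<^sub>xP \<circ> \<xi>\<close>, and \<open>\<partial>\<^sub>xP\<close> is Lipschitz at time \<open>c\<close>.\<close>

section \<open>Lipschitz functions of one real variable\<close>

text \<open>The unknown \<open>h\<close> makes the system polynomial: \<open>w*w/q\<close> occurs in
  the equation for \<open>w\<close>, and its own evolution contains no division. The main obstacle
  is that slopes exist only almost everywhere in space, while an ODE in time needs the same point
  \<open>x\<close> at all times. Continuity in time for the Lipschitz norm resolves this:
  differentiability at a point survives Lipschitz limits, so one null set, collected at rational
  times, serves every time. Differentiability in time of the velocity for the Lipschitz seminorm is
  not given either, since \<open>P\<close> at two times is first compared only in C^1; it comes from
  the formula for the slope of \<open>r\<close>, which involves \<open>p\<close>, \<open>v\<close>,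
  \<open>q\<close>, \<open>w\<close> alone. That formula pulls the elliptic equation back through
  \<open>\<xi>\<close>, and for this the inverse flow must preserve null sets; hence the lower bound
  on \<open>q\<close> precedes everything else. In the Taylor estimates the time interval and the
  sup bound \<open>M\<close> are fixed first. Only the growth rate \<open>C\<close> is then taken
  large against constants built from \<open>M\<close>, so that raising the order costs
  nothing.\<close>

text \<open>Vitali's theorem yields closed balls; passing to open ones costs only countably many
  spheres, hence a null set. The union is then open, stays inside \<open>G\<close> and still
  contains almost all of \<open>E\<close>, so it can take the place of \<open>G\<close> in a further
  selection.\<close>

lemma Vitali_open_refinement:
  fixes E G :: "real set" and K :: "(real \<times> real) set"
  assumes cov: "\<And>x d. x \<in> E \<Longrightarrow> d > 0 \<Longrightarrow> \<exists>(a,r)\<in>K. 0 < r \<and> r < d \<and> x \<in> cball a r"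
    and G: "open G" "negligible (E - G)"
  obtains C where "countable C" "C \<subseteq> K" "\<And>i. i \<in> C \<Longrightarrow> 0 < snd i"
    "disjoint_family_on (\<lambda>i. ball (fst i) (snd i)) C" "(\<Union>i\<in>C. ball (fst i) (snd i)) \<subseteq> G"
    "negligible (E - (\<Union>i\<in>C. ball (fst i) (snd i)))"
proof -
  let ?K = "{(a,r) \<in> K. 0 < r \<and> cball a r \<subseteq> G}"
  have 1: "0 < snd i" if "i \<in> ?K" for i using that by auto
  have 2: "\<exists>i. i \<in> ?K \<and> x \<in> cball (fst i) (snd i) \<and> snd i < d"
    if x: "x \<in> E \<inter> G" and d: "0 < d" for x d :: real
  proof -
    obtain e where e: "e > 0" "ball x e \<subseteq> G" using x G(1) open_contains_ball by blast
    obtain a r where ar: "(a,r) \<in> K" "0 < r" "r < min d (e/2)" "x \<in> cball a r"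
      using cov[of x "min d (e/2)"] x d e by auto
    have "cball a r \<subseteq> ball x e"
    proof
      fix y assume "y \<in> cball a r"
      then show "y \<in> ball x e" using ar by (auto simp: dist_real_def)
    qed
    then show ?thesis using ar e by (intro exI[of _ "(a,r)"]) auto
  qed
  obtain C where C: "countable C" "C \<subseteq> ?K"
     "pairwise (\<lambda>i j. disjnt (cball (fst i) (snd i)) (cball (fst j) (snd j))) C"
     "negligible (E \<inter> G - (\<Union>i \<in> C. cball (fst i) (snd i)))"
    using Vitali_covering_theorem_cballs[of ?K snd "E \<inter> G" fst, OF 1 2] by blast
  define B where "B i = ball (fst i) (snd i)" for i :: "real \<times> real"
  define D where "D i = cball (fst i) (snd i)" for i :: "real \<times> real"
  define Z where "Z i = sphere (fst i) (snd i)" for i :: "real \<times> real"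
  have BD: "B i \<subseteq> D i" "D i \<subseteq> B i \<union> Z i" for i
    by (auto simp: B_def D_def Z_def)
  have C4: "negligible (E \<inter> G - (\<Union>i\<in>C. D i))" using C(4) by (simp only: D_def)
  have sph: "negligible (\<Union>i\<in>C. Z i)"
    by (rule negligible_countable_Union) (auto simp: C(1) negligible_sphere Z_def)
  have DG: "D i \<subseteq> G" "i \<in> K" "0 < snd i" if "i \<in> C" for i
    using subsetD[OF C(2) that] by (simp_all only: mem_Collect_eq D_def case_prod_beta prod.collapse)
  have pw: "D i \<inter> D j = {}" if "i \<in> C" "j \<in> C" "i \<noteq> j" for i j
    using pairwiseD[OF C(3) that] by (simp only: D_def disjnt_def)
  have sub: "(\<Union>i\<in>C. B i) \<subseteq> G" using DG(1) BD(1) by blast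
  have "E - (\<Union>i\<in>C. B i) \<subseteq> (E - G) \<union> (E \<inter> G - (\<Union>i\<in>C. D i)) \<union> (\<Union>i\<in>C. Z i)"
    using BD(2) by blast
  then have neg: "negligible (E - (\<Union>i\<in>C. B i))"
    by (rule negligible_subset[rotated]) (intro negligible_Un G(2) C4 sph)
  have dis: "disjoint_family_on B C"
    unfolding disjoint_family_on_def using pw BD(1) by blast
  show thesis
    by (rule that[OF C(1) _ _ dis[unfolded B_def] sub[unfolded B_def] neg[unfolded B_def]])
      (use DG in auto)
qed

lemma emeasure_disjoint_balls_le:
  fixes M M' :: "real measure"
  assumes "countable C" "disjoint_family_on (\<lambda>i. ball (fst i) (snd i)) C"
    and "\<And>i. i \<in> C \<Longrightarrow> emeasure M (ball (fst i) (snd i)) \<le> c * emeasure M' (ball (fst i) (snd i))"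
    and "sets M = sets borel" "sets M' = sets borel"
  shows "emeasure M (\<Union>i\<in>C. ball (fst i) (snd i)) \<le> c * emeasure M' (\<Union>i\<in>C. ball (fst i) (snd i))"
proof -
  have "emeasure M (\<Union>i\<in>C. ball (fst i) (snd i)) = (\<integral>\<^sup>+i. emeasure M (ball (fst i) (snd i)) \<partial>count_space C)"
    by (rule emeasure_UN_countable) (use assms in auto)
  also have "\<dots> \<le> (\<integral>\<^sup>+i. c * emeasure M' (ball (fst i) (snd i)) \<partial>count_space C)"
    by (rule nn_integral_mono) (use assms in auto)
  also have "\<dots> = c * (\<integral>\<^sup>+i. emeasure M' (ball (fst i) (snd i)) \<partial>count_space C)"
    by (rule nn_integral_cmult) auto
  also have "(\<integral>\<^sup>+i. emeasure M' (ball (fst i) (snd i)) \<partial>count_space C)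
      = emeasure M' (\<Union>i\<in>C. ball (fst i) (snd i))"
    by (rule emeasure_UN_countable[symmetric]) (use assms in auto)
  finally show ?thesis .
qed

text \<open>Lebesgue's differentiation argument for the Stieltjes measure \<open>\<mu>\<close> of
  \<open>F\<close>. Covering \<open>E\<close> by flat intervals gives an open \<open>G1\<close>
  whose \<open>\<mu>\<close>-measure is at most \<open>\<alpha>\<close> times its length; covering
  again inside \<open>G1\<close> by steep ones gives \<open>G2\<close>, whose length is at most
  \<open>1/\<beta>\<close> times the \<open>\<mu>\<close>-measure of \<open>G1\<close>. Each round
  shrinks the length of an open set containing almost all of \<open>E\<close> by the factor
  \<open>\<alpha>/\<beta>\<close>.\<close>

lemma negligible_oscillating_slopes:
  fixes F :: "real \<Rightarrow> real"
  assumes mono: "\<And>x y. x \<le> y \<Longrightarrow> F x \<le> F y" and cont: "continuous_on UNIV F"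
    and ab: "0 < \<alpha>" "\<alpha> < \<beta>"
    and low: "\<And>x d. x \<in> E \<Longrightarrow> d > 0 \<Longrightarrow> \<exists>a r. 0 < r \<and> r < d \<and> x \<in> cball a r \<and> F (a+r) - F (a-r) \<le> \<alpha> * (2*r)"
    and high: "\<And>x d. x \<in> E \<Longrightarrow> d > 0 \<Longrightarrow> \<exists>a r. 0 < r \<and> r < d \<and> x \<in> cball a r \<and> F (a+r) - F (a-r) \<ge> \<beta> * (2*r)"
    and "bounded E"
  shows "negligible E"
proof -
  define \<mu> where "\<mu> = interval_measure F"
  have sets_mu: "sets \<mu> = sets borel" by (simp add: \<mu>_def)
  have mu_Icc: "emeasure \<mu> {a..b} = ennreal (F b - F a)" if "a \<le> b" for a b
    unfolding \<mu>_def using that mono cont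
    by (intro emeasure_interval_measure_Icc) (auto intro: continuous_on_subset)
  have cont': "continuous (at x within A) F" for x A
    using cont by (simp add: continuous_on_eq_continuous_at continuous_at_imp_continuous_within)
  have mu_Ioc: "emeasure \<mu> {a<..b} = ennreal (F b - F a)" if "a \<le> b" for a b
    unfolding \<mu>_def by (rule emeasure_interval_measure_Ioc) (use that mono cont' in auto)
  have mu_pt: "emeasure \<mu> {b} = 0" for b
    using mu_Icc[of b b] by simp
  have mu_ball: "emeasure \<mu> (ball a r) = ennreal (F (a+r) - F (a-r))" if "r > 0" for a r
  proof -
    have "{a-r<..a+r} = ball a r \<union> {a+r}" using that by (auto simp: ball_def dist_real_def)
    moreover have "emeasure \<mu> (ball a r) + emeasure \<mu> {a+r} = emeasure \<mu> (ball a r \<union> {a+r})"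
      using that by (intro plus_emeasure) (auto simp: sets_mu dist_real_def)
    ultimately have "emeasure \<mu> {a-r<..a+r} = emeasure \<mu> (ball a r) + emeasure \<mu> {a+r}"
      by (simp only:)
    then show ?thesis using mu_Ioc[of "a-r" "a+r"] mu_pt that by simp
  qed
  have lb_ball: "emeasure lborel (ball a r) = ennreal (2*r)" if "r > 0" for a r :: real
  proof -
    have "ball a r = {a-r<..<a+r}" by (auto simp: ball_def dist_real_def)
    then show ?thesis using that by simp
  qed
  have step: "\<exists>G'. open G' \<and> negligible (E - G') \<and> emeasure lborel G' \<le> ennreal (\<alpha>/\<beta>) * emeasure lborel G"
    if G: "open G" "negligible (E - G)" for G
  proof -
    obtain C where C: "countable C" "C \<subseteq> {(a,r). F (a+r) - F (a-r) \<le> \<alpha> * (2*r)}"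
      "\<And>i. i \<in> C \<Longrightarrow> 0 < snd i" "disjoint_family_on (\<lambda>i. ball (fst i) (snd i)) C"
      "(\<Union>i\<in>C. ball (fst i) (snd i)) \<subseteq> G" "negligible (E - (\<Union>i\<in>C. ball (fst i) (snd i)))"
    proof (rule Vitali_open_refinement[of E "{(a,r). F (a+r) - F (a-r) \<le> \<alpha> * (2*r)}" G])
      show "\<exists>(a,r)\<in>{(a,r). F (a+r) - F (a-r) \<le> \<alpha> * (2*r)}. 0 < r \<and> r < d \<and> x \<in> cball a r"
        if "x \<in> E" "d > 0" for x d using low[OF that] by blast
    qed (use G in auto)
    define G1 where "G1 = (\<Union>i\<in>C. ball (fst i) (snd i))"
    have G1: "open G1" "negligible (E - G1)" using C by (auto simp: G1_def)
    have m1: "emeasure \<mu> G1 \<le> ennreal \<alpha> * emeasure lborel G1"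
      unfolding G1_def
    proof (rule emeasure_disjoint_balls_le)
      fix i assume "i \<in> C"
      define a r where "a = fst i" "r = snd i"
      have "emeasure \<mu> (ball a r) \<le> ennreal \<alpha> * emeasure lborel (ball a r)"
      proof -
        have "F (a+r) - F (a-r) \<le> \<alpha> * (2*r)" "r > 0" using C(2,3) \<open>i \<in> C\<close> by (auto simp: a_r_def)
        moreover have "ennreal \<alpha> * ennreal (2*r) = ennreal (\<alpha> * (2*r))"
          using ab by (subst ennreal_mult') auto
        ultimately show ?thesis by (simp only: mu_ball lb_ball) (rule ennreal_leI)
      qed
      then show "emeasure \<mu> (ball (fst i) (snd i)) \<le> ennreal \<alpha> * emeasure lborel (ball (fst i) (snd i))"
        by (simp only: a_r_def)
    qed (use C sets_mu in auto)
    obtain C' where C': "countable C'" "C' \<subseteq> {(a,r). F (a+r) - F (a-r) \<ge> \<beta> * (2*r)}"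
      "\<And>i. i \<in> C' \<Longrightarrow> 0 < snd i" "disjoint_family_on (\<lambda>i. ball (fst i) (snd i)) C'"
      "(\<Union>i\<in>C'. ball (fst i) (snd i)) \<subseteq> G1" "negligible (E - (\<Union>i\<in>C'. ball (fst i) (snd i)))"
    proof (rule Vitali_open_refinement[of E "{(a,r). F (a+r) - F (a-r) \<ge> \<beta> * (2*r)}" G1])
      show "\<exists>(a,r)\<in>{(a,r). F (a+r) - F (a-r) \<ge> \<beta> * (2*r)}. 0 < r \<and> r < d \<and> x \<in> cball a r"
        if "x \<in> E" "d > 0" for x d using high[OF that] by blast
    qed (use G1 in auto)
    define G2 where "G2 = (\<Union>i\<in>C'. ball (fst i) (snd i))"
    have m2: "emeasure lborel G2 \<le> ennreal (1/\<beta>) * emeasure \<mu> G2"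
      unfolding G2_def
    proof (rule emeasure_disjoint_balls_le)
      fix i assume "i \<in> C'"
      define a r where "a = fst i" "r = snd i"
      have "emeasure lborel (ball a r) \<le> ennreal (1/\<beta>) * emeasure \<mu> (ball a r)"
      proof -
        have *: "F (a+r) - F (a-r) \<ge> \<beta> * (2*r)" "r > 0" using C'(2,3) \<open>i \<in> C'\<close> by (auto simp: a_r_def)
        have "ennreal (1/\<beta>) * ennreal (F (a+r) - F (a-r)) = ennreal (1/\<beta> * (F (a+r) - F (a-r)))"
          using ab by (subst ennreal_mult') auto
        moreover have "2*r \<le> 1/\<beta> * (F (a+r) - F (a-r))" using * ab by (simp add: field_simps)
        ultimately show ?thesis using *(2) by (simp only: mu_ball lb_ball) (rule ennreal_leI)
      qed
      then show "emeasure lborel (ball (fst i) (snd i)) \<le> ennreal (1/\<beta>) * emeasure \<mu> (ball (fst i) (snd i))"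
        by (simp only: a_r_def)
    qed (use C' sets_mu in auto)
    have "emeasure lborel G2 \<le> ennreal (1/\<beta>) * emeasure \<mu> G2" by (rule m2)
    also have "\<dots> \<le> ennreal (1/\<beta>) * emeasure \<mu> G1"
      using C'(5) G1 by (intro mult_left_mono emeasure_mono) (auto simp: G2_def sets_mu)
    also have "\<dots> \<le> ennreal (1/\<beta>) * (ennreal \<alpha> * emeasure lborel G1)"
      by (intro mult_left_mono m1) auto
    also have "\<dots> \<le> ennreal (1/\<beta>) * (ennreal \<alpha> * emeasure lborel G)"
      using C(5) G by (intro mult_left_mono emeasure_mono) (auto simp: G1_def)
    also have "\<dots> = ennreal (\<alpha>/\<beta>) * emeasure lborel G"
    proof -
      have "ennreal (1/\<beta>) * ennreal \<alpha> = ennreal (\<alpha>/\<beta>)"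
        using ab by (subst ennreal_mult'[symmetric]) auto
      then show ?thesis by (simp only: mult.assoc[symmetric])
    qed
    finally show ?thesis using C'(6) by (intro exI[of _ G2]) (auto simp: G2_def)
  qed
  \<comment> \<open>The iteration starts from a ball of finite length; here the boundedness of
    \<open>E\<close> enters.\<close>
  obtain R where R: "R > 0" "E \<subseteq> ball 0 R" using \<open>bounded E\<close> bounded_subset_ballD by blast
  have it: "\<exists>G. open G \<and> negligible (E - G) \<and> emeasure lborel G \<le> ennreal ((\<alpha>/\<beta>)^n * (2*R))" for n
  proof (induction n)
    case 0 then show ?case using R lb_ball by (intro exI[of _ "ball 0 R"]) (auto simp: Diff_eq_empty_iff[THEN iffD2])
  next
    case (Suc n)
    then obtain G where G: "open G" "negligible (E - G)" "emeasure lborel G \<le> ennreal ((\<alpha>/\<beta>)^n * (2*R))" by auto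
    obtain G' where G': "open G'" "negligible (E - G')" "emeasure lborel G' \<le> ennreal (\<alpha>/\<beta>) * emeasure lborel G"
      using step[OF G(1,2)] by auto
    have "emeasure lborel G' \<le> ennreal (\<alpha>/\<beta>) * ennreal ((\<alpha>/\<beta>)^n * (2*R))"
      using G' G by (meson mult_left_mono order_trans zero_le)
    then have "emeasure lborel G' \<le> ennreal ((\<alpha>/\<beta>)^Suc n * (2*R))"
      using ab R by (subst (asm) ennreal_mult'[symmetric]) (auto simp: mult.assoc)
    then show ?case using G' by blast
  qed
  show ?thesis
  proof (rule negligible_outer_le[THEN iffD2], intro allI impI)
    fix e :: real assume e: "e > 0"
    have "(\<lambda>n. (\<alpha>/\<beta>)^n * (2*R)) \<longlonglongrightarrow> 0"
      using ab by (intro tendsto_mult_left_zero LIMSEQ_realpow_zero) auto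
    then obtain n where n: "(\<alpha>/\<beta>)^n * (2*R) < e"
      using e by (metis (no_types, lifting) eventually_False_sequentially eventually_mono order_tendstoD(2))
    obtain G where G: "open G" "negligible (E - G)" "emeasure lborel G \<le> ennreal ((\<alpha>/\<beta>)^n * (2*R))"
      using it by blast
    have lm: "G \<in> lmeasurable" using G
      by (intro fmeasurableI) (auto simp: le_less_trans[OF _ ennreal_less_top])
    have "measure lebesgue G \<le> e"
    proof -
      have "measure lborel G \<le> (\<alpha>/\<beta>)^n * (2*R)"
        using G(3) ab R by (auto simp: measure_def intro!: enn2real_leI)
      then show ?thesis using n G(1) by simp
    qed
    moreover have "measure lebesgue (G \<union> (E - G)) \<le> measure lebesgue G + measure lebesgue (E - G)"
      using G lm by (intro measure_Un_le) (auto simp: negligible_iff_null_sets)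
    moreover have "measure lebesgue (E - G) = 0"
      using G(2) by (simp add: negligible_imp_measure0)
    ultimately show "\<exists>U. E \<subseteq> U \<and> U \<in> lmeasurable \<and> measure lebesgue U \<le> e"
      using fmeasurable.Un[OF lm negligible_imp_measurable[OF G(2)]]
      by (intro exI[of _ "G \<union> (E - G)"]) auto
  qed
qed

text \<open>The limit is the supremum of the eventual lower bounds. Rational pairs are enough by
  density, so that countably many exceptional sets account for every failure of convergence.\<close>

lemma convergent_filter_of_dichotomy:
  fixes Q :: "'a \<Rightarrow> real"
  assumes bd: "\<forall>\<^sub>F y in A. m \<le> Q y" "\<forall>\<^sub>F y in A. Q y \<le> M" and nb: "A \<noteq> bot"
    and dich: "\<And>\<alpha> \<beta>. \<alpha> \<in> \<rat> \<Longrightarrow> \<beta> \<in> \<rat> \<Longrightarrow> \<alpha> < \<beta> \<Longrightarrow> (\<forall>\<^sub>F y in A. \<alpha> \<le> Q y) \<or> (\<forall>\<^sub>F y in A. Q y \<le> \<beta>)"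
  shows "\<exists>l. (Q \<longlongrightarrow> l) A"
proof -
  define S where "S = {\<alpha>. \<forall>\<^sub>F y in A. \<alpha> \<le> Q y}"
  have mS: "m \<in> S" using bd by (simp add: S_def)
  have SM: "\<alpha> \<le> M" if "\<alpha> \<in> S" for \<alpha>
  proof -
    have "\<forall>\<^sub>F y in A. \<alpha> \<le> M"
      using that bd(2) unfolding S_def mem_Collect_eq by eventually_elim auto
    then show ?thesis using nb by (simp add: eventually_const_iff)
  qed
  then have bdd: "bdd_above S" by (auto simp: bdd_above_def)
  have "(Q \<longlongrightarrow> Sup S) A"
  proof (rule order_tendstoI)
    fix a assume "a < Sup S"
    then obtain \<alpha> where "\<alpha> \<in> S" "a < \<alpha>" using mS bdd by (metis empty_iff less_cSup_iff)
    then show "\<forall>\<^sub>F y in A. a < Q y" unfolding S_def mem_Collect_eq by (auto elim: eventually_mono)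
  next
    fix a assume a: "Sup S < a"
    then obtain \<alpha> where \<alpha>: "\<alpha> \<in> \<rat>" "Sup S < \<alpha>" "\<alpha> < a" using Rats_dense_in_real by blast
    then obtain \<beta> where \<beta>: "\<beta> \<in> \<rat>" "\<alpha> < \<beta>" "\<beta> < a" using Rats_dense_in_real by blast
    have "\<alpha> \<notin> S" using \<alpha> bdd cSup_upper by force
    then have "\<forall>\<^sub>F y in A. Q y \<le> \<beta>" using dich[of \<alpha> \<beta>] \<alpha> \<beta> by (auto simp: S_def)
    then show "\<forall>\<^sub>F y in A. Q y < a" using \<beta> by (auto elim: eventually_mono)
  qed
  then show ?thesis by blast
qed

text \<open>Adding \<open>(L+1) * x\<close> does not affect differentiability but puts all slopes
  between \<open>1\<close> and \<open>2*L+1\<close>, so that \<open>F\<close> has a Stieltjes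
  measure and bounded difference quotients. A point at which these quotients diverge lies in some
  \<open>E \<alpha> \<beta>\<close> with rational \<open>0 < \<alpha> < \<beta>\<close>.\<close>

lemma lipschitz_differentiable_ae:
  fixes f :: "real \<Rightarrow> real"
  assumes "L-lipschitz_on UNIV f"
  shows "negligible {x. \<not> f differentiable at x}"
proof -
  have L0: "L \<ge> 0" and L: "\<bar>f x - f y\<bar> \<le> L * \<bar>x - y\<bar>" for x y
    using assms unfolding lipschitz_on_def by (auto simp: dist_real_def)
  define F where "F x = f x + (L+1) * x" for x
  have lo: "F y - F x \<ge> y - x" if "x \<le> y" for x y
    using L[of y x] that unfolding F_def by (simp add: algebra_simps abs_le_iff)
  have mono: "F x \<le> F y" if "x \<le> y" for x y using lo[OF that] that by linarith
  have cont: "continuous_on UNIV F" unfolding F_def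
    using lipschitz_on_continuous_on[OF assms] by (intro continuous_intros)
  have FL: "\<bar>F y - F x\<bar> \<le> (2*L+1) * \<bar>y - x\<bar>" for x y
  proof -
    have "\<bar>F y - F x\<bar> \<le> \<bar>f y - f x\<bar> + \<bar>(L+1)*(y-x)\<bar>" unfolding F_def by (simp add: algebra_simps)
    also have "\<bar>(L+1)*(y-x)\<bar> = (L+1)*\<bar>y-x\<bar>" using L0 by (simp add: abs_mult)
    finally show ?thesis using L[of y x] by (simp add: algebra_simps)
  qed
  \<comment> \<open>The intervals only have to contain \<open>x\<close>, not to be centred there:
    the interval between \<open>x\<close> and \<open>y\<close> then qualifies, with centre
    \<open>(x+y)/2\<close> and radius \<open>\<bar>y-x\<bar>/2\<close>.\<close>
  define E where "E \<alpha> \<beta> = {x. (\<forall>d>0. \<exists>a r. 0 < r \<and> r < d \<and> x \<in> cball a r \<and> F (a+r) - F (a-r) \<le> \<alpha> * (2*r))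
      \<and> (\<forall>d>0. \<exists>a r. 0 < r \<and> r < d \<and> x \<in> cball a r \<and> F (a+r) - F (a-r) \<ge> \<beta> * (2*r))}" for \<alpha> \<beta>
  have negE: "negligible (E \<alpha> \<beta>)" if "0 < \<alpha>" "\<alpha> < \<beta>" for \<alpha> \<beta>
  proof -
    have "negligible (E \<alpha> \<beta> \<inter> ball 0 (real n))" for n
      by (rule negligible_oscillating_slopes[OF mono cont that]) (auto simp: E_def)
    then have "negligible (\<Union>n. E \<alpha> \<beta> \<inter> ball 0 (real n))"
      by (intro negligible_countable_Union countable_image) auto
    moreover have "E \<alpha> \<beta> \<subseteq> (\<Union>n. E \<alpha> \<beta> \<inter> ball 0 (real n))"
      using reals_Archimedean2 by fastforce
    ultimately show ?thesis using negligible_subset by blast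
  qed
  define Z where "Z = (\<Union>(\<alpha>,\<beta>) \<in> {(\<alpha>,\<beta>). \<alpha> \<in> \<rat> \<and> \<beta> \<in> \<rat> \<and> 0 < \<alpha> \<and> \<alpha> < \<beta>}. E \<alpha> \<beta>)"
  have "countable {(\<alpha>,\<beta>::real). \<alpha> \<in> \<rat> \<and> \<beta> \<in> \<rat> \<and> 0 < \<alpha> \<and> \<alpha> < (\<beta>::real)}"
    by (rule countable_subset[of _ "\<rat> \<times> \<rat>"]) (auto simp: countable_rat)
  then have negZ: "negligible Z" unfolding Z_def
    by (intro negligible_countable_Union) (auto simp: negE)
  have "f differentiable at x" if x: "x \<notin> Z" for x
  proof -
    define Q where "Q y = (F y - F x) / (y - x)" for y
    have Q1: "1 \<le> Q y" if "y \<noteq> x" for y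
    proof (cases "y > x")
      case True then show ?thesis using lo[of x y] by (simp add: Q_def field_simps)
    next
      case False then show ?thesis using lo[of y x] that by (simp add: Q_def divide_simps)
    qed
    have Q2: "Q y \<le> 2*L+1" if "y \<noteq> x" for y
    proof -
      have "\<bar>Q y\<bar> \<le> 2*L+1" using FL[of y x] that by (simp add: Q_def abs_divide divide_simps)
      then show ?thesis by linarith
    qed
    have slope: "x \<in> cball ((x+y)/2) (\<bar>y-x\<bar>/2) \<and> F ((x+y)/2 + \<bar>y-x\<bar>/2) - F ((x+y)/2 - \<bar>y-x\<bar>/2) = Q y * (2*(\<bar>y-x\<bar>/2))"
      if "y \<noteq> x" for y
    proof (cases "y > x")
      case True
      then have "(x+y)/2 + \<bar>y-x\<bar>/2 = y" "(x+y)/2 - \<bar>y-x\<bar>/2 = x" by (auto simp: field_simps)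
      then show ?thesis using True by (simp only:) (auto simp: Q_def dist_real_def field_simps)
    next
      case False
      then have "(x+y)/2 + \<bar>y-x\<bar>/2 = x" "(x+y)/2 - \<bar>y-x\<bar>/2 = y" by (auto simp: field_simps)
      then show ?thesis using False that by (simp only:) (auto simp: Q_def dist_real_def field_simps)
    qed
    have dich: "(\<forall>\<^sub>F y in at x. \<alpha> \<le> Q y) \<or> (\<forall>\<^sub>F y in at x. Q y \<le> \<beta>)"
      if ab: "\<alpha> \<in> \<rat>" "\<beta> \<in> \<rat>" "\<alpha> < \<beta>" for \<alpha> \<beta>
    proof (cases "0 < \<alpha>")
      case False
      then have "\<forall>\<^sub>F y in at x. \<alpha> \<le> Q y" using Q1
        by (auto simp: eventually_at intro!: exI[of _ 1] intro: order_trans[OF _ Q1])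
      then show ?thesis ..
    next
      case True
      then have "x \<notin> E \<alpha> \<beta>" using x ab by (auto simp: Z_def)
      then consider d where "d > 0" "\<And>a r. 0 < r \<Longrightarrow> r < d \<Longrightarrow> x \<in> cball a r \<Longrightarrow> \<not> F (a+r) - F (a-r) \<le> \<alpha> * (2*r)"
        | d where "d > 0" "\<And>a r. 0 < r \<Longrightarrow> r < d \<Longrightarrow> x \<in> cball a r \<Longrightarrow> \<not> F (a+r) - F (a-r) \<ge> \<beta> * (2*r)"
        unfolding E_def by blast
      then show ?thesis
      proof cases
        case 1
        have "\<alpha> \<le> Q y" if "y \<noteq> x" "dist y x < d" for y
        proof -
          have "\<not> Q y * (2*(\<bar>y-x\<bar>/2)) \<le> \<alpha> * (2*(\<bar>y-x\<bar>/2))"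
            using 1(2)[of "\<bar>y-x\<bar>/2" "(x+y)/2"] slope[OF that(1)] that by (auto simp: dist_real_def)
          then show ?thesis by (meson linear mult_right_mono abs_ge_zero divide_nonneg_nonneg mult_nonneg_nonneg zero_le_numeral)
        qed
        then show ?thesis using 1(1) by (auto simp: eventually_at)
      next
        case 2
        have "Q y \<le> \<beta>" if "y \<noteq> x" "dist y x < d" for y
        proof -
          have "\<not> Q y * (2*(\<bar>y-x\<bar>/2)) \<ge> \<beta> * (2*(\<bar>y-x\<bar>/2))"
            using 2(2)[of "\<bar>y-x\<bar>/2" "(x+y)/2"] slope[OF that(1)] that by (auto simp: dist_real_def)
          then show ?thesis by (meson linear mult_right_mono abs_ge_zero divide_nonneg_nonneg mult_nonneg_nonneg zero_le_numeral)
        qed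
        then show ?thesis using 2(1) by (auto simp: eventually_at)
      qed
    qed
    have "\<exists>l. (Q \<longlongrightarrow> l) (at x)"
      by (rule convergent_filter_of_dichotomy[OF _ _ _ dich, where m = 1 and M = "2*L+1"])
        (use Q1 Q2 in \<open>auto simp: eventually_at intro!: exI[of _ 1]\<close>)
    then obtain l where "(Q \<longlongrightarrow> l) (at x)" ..
    then have "(F has_real_derivative l) (at x)"
      unfolding has_field_derivative_iff Q_def .
    then have "((\<lambda>x. F x - (L+1) * x) has_real_derivative (l - (L+1))) (at x)"
      by (auto intro!: derivative_eq_intros)
    then show ?thesis unfolding F_def by (auto simp: real_differentiable_def)
  qed
  then have "{x. \<not> f differentiable at x} \<subseteq> Z" by auto
  then show ?thesis by (rule negligible_subset[OF negZ])
qed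

text \<open>The integral of the quotient \<open>(f (x + e) - f x) / e\<close> telescopes into
  averages of \<open>f\<close> over intervals of length \<open>e\<close> at \<open>b\<close> and at
  \<open>a\<close>, which tend to the end values by continuity. The quotients are bounded by the
  Lipschitz constant, so dominated convergence passes to the derivative.\<close>

lemma has_integral_lipschitz_derivative:
  fixes f :: "real \<Rightarrow> real"
  assumes lip: "L-lipschitz_on UNIV f" and N: "negligible N"
    and der: "\<And>x. x \<notin> N \<Longrightarrow> (f has_real_derivative g x) (at x)"
    and "a \<le> b"
  shows "(g has_integral (f b - f a)) {a..b}"
proof -
  have L: "\<bar>f x - f y\<bar> \<le> L * \<bar>x - y\<bar>" for x y
    using lip unfolding lipschitz_on_def by (auto simp: dist_real_def)
  have cf: "continuous_on S f" for S using lipschitz_on_continuous_on[OF lip] continuous_on_subset by blast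
  \<comment> \<open>The antiderivative reaches to \<open>b+1\<close> because the quotients shift the
    interval by \<open>e n\<close>, which is at most 1.\<close>
  obtain H where H: "\<And>x. x \<in> {a..b+1} \<Longrightarrow> (H has_vector_derivative f x) (at x within {a..b+1})"
    using antiderivative_continuous[OF cf, of a "b+1"] by blast
  define e where "e n = inverse (real (Suc n))" for n
  have e: "0 < e n" "e n \<le> 1" for n by (auto simp: e_def field_simps)
  define D where "D n x = (if x \<in> N then 0 else (f (x + e n) - f x) / e n)" for n x
  define g' where "g' x = (if x \<in> N then 0 else g x)" for x
  have intD: "(D n has_integral ((H (b + e n) - H b) / e n - (H (a + e n) - H a) / e n)) {a..b}" for n
  proof -
    have "((\<lambda>x. (f (x + e n) - f x) / e n) has_integral
        ((H (b + e n) - H b) / e n - (H (a + e n) - H a) / e n)) {a..b}"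
    proof -
      have h1: "((\<lambda>x. H (x + e n)) has_vector_derivative f (x + e n)) (at x within {a..b})" if "x \<in> {a..b}" for x
      proof -
        have "(H has_vector_derivative f (x + e n)) (at (x + e n) within (\<lambda>x. x + e n) ` {a..b})"
          using H[of "x + e n"] that e[of n] by (intro has_vector_derivative_within_subset[OF H]) auto
        then have "(H \<circ> (\<lambda>x. x + e n) has_vector_derivative 1 *\<^sub>R f (x + e n)) (at x within {a..b})"
          by (intro vector_diff_chain_within) (auto intro!: derivative_eq_intros)
        then show ?thesis by (simp add: o_def)
      qed
      have h2: "(H has_vector_derivative f x) (at x within {a..b})" if "x \<in> {a..b}" for x
        using that by (intro has_vector_derivative_within_subset[OF H]) auto
      have "((\<lambda>x. f (x + e n) - f x) has_integral ((H (b + e n) - H b) - (H (a + e n) - H a))) {a..b}"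
        by (rule fundamental_theorem_of_calculus[OF \<open>a \<le> b\<close>, of "\<lambda>x. H (x + e n) - H x"])
          (intro has_vector_derivative_diff h1 h2)
      from has_integral_mult_left[OF this, of "1 / e n"] show ?thesis by (simp add: diff_divide_distrib)
    qed
    then show ?thesis
      by (rule has_integral_spike[OF N, rotated]) (auto simp: D_def)
  qed
  have e0: "e \<longlonglongrightarrow> 0" unfolding e_def using LIMSEQ_inverse_real_of_nat by simp
  have e0': "filterlim e (at_right 0) sequentially"
  proof -
    have "e n \<noteq> 0" for n using e[of n] by simp
    then show ?thesis using e0 e by (auto simp: filterlim_at)
  qed
  have conv: "(\<lambda>n. (H (x + e n) - H x) / e n) \<longlonglongrightarrow> f x" if "x \<in> {a..b}" for x
  proof -
    have "(H has_real_derivative f x) (at x within {x..b+1})"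
      using H[of x] that DERIV_subset[of H "f x" x "{a..b+1}" "{x..b+1}"] by (auto simp: has_real_derivative_iff_has_vector_derivative)
    then have "((\<lambda>y. (H y - H x)/(y - x)) \<longlongrightarrow> f x) (at x within {x..b+1})"
      by (simp add: has_field_derivative_iff)
    moreover have "filterlim (\<lambda>n. x + e n) (at x within {x..b+1}) sequentially"
      unfolding filterlim_at using e that tendsto_add[OF tendsto_const[of x] e0]
      by (auto simp: less_imp_le add_mono intro!: always_eventually)
        (use e in \<open>smt (verit, best)\<close>)+
    ultimately have "(\<lambda>n. (H (x + e n) - H x)/(x + e n - x)) \<longlonglongrightarrow> f x" by (rule filterlim_compose)
    then show ?thesis by simp
  qed
  have lim: "(\<lambda>n. integral {a..b} (D n)) \<longlonglongrightarrow> f b - f a"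
    unfolding integral_unique[OF intD] using conv[of a] conv[of b] \<open>a \<le> b\<close> by (intro tendsto_diff) auto
  have Dlim: "(\<lambda>n. D n x) \<longlonglongrightarrow> g' x" for x
  proof (cases "x \<in> N")
    case False
    have "((\<lambda>h. (f (x + h) - f x) / h) \<longlongrightarrow> g x) (at 0)" using der[OF False] by (simp add: DERIV_def)
    moreover have "filterlim e (at 0) sequentially" using e0' by (rule filterlim_mono) (auto simp: at_le)
    ultimately have "(\<lambda>n. (f (x + e n) - f x) / e n) \<longlonglongrightarrow> g x" by (rule filterlim_compose)
    then show ?thesis using False by (simp add: D_def g'_def)
  qed (simp add: D_def g'_def)
  have Dle: "norm (D n x) \<le> \<bar>L\<bar>" for n x
    using L[of "x + e n" x] e[of n] by (auto simp: D_def abs_divide divide_simps) (smt (verit) mult_right_mono abs_ge_self)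
  have "g' integrable_on {a..b}" "(\<lambda>n. integral {a..b} (D n)) \<longlonglongrightarrow> integral {a..b} g'"
    by (rule dominated_convergence[of D "{a..b}" "\<lambda>_. \<bar>L\<bar>"]; use intD Dle Dlim in auto)+
  then have "(g' has_integral (f b - f a)) {a..b}"
    using LIMSEQ_unique[OF lim] by (simp add: has_integral_integrable_integral)
  then show ?thesis
    by (rule has_integral_spike[OF N, rotated]) (auto simp: g'_def)
qed

section \<open>Norms on the torus\<close>

lemma AE_lebesgue_iff_negligible: "(AE x in lebesgue. P x) \<longleftrightarrow> negligible {x. \<not> P x}"
  by (simp add: completion.AE_iff_null_sets negligible_iff_null_sets)

section \<open>Locally essentially bounded functions and their integrals\<close>

text \<open>The class has to contain almost everywhere derivatives, bounded off a null set only, and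
  exponential weights, bounded on bounded intervals only. It is closed under products, and its
  members are integrable on compact intervals.\<close>

definition loc_ess_bounded :: "(real \<Rightarrow> real) \<Rightarrow> bool" where
  "loc_ess_bounded f \<longleftrightarrow> f \<in> borel_measurable lebesgue \<and>
     (\<forall>a b. \<exists>C. AE x in lebesgue. x \<in> {a..b} \<longrightarrow> \<bar>f x\<bar> \<le> C)"

lemma loc_ess_boundedI_bounded:
  assumes "f \<in> borel_measurable lebesgue" "AE x in lebesgue. \<bar>f x\<bar> \<le> C"
  shows "loc_ess_bounded f"
  unfolding loc_ess_bounded_def using assms by (auto intro!: exI[of _ C] elim: eventually_mono)

lemma loc_ess_bounded_continuous:
  assumes "continuous_on UNIV f"
  shows "loc_ess_bounded f"
  unfolding loc_ess_bounded_def
proof (intro conjI allI)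
  show "f \<in> borel_measurable lebesgue"
    using borel_measurable_continuous_onI[OF assms] by (simp add: measurable_completion)
  fix a b
  have "bounded (f ` {a..b})"
    by (intro compact_imp_bounded compact_continuous_image continuous_on_subset[OF assms]) auto
  then obtain C where "\<forall>x\<in>f ` {a..b}. norm x \<le> C" unfolding bounded_iff ..
  then show "\<exists>C. AE x in lebesgue. x \<in> {a..b} \<longrightarrow> \<bar>f x\<bar> \<le> C"
    by (intro exI[of _ C]) auto
qed

lemma loc_ess_bounded_const [simp]: "loc_ess_bounded (\<lambda>_. c)"
  by (rule loc_ess_bounded_continuous) auto

lemma loc_ess_bounded_add:
  assumes "loc_ess_bounded f" "loc_ess_bounded g"
  shows "loc_ess_bounded (\<lambda>x. f x + g x)"
  unfolding loc_ess_bounded_def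
proof (intro conjI allI)
  show "(\<lambda>x. f x + g x) \<in> borel_measurable lebesgue"
    using assms unfolding loc_ess_bounded_def by auto
  fix a b
  obtain C D where "AE x in lebesgue. x \<in> {a..b} \<longrightarrow> \<bar>f x\<bar> \<le> C" "AE x in lebesgue. x \<in> {a..b} \<longrightarrow> \<bar>g x\<bar> \<le> D"
    using assms unfolding loc_ess_bounded_def by blast
  then have "AE x in lebesgue. x \<in> {a..b} \<longrightarrow> \<bar>f x + g x\<bar> \<le> C + D" by eventually_elim auto
  then show "\<exists>C. AE x in lebesgue. x \<in> {a..b} \<longrightarrow> \<bar>f x + g x\<bar> \<le> C" ..
qed

lemma loc_ess_bounded_mult:
  assumes "loc_ess_bounded f" "loc_ess_bounded g"
  shows "loc_ess_bounded (\<lambda>x. f x * g x)"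
  unfolding loc_ess_bounded_def
proof (intro conjI allI)
  show "(\<lambda>x. f x * g x) \<in> borel_measurable lebesgue"
    using assms unfolding loc_ess_bounded_def by auto
  fix a b
  obtain C D where "AE x in lebesgue. x \<in> {a..b} \<longrightarrow> \<bar>f x\<bar> \<le> C" "AE x in lebesgue. x \<in> {a..b} \<longrightarrow> \<bar>g x\<bar> \<le> D"
    using assms unfolding loc_ess_bounded_def by blast
  then have "AE x in lebesgue. x \<in> {a..b} \<longrightarrow> \<bar>f x * g x\<bar> \<le> C * D"
    by eventually_elim (auto simp: abs_mult intro!: mult_mono intro: order_trans[OF abs_ge_zero])
  then show "\<exists>C. AE x in lebesgue. x \<in> {a..b} \<longrightarrow> \<bar>f x * g x\<bar> \<le> C" ..
qed

lemma loc_ess_bounded_minus: "loc_ess_bounded f \<Longrightarrow> loc_ess_bounded (\<lambda>x. - f x)"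
  using loc_ess_bounded_mult[OF loc_ess_bounded_const[of "-1"]] by simp

lemma loc_ess_bounded_diff:
  "loc_ess_bounded f \<Longrightarrow> loc_ess_bounded g \<Longrightarrow> loc_ess_bounded (\<lambda>x. f x - g x)"
  using loc_ess_bounded_add[OF _ loc_ess_bounded_minus] by fastforce

lemma loc_ess_bounded_power2: "loc_ess_bounded f \<Longrightarrow> loc_ess_bounded (\<lambda>x. (f x)\<^sup>2)"
  by (simp add: power2_eq_square loc_ess_bounded_mult)

lemma loc_ess_bounded_divide_const: "loc_ess_bounded f \<Longrightarrow> loc_ess_bounded (\<lambda>x. f x / c)"
  using loc_ess_bounded_mult[OF _ loc_ess_bounded_const[of "1/c"]] by fastforce

lemma loc_ess_bounded_abs: "loc_ess_bounded f \<Longrightarrow> loc_ess_bounded (\<lambda>x. \<bar>f x\<bar>)"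
  unfolding loc_ess_bounded_def by auto

lemmas loc_ess_bounded_intros = loc_ess_bounded_const loc_ess_bounded_add loc_ess_bounded_mult
  loc_ess_bounded_minus loc_ess_bounded_diff loc_ess_bounded_power2 loc_ess_bounded_divide_const
  loc_ess_bounded_abs

lemma loc_ess_bounded_set_integrable:
  assumes "loc_ess_bounded f"
  shows "set_integrable lebesgue {a..b} f"
proof -
  obtain C where C: "AE x in lebesgue. x \<in> {a..b} \<longrightarrow> \<bar>f x\<bar> \<le> C"
    using assms unfolding loc_ess_bounded_def by blast
  have [measurable]: "f \<in> borel_measurable lebesgue" using assms by (simp add: loc_ess_bounded_def)
  have "set_integrable lebesgue {a..b} (\<lambda>_. C)"
    by (auto simp: absolutely_integrable_on_const)
  then show ?thesis unfolding set_integrable_def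
  proof (rule Bochner_Integration.integrable_bound)
    show "(\<lambda>x. indicat_real {a..b} x *\<^sub>R f x) \<in> borel_measurable lebesgue"
      by (intro borel_measurable_scaleR borel_measurable_indicator) auto
    show "AE x in lebesgue. norm (indicat_real {a..b} x *\<^sub>R f x) \<le> norm (indicat_real {a..b} x *\<^sub>R C)"
      using C by eventually_elim (auto simp: indicator_def)
  qed
qed

lemma loc_ess_bounded_integrable_on: "loc_ess_bounded f \<Longrightarrow> f integrable_on {a..b}"
  using loc_ess_bounded_set_integrable set_lebesgue_integral_eq_integral(1) by blast

lemma loc_ess_bounded_LINT: "loc_ess_bounded f \<Longrightarrow> (LINT x:{a..b}|lebesgue. f x) = integral {a..b} f"
  using loc_ess_bounded_set_integrable set_lebesgue_integral_eq_integral(2) by blast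

lemma integral_mono_AE:
  assumes "loc_ess_bounded f" "loc_ess_bounded g" "AE x in lebesgue. x \<in> {a..b} \<longrightarrow> f x \<le> g x"
  shows "integral {a..b} f \<le> integral {a..b} g"
proof -
  have "integral {a..b} f \<le> integral {a..b} (\<lambda>x. if f x \<le> g x \<or> x \<notin> {a..b} then g x else f x)"
  proof (rule integral_le)
    have *: "(g has_integral integral {a..b} g) {a..b}"
      using assms(2) by (simp add: integrable_integral loc_ess_bounded_integrable_on)
    have "((\<lambda>x. if f x \<le> g x \<or> x \<notin> {a..b} then g x else f x) has_integral integral {a..b} g) {a..b}"
      by (rule has_integral_spike[OF _ _ *, of "{x. \<not> (x \<in> {a..b} \<longrightarrow> f x \<le> g x)}"])
        (use assms(3) in \<open>auto simp: AE_lebesgue_iff_negligible\<close>)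
    then show "(\<lambda>x. if f x \<le> g x \<or> x \<notin> {a..b} then g x else f x) integrable_on {a..b}" by blast
  qed (use assms in \<open>auto simp: loc_ess_bounded_integrable_on\<close>)
  also have "\<dots> = integral {a..b} g"
    by (rule integral_spike[of "{x. \<not> (x \<in> {a..b} \<longrightarrow> f x \<le> g x)}"])
      (use assms(3) in \<open>auto simp: AE_lebesgue_iff_negligible\<close>)
  finally show ?thesis .
qed

lemma integral_abs_le:
  assumes "loc_ess_bounded f"
  shows "\<bar>integral {a..b} f\<bar> \<le> integral {a..b} (\<lambda>x. \<bar>f x\<bar>)"
  using integral_norm_bound_integral[of f "{a..b}" "\<lambda>x. \<bar>f x\<bar>"] assms
  by (auto simp: loc_ess_bounded_integrable_on loc_ess_bounded_abs)

text \<open>Nonnegativity of the variance: the square of \<open>f - c\<close>, with \<open>c\<close>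
  the mean value, has a nonnegative integral.\<close>

lemma Cauchy_Schwarz_interval:
  assumes f: "loc_ess_bounded f" and ab: "a < b"
  shows "(integral {a..b} f)\<^sup>2 \<le> (b - a) * integral {a..b} (\<lambda>x. (f x)\<^sup>2)"
proof -
  define c where "c = integral {a..b} f / (b - a)"
  have i: "f integrable_on {a..b}" "(\<lambda>x. (f x)\<^sup>2) integrable_on {a..b}"
    using f by (auto intro!: loc_ess_bounded_integrable_on loc_ess_bounded_intros)
  have "0 \<le> integral {a..b} (\<lambda>x. (f x - c)\<^sup>2)"
    by (rule integral_nonneg) (auto intro!: loc_ess_bounded_integrable_on loc_ess_bounded_intros f)
  also have "(\<lambda>x. (f x - c)\<^sup>2) = (\<lambda>x. (f x)\<^sup>2 - 2 * c * f x + c\<^sup>2)"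
    by (auto simp: power2_eq_square algebra_simps)
  also have "integral {a..b} (\<lambda>x. (f x)\<^sup>2 - 2 * c * f x + c\<^sup>2) =
      integral {a..b} (\<lambda>x. (f x)\<^sup>2) - 2 * c * integral {a..b} f + c\<^sup>2 * (b - a)"
  proof (rule integral_unique)
    have "((\<lambda>x. (f x)\<^sup>2 - 2 * c * f x + c\<^sup>2) has_integral
        integral {a..b} (\<lambda>x. (f x)\<^sup>2) - 2 * c * integral {a..b} f + (b - a) *\<^sub>R c\<^sup>2) {a..b}"
      using has_integral_const_real[of "c\<^sup>2" a b] ab
      by (intro has_integral_add has_integral_diff has_integral_mult_right integrable_integral i) auto
    then show "((\<lambda>x. (f x)\<^sup>2 - 2 * c * f x + c\<^sup>2) has_integral
        integral {a..b} (\<lambda>x. (f x)\<^sup>2) - 2 * c * integral {a..b} f + c\<^sup>2 * (b - a)) {a..b}"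
      by (simp add: mult.commute)
  qed
  also have "\<dots> = integral {a..b} (\<lambda>x. (f x)\<^sup>2) - (integral {a..b} f)\<^sup>2 / (b - a)"
  proof -
    have 1: "c * (b - a) = integral {a..b} f" using ab by (simp add: c_def)
    have "c\<^sup>2 * (b - a) = c * integral {a..b} f" by (simp add: 1[symmetric] power2_eq_square)
    moreover have "c * integral {a..b} f = (integral {a..b} f)\<^sup>2 / (b - a)"
      by (simp add: c_def power2_eq_square)
    ultimately show ?thesis by simp
  qed
  finally show ?thesis using ab by (simp add: field_simps)
qed

text \<open>An interval of length at most 1 lies in two consecutive cells between integers, whence
  the factor 2.\<close>

lemma integral_periodic_le:
  assumes g: "loc_ess_bounded g" "\<And>x. g x \<ge> 0" and per: "\<And>x. g (x + 1) = g x"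
    and xy: "x \<le> y" "y \<le> x + 1"
  shows "integral {x..y} g \<le> 2 * integral {0..1} g"
proof -
  interpret periodic_fun_simple' g by unfold_locales (rule per)
  define n where "n = real_of_int \<lfloor>x\<rfloor>"
  have n: "n \<le> x" "x \<le> n + 1" unfolding n_def by linarith+
  have i: "g integrable_on {a..b}" for a b using g loc_ess_bounded_integrable_on by blast
  have sh: "integral {of_int m..of_int m + 1} g = integral {0..1} g" for m
    using integral_shift_real_ivl[of "of_int m" "of_int m" "of_int m + 1" g]
    by (simp add: plus_of_int)
  have "integral {x..y} g \<le> integral {n..n+2} g"
    by (rule integral_subset_le) (use n xy i g in auto)
  also have "\<dots> = integral {n..n+1} g + integral {n+1..n+2} g"
    by (rule Henstock_Kurzweil_Integration.integral_combine[symmetric]) (use i in auto)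
  also have "\<dots> = 2 * integral {0..1} g"
    using sh[of "\<lfloor>x\<rfloor>"] sh[of "\<lfloor>x\<rfloor> + 1"] by (simp add: n_def add.assoc)
  finally show ?thesis .
qed

lemma Linf_torus_loc_ess_bounded: "f \<in> Linf_torus \<Longrightarrow> loc_ess_bounded f"
  unfolding Linf_torus_def using loc_ess_boundedI_bounded by blast

section \<open>The L^2 norm and integrals over short intervals\<close>

lemma integral_abs_le_L2:
  assumes f: "loc_ess_bounded f" and B: "integral {0..1} (\<lambda>x. (f x)\<^sup>2) \<le> N\<^sup>2" and N: "N \<ge> 0"
  shows "integral {0..1} (\<lambda>x. \<bar>f x\<bar>) \<le> N"
proof -
  have "(integral {0..1} (\<lambda>x. \<bar>f x\<bar>))\<^sup>2 \<le> (1 - 0) * integral {0..1} (\<lambda>x. \<bar>f x\<bar>\<^sup>2)"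
    by (rule Cauchy_Schwarz_interval) (auto intro!: loc_ess_bounded_intros f)
  then have "(integral {0..1} (\<lambda>x. \<bar>f x\<bar>))\<^sup>2 \<le> N\<^sup>2" using B by simp
  then show ?thesis by (rule power2_le_imp_le[OF _ N])
qed

lemma L2_norm_torus_nonneg: "L2_norm_torus f \<ge> 0"
  unfolding L2_norm_torus_def set_lebesgue_integral_def
  by (intro real_sqrt_ge_zero Bochner_Integration.integral_nonneg) auto

lemma L2_norm_torus_power2:
  assumes "f \<in> Linf_torus"
  shows "integral {0..1} (\<lambda>x. (f x)\<^sup>2) = (L2_norm_torus f)\<^sup>2"
  using Linf_torus_loc_ess_bounded[OF assms]
  by (simp add: L2_norm_torus_def loc_ess_bounded_LINT loc_ess_bounded_power2 integral_nonneg loc_ess_bounded_integrable_on)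

text \<open>It turns the time derivative of \<open>u\<close>, known only in L^2, into information on
  integrals over intervals. The bound does not depend on the position of the interval, which may
  therefore move with time.\<close>

lemma integral_le_L2_norm_torus:
  assumes f: "f \<in> Linf_torus" and xy: "x \<le> y" "y \<le> x + 1"
  shows "\<bar>integral {x..y} f\<bar> \<le> 2 * L2_norm_torus f"
proof -
  have b: "loc_ess_bounded f" using Linf_torus_loc_ess_bounded[OF f] .
  have "\<bar>integral {x..y} f\<bar> \<le> integral {x..y} (\<lambda>x. \<bar>f x\<bar>)" by (rule integral_abs_le[OF b])
  also have "\<dots> \<le> 2 * integral {0..1} (\<lambda>x. \<bar>f x\<bar>)"
    by (rule integral_periodic_le) (use f xy b in \<open>auto simp: Linf_torus_def intro!: loc_ess_bounded_intros\<close>)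
  also have "integral {0..1} (\<lambda>x. \<bar>f x\<bar>) \<le> L2_norm_torus f"
    by (rule integral_abs_le_L2) (auto simp: b L2_norm_torus_power2[OF f] L2_norm_torus_nonneg)
  finally show ?thesis by simp
qed

section \<open>Almost everywhere derivatives of Lipschitz functions\<close>

lemma lipschitz_on_deriv_AE:
  fixes f :: "real \<Rightarrow> real"
  assumes "L-lipschitz_on UNIV f"
  shows "AE x in lebesgue. (f has_real_derivative deriv f x) (at x)"
proof -
  have "{x. \<not> (f has_real_derivative deriv f x) (at x)} = {x. \<not> f differentiable at x}"
    using DERIV_deriv_iff_real_differentiable by auto
  then show ?thesis unfolding AE_lebesgue_iff_negligible
    using lipschitz_differentiable_ae[OF assms] by simp
qed

lemma lipschitz_DERIV_abs_le:
  fixes f :: "real \<Rightarrow> real"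
  assumes "L-lipschitz_on UNIV f" "(f has_real_derivative D) (at x)"
  shows "\<bar>D\<bar> \<le> L"
proof -
  have "((\<lambda>y. \<bar>(f y - f x) / (y - x)\<bar>) \<longlongrightarrow> \<bar>D\<bar>) (at x)"
    using assms(2) unfolding has_field_derivative_iff by (rule tendsto_rabs)
  moreover have "\<forall>\<^sub>F y in at x. \<bar>(f y - f x) / (y - x)\<bar> \<le> L"
    using assms(1) unfolding lipschitz_on_def
    by (auto simp: eventually_at_filter dist_real_def divide_simps intro!: always_eventually)
  ultimately show ?thesis by (rule tendsto_upperbound) simp
qed

lemma lipschitz_deriv_le_AE:
  fixes f :: "real \<Rightarrow> real"
  assumes "L-lipschitz_on UNIV f"
  shows "AE x in lebesgue. \<bar>deriv f x\<bar> \<le> L"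
  using lipschitz_on_deriv_AE[OF assms] by eventually_elim (rule lipschitz_DERIV_abs_le[OF assms])

text \<open>Off a null set \<open>g\<close> is a pointwise limit of continuous difference quotients,
  and completeness of the measure absorbs the null set.\<close>

lemma borel_measurable_AE_derivative:
  fixes f :: "real \<Rightarrow> real"
  assumes "continuous_on UNIV f" "AE x in lebesgue. (f has_real_derivative g x) (at x)"
  shows "g \<in> borel_measurable lebesgue"
proof -
  define N where "N = {x. \<not> (f has_real_derivative g x) (at x)}"
  have N: "N \<in> null_sets lebesgue"
    using assms(2) by (simp add: AE_lebesgue_iff_negligible N_def negligible_iff_null_sets)
  then have [measurable]: "N \<in> sets lebesgue" by auto
  define e where "e n = inverse (real (Suc n))" for n
  have "continuous_on UNIV (\<lambda>x. (f (x + e n) - f x) / e n)" for n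
    by (intro continuous_intros continuous_on_compose2[OF assms(1)] continuous_on_subset[OF assms(1)]) (auto simp: e_def)
  then have [measurable]: "(\<lambda>x. (f (x + e n) - f x) / e n) \<in> borel_measurable lebesgue" for n
    using loc_ess_bounded_continuous loc_ess_bounded_def by blast
  have "(\<lambda>x. if x \<in> N then 0 else g x) \<in> borel_measurable lebesgue"
  proof (rule borel_measurable_LIMSEQ_real)
    show "(\<lambda>x. if x \<in> N then 0 else (f (x + e n) - f x) / e n) \<in> borel_measurable lebesgue" for n
      by measurable
    fix x
    have "filterlim e (at 0) sequentially"
      unfolding filterlim_at e_def using LIMSEQ_inverse_real_of_nat by auto
    moreover have "((\<lambda>h. (f (x + h) - f x) / h) \<longlongrightarrow> g x) (at 0)" if "x \<notin> N"
      using that by (simp add: DERIV_def N_def)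
    ultimately show "(\<lambda>n. if x \<in> N then 0 else (f (x + e n) - f x) / e n) \<longlonglongrightarrow> (if x \<in> N then 0 else g x)"
      by (auto intro: filterlim_compose)
  qed
  moreover have "AE x in lebesgue. (if x \<in> N then 0 else g x) = g x"
    using AE_not_in[OF N] by eventually_elim auto
  ultimately show ?thesis by (rule borel_measurable_AE)
qed

lemma loc_ess_bounded_deriv:
  assumes "L-lipschitz_on UNIV f"
  shows "loc_ess_bounded (deriv f)"
  by (rule loc_ess_boundedI_bounded[OF borel_measurable_AE_derivative lipschitz_deriv_le_AE[OF assms]])
    (use lipschitz_on_continuous_on[OF assms] lipschitz_on_deriv_AE[OF assms] in auto)

text \<open>Precomposition with the clamp \<open>c\<close> extends \<open>f\<close> by its end
  values to a Lipschitz function on the line, with derivative \<open>g\<close> inside the interval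
  and 0 outside. The hypothesis is local because products with exponentials of the flow are
  Lipschitz on bounded intervals but in general not on the line.\<close>

lemma fundamental_theorem_lipschitz_on:
  fixes f :: "real \<Rightarrow> real"
  assumes lip: "L-lipschitz_on {a..b} f" and der: "AE x in lebesgue. (f has_real_derivative g x) (at x)"
    and ab: "a \<le> b"
  shows "(g has_integral (f b - f a)) {a..b}"
proof -
  define c where "c x = max a (min b x)" for x
  have c: "c x \<in> {a..b}" "\<bar>c x - c y\<bar> \<le> \<bar>x - y\<bar>" for x y using ab by (auto simp: c_def)
  have L0: "L \<ge> 0" using lip lipschitz_on_nonneg by blast
  have lip': "L-lipschitz_on UNIV (\<lambda>x. f (c x))"
  proof (rule lipschitz_onI[OF _ L0])
    fix x y
    have "dist (f (c x)) (f (c y)) \<le> L * dist (c x) (c y)"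
      using lip c unfolding lipschitz_on_def by blast
    also have "\<dots> \<le> L * dist x y" using c(2)[of x y] L0 by (auto simp: dist_real_def intro!: mult_left_mono)
    finally show "dist (f (c x)) (f (c y)) \<le> L * dist x y" .
  qed
  \<comment> \<open>The end points join the null set, since the clamped function may have corners
    there.\<close>
  define N where "N = {x. \<not> (f has_real_derivative g x) (at x)} \<union> {a,b}"
  have N: "negligible N" using der by (simp add: N_def AE_lebesgue_iff_negligible)
  have "((\<lambda>x. if x \<in> {a..b} then g x else 0) has_integral (f (c b) - f (c a))) {a..b}"
  proof (rule has_integral_lipschitz_derivative[OF lip' N _ ab])
    fix x assume x: "x \<notin> N"
    consider "x < a" | "a < x" "x < b" | "x > b" using x by (fastforce simp: N_def)
    then show "((\<lambda>x. f (c x)) has_real_derivative (if x \<in> {a..b} then g x else 0)) (at x)"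
    proof cases
      case 1
      have "((\<lambda>x. f a) has_real_derivative 0) (at x)" by simp
      then have "((\<lambda>x. f (c x)) has_real_derivative 0) (at x)"
        by (rule has_field_derivative_transform_within_open[of _ _ _ "{..<a}"]) (use 1 ab in \<open>auto simp: c_def\<close>)
      then show ?thesis using 1 by simp
    next
      case 2
      have "(f has_real_derivative g x) (at x)" using x by (simp add: N_def)
      then have "((\<lambda>x. f (c x)) has_real_derivative g x) (at x)"
        by (rule has_field_derivative_transform_within_open[of _ _ _ "{a<..<b}"]) (use 2 in \<open>auto simp: c_def\<close>)
      then show ?thesis using 2 by simp
    next
      case 3
      have "((\<lambda>x. f b) has_real_derivative 0) (at x)" by simp
      then have "((\<lambda>x. f (c x)) has_real_derivative 0) (at x)"
        by (rule has_field_derivative_transform_within_open[of _ _ _ "{b<..}"]) (use 3 ab in \<open>auto simp: c_def\<close>)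
      then show ?thesis using 3 by simp
    qed
  qed
  moreover have "c a = a" "c b = b" using ab by (auto simp: c_def)
  ultimately have "((\<lambda>x. if x \<in> {a..b} then g x else 0) has_integral (f b - f a)) {a..b}" by simp
  then show ?thesis by (rule has_integral_eq[rotated]) simp
qed

lemma fundamental_theorem_lipschitz:
  fixes f :: "real \<Rightarrow> real"
  assumes "L-lipschitz_on UNIV f" "x \<le> y"
  shows "(deriv f has_integral (f y - f x)) {x..y}"
  using assms by (intro fundamental_theorem_lipschitz_on lipschitz_on_deriv_AE)
    (auto intro: lipschitz_on_subset)

lemma deriv_periodic:
  assumes "\<And>x::real. f (x + 1) = f x"
  shows "deriv f (x + 1) = deriv f x"
proof -
  have "f = (\<lambda>x. f (1 + x))" using assms by (auto simp: add.commute)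
  then have "(f has_field_derivative D) (at (x + 1)) \<longleftrightarrow> (f has_field_derivative D) (at x)" for D
    using DERIV_shift[of f D x 1] by (simp add: add.commute)
  then show ?thesis by (simp add: deriv_def)
qed

lemma Lip_torusE:
  assumes "f \<in> Lip_torus"
  obtains L where "L-lipschitz_on UNIV f" "\<forall>x. f (x + 1) = f x"
  using assms unfolding Lip_torus_def by auto

section \<open>Sobolev inequalities in one dimension\<close>

lemma H1_norm_torus_nonneg: "H1_norm_torus f \<ge> 0"
  unfolding H1_norm_torus_def set_lebesgue_integral_def
  by (intro real_sqrt_ge_zero Bochner_Integration.integral_nonneg) auto

lemma Lip_torus_continuous: "f \<in> Lip_torus \<Longrightarrow> continuous_on S f"
  by (auto simp: Lip_torus_def intro: lipschitz_on_continuous_on lipschitz_on_subset)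

lemma Lip_torus_loc_ess_bounded: "f \<in> Lip_torus \<Longrightarrow> loc_ess_bounded f"
  by (simp add: loc_ess_bounded_continuous Lip_torus_continuous)

lemma Lip_torus_deriv_loc_ess_bounded: "f \<in> Lip_torus \<Longrightarrow> loc_ess_bounded (deriv f)"
  by (auto simp: Lip_torus_def intro: loc_ess_bounded_deriv)

lemma H1_norm_torus_bounds:
  assumes "f \<in> Lip_torus"
  shows "integral {0..1} (\<lambda>x. (f x)\<^sup>2) \<le> (H1_norm_torus f)\<^sup>2"
    and "integral {0..1} (\<lambda>x. (deriv f x)\<^sup>2) \<le> (H1_norm_torus f)\<^sup>2"
proof -
  note b = Lip_torus_loc_ess_bounded[OF assms] Lip_torus_deriv_loc_ess_bounded[OF assms]
  have *: "(H1_norm_torus f)\<^sup>2 = integral {0..1} (\<lambda>x. (f x)\<^sup>2 + (deriv f x)\<^sup>2)"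
    unfolding H1_norm_torus_def
    by (subst loc_ess_bounded_LINT)
      (auto intro!: loc_ess_bounded_intros b real_sqrt_pow2 integral_nonneg loc_ess_bounded_integrable_on)
  have "integral {0..1} (\<lambda>x. (f x)\<^sup>2 + (deriv f x)\<^sup>2) = integral {0..1} (\<lambda>x. (f x)\<^sup>2) + integral {0..1} (\<lambda>x. (deriv f x)\<^sup>2)"
    by (intro integral_add) (auto intro!: loc_ess_bounded_intros b loc_ess_bounded_integrable_on)
  moreover have "0 \<le> integral {0..1} (\<lambda>x. (f x)\<^sup>2)" "0 \<le> integral {0..1} (\<lambda>x. (deriv f x)\<^sup>2)"
    by (auto intro!: integral_nonneg loc_ess_bounded_intros b loc_ess_bounded_integrable_on)
  ultimately show "integral {0..1} (\<lambda>x. (f x)\<^sup>2) \<le> (H1_norm_torus f)\<^sup>2"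
    "integral {0..1} (\<lambda>x. (deriv f x)\<^sup>2) \<le> (H1_norm_torus f)\<^sup>2" using * by auto
qed

text \<open>The embedding of H^1 into Hoelder functions of exponent 1/2, from Cauchy-Schwarz applied
  to the derivative. The factor \<open>y - x\<close> makes the squared increment over a short window
  proportional to its length.\<close>

lemma Lip_torus_osc_le_H1:
  assumes f: "f \<in> Lip_torus" and xy: "x \<le> y" "y \<le> x + 1"
  shows "(f y - f x)\<^sup>2 \<le> 2 * (y - x) * (H1_norm_torus f)\<^sup>2"
proof (cases "x < y")
  case True
  obtain L where L: "L-lipschitz_on UNIV f" "\<forall>x. f (x + 1) = f x" using f by (rule Lip_torusE)
  note b = Lip_torus_deriv_loc_ess_bounded[OF f]
  have "(f y - f x)\<^sup>2 = (integral {x..y} (deriv f))\<^sup>2"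
    using fundamental_theorem_lipschitz[OF L(1) xy(1)] by (simp add: integral_unique)
  also have "\<dots> \<le> (y - x) * integral {x..y} (\<lambda>x. (deriv f x)\<^sup>2)"
    by (rule Cauchy_Schwarz_interval[OF b True])
  also have "integral {x..y} (\<lambda>x. (deriv f x)\<^sup>2) \<le> 2 * integral {0..1} (\<lambda>x. (deriv f x)\<^sup>2)"
    by (rule integral_periodic_le) (auto intro!: loc_ess_bounded_intros b xy simp: deriv_periodic L(2))
  also have "integral {0..1} (\<lambda>x. (deriv f x)\<^sup>2) \<le> (H1_norm_torus f)\<^sup>2"
    by (rule H1_norm_torus_bounds[OF f])
  finally have "(f y - f x)\<^sup>2 \<le> (y - x) * (2 * (H1_norm_torus f)\<^sup>2)" using True by simp
  then show ?thesis by (simp only: mult.assoc mult.left_commute)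
qed (use xy in auto)

text \<open>The oscillation over one period is at most \<open>2 * N\<close>, so a value above
  \<open>3 * N\<close> would keep the modulus of \<open>f\<close> above \<open>N\<close> on the
  whole period, against the bound \<open>N\<close> on its L^2 norm.\<close>

lemma Lip_torus_abs_le_H1:
  assumes f: "f \<in> Lip_torus"
  shows "\<bar>f x\<bar> \<le> 3 * H1_norm_torus f"
proof (rule ccontr)
  define N where "N = H1_norm_torus f"
  have N: "N \<ge> 0" by (simp add: N_def H1_norm_torus_nonneg)
  obtain L where L: "L-lipschitz_on UNIV f" "\<forall>x. f (x + 1) = f x" using f by (rule Lip_torusE)
  interpret periodic_fun_simple' f by unfold_locales (use L in auto)
  define x' where "x' = x - of_int \<lfloor>x\<rfloor>"
  have x': "0 \<le> x'" "x' \<le> 1" "f x' = f x" unfolding x'_def using minus_of_int[of x "\<lfloor>x\<rfloor>"] by (auto, linarith)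
  assume "\<not> \<bar>f x\<bar> \<le> 3 * H1_norm_torus f"
  then have c: "\<bar>f x'\<bar> - 2 * N > N" using x' N_def by auto
  have "(\<bar>f x'\<bar> - 2 * N)\<^sup>2 \<le> (f y)\<^sup>2" if "y \<in> {0..1}" for y
  proof -
    have "(f y - f x')\<^sup>2 \<le> 2 * \<bar>y - x'\<bar> * N\<^sup>2"
      using Lip_torus_osc_le_H1[OF f, of x' y] Lip_torus_osc_le_H1[OF f, of y x'] that x'
      by (cases "x' \<le> y") (auto simp: N_def power2_commute)
    also have "\<dots> \<le> 4 * N\<^sup>2" using that x' by (intro mult_right_mono) auto
    finally have "\<bar>f y - f x'\<bar>\<^sup>2 \<le> (2 * N)\<^sup>2" by (simp add: power_mult_distrib)
    then have "\<bar>f y - f x'\<bar> \<le> 2 * N" by (rule power2_le_imp_le) (use N in simp)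
    then have "\<bar>f x'\<bar> - 2 * N \<le> \<bar>f y\<bar>" by linarith
    then have "(\<bar>f x'\<bar> - 2 * N)\<^sup>2 \<le> \<bar>f y\<bar>\<^sup>2" using c N by (intro power_mono) auto
    then show ?thesis by simp
  qed
  then have "integral {0..1::real} (\<lambda>_. (\<bar>f x'\<bar> - 2 * N)\<^sup>2) \<le> integral {0..1} (\<lambda>x. (f x)\<^sup>2)"
    using loc_ess_bounded_power2[OF Lip_torus_loc_ess_bounded[OF f]]
    by (intro integral_le) (auto intro!: loc_ess_bounded_integrable_on)
  also have "\<dots> \<le> N\<^sup>2" using H1_norm_torus_bounds[OF f] by (simp add: N_def)
  finally have "(\<bar>f x'\<bar> - 2 * N)\<^sup>2 \<le> N\<^sup>2" by simp
  then have "\<bar>f x'\<bar> - 2 * N \<le> N" using N by (rule power2_le_imp_le)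
  then show False using c by simp
qed

section \<open>The elliptic equation\<close>

lemma lipschitz_on_mult_interval:
  fixes f g :: "real \<Rightarrow> real"
  assumes f: "K-lipschitz_on {a..b} f" and g: "M-lipschitz_on {a..b} g"
  shows "\<exists>C. C-lipschitz_on {a..b} (\<lambda>x. f x * g x)"
proof -
  have "bounded (f ` {a..b})" "bounded (g ` {a..b})"
    using lipschitz_on_continuous_on[OF f] lipschitz_on_continuous_on[OF g]
    by (auto intro!: compact_imp_bounded compact_continuous_image)
  then obtain A B where A: "\<forall>y\<in>f ` {a..b}. norm y \<le> A" and B: "\<forall>y\<in>g ` {a..b}. norm y \<le> B"
    unfolding bounded_iff by blast
  have K: "K \<ge> 0" "M \<ge> 0" using f g lipschitz_on_nonneg by blast+
  have "(\<bar>A\<bar> * M + \<bar>B\<bar> * K)-lipschitz_on {a..b} (\<lambda>x. f x * g x)"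
  proof (rule lipschitz_onI)
    fix x y assume xy: "x \<in> {a..b}" "y \<in> {a..b}"
    have 1: "\<bar>f x - f y\<bar> \<le> K * \<bar>x - y\<bar>" "\<bar>g x - g y\<bar> \<le> M * \<bar>x - y\<bar>"
      using f g xy unfolding lipschitz_on_def by (auto simp: dist_real_def)
    have 2: "\<bar>f x\<bar> \<le> \<bar>A\<bar>" "\<bar>g y\<bar> \<le> \<bar>B\<bar>" using A B xy by force+
    have "f x * g x - f y * g y = f x * (g x - g y) + (f x - f y) * g y" by (simp add: algebra_simps)
    then have "\<bar>f x * g x - f y * g y\<bar> \<le> \<bar>f x\<bar> * \<bar>g x - g y\<bar> + \<bar>f x - f y\<bar> * \<bar>g y\<bar>"
      by (metis abs_mult abs_triangle_ineq)
    also have "\<dots> \<le> \<bar>A\<bar> * (M * \<bar>x - y\<bar>) + (K * \<bar>x - y\<bar>) * \<bar>B\<bar>"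
      using 1 2 K by (intro add_mono mult_mono) auto
    finally show "dist (f x * g x) (f y * g y) \<le> (\<bar>A\<bar> * M + \<bar>B\<bar> * K) * dist x y"
      by (simp add: dist_real_def algebra_simps)
  qed (use K in auto)
  then show ?thesis ..
qed

lemma lipschitz_on_exp_interval:
  fixes f :: "real \<Rightarrow> real"
  assumes f: "K-lipschitz_on {a..b} f"
  shows "\<exists>C. C-lipschitz_on {a..b} (\<lambda>x. exp (f x))"
proof -
  have "bounded (f ` {a..b})"
    using lipschitz_on_continuous_on[OF f]
    by (auto intro!: compact_imp_bounded compact_continuous_image)
  then obtain A where A: "\<forall>y\<in>f ` {a..b}. norm y \<le> A"
    unfolding bounded_iff by blast
  have K: "K \<ge> 0" using f lipschitz_on_nonneg by blast
  have "(exp A * K)-lipschitz_on {a..b} (\<lambda>x. exp (f x))"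
  proof (rule lipschitz_onI)
    fix x y assume xy: "x \<in> {a..b}" "y \<in> {a..b}"
    have 1: "\<bar>f x - f y\<bar> \<le> K * \<bar>x - y\<bar>"
      using f xy unfolding lipschitz_on_def by (auto simp: dist_real_def)
    have "norm (exp (f x) - exp (f y)) \<le> exp A * norm (f x - f y)"
    proof (rule field_differentiable_bound[of "{..A}"])
      show "f x \<in> {..A}" "f y \<in> {..A}" using A xy by force+
    qed (auto intro!: derivative_eq_intros)
    also have "\<dots> \<le> exp A * (K * \<bar>x - y\<bar>)" using 1 by (intro mult_left_mono) auto
    finally show "dist (exp (f x)) (exp (f y)) \<le> exp A * K * dist x y"
      by (simp add: dist_real_def mult.assoc)
  qed (use K in auto)
  then show ?thesis ..
qed

text \<open>Green's formula for \<open>1 - \<partial>\<^sub>x\<^sup>2\<close> on the torus, in the Lagrangian variable: \<open>p\<close>, \<open>r\<close>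
  and \<open>m\<close> stand for \<open>P \<circ> \<xi>\<close>, \<open>\<partial>\<^sub>xP \<circ> \<xi>\<close> and \<open>(u\<^sup>2 + u\<^sub>x\<^sup>2/2) \<circ> \<xi> \<cdot> \<xi>\<^sub>x\<close>. Splitting into
  \<open>p \<mp> r\<close> factors the second order operator.\<close>

lemma Green_torus:
  fixes X p r q m :: "real \<Rightarrow> real"
  assumes lip: "Lx-lipschitz_on UNIV X" "Lp-lipschitz_on UNIV p" "Lr-lipschitz_on UNIV r"
    and per: "X (x + 1) = X x + 1" "p (x + 1) = p x" "r (x + 1) = r x"
    and der: "AE y in lebesgue. (X has_real_derivative q y) (at y)"
      "AE y in lebesgue. (p has_real_derivative r y * q y) (at y)"
      "AE y in lebesgue. (r has_real_derivative p y * q y - m y) (at y)"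
  shows "((\<lambda>y. exp (X y - X x) * m y) has_integral (exp 1 - 1) * (p x - r x)) {x..x+1}"
    and "((\<lambda>y. exp (X x - X y) * m y) has_integral (1 - exp (-1)) * (p x + r x)) {x..x+1}"
proof -
  have lips: "Lx-lipschitz_on {x..x+1} X" "Lp-lipschitz_on {x..x+1} p" "Lr-lipschitz_on {x..x+1} r"
    using lip by (auto intro: lipschitz_on_subset)
  have c: "0-lipschitz_on {x..x+1} (\<lambda>_::real. c::real)" for c by (simp add: lipschitz_on_def)
  have pr: "(Lp + Lr)-lipschitz_on {x..x+1} (\<lambda>y. p y - r y)" "(Lp + Lr)-lipschitz_on {x..x+1} (\<lambda>y. - (p y + r y))"
    using lips by (intro lipschitz_intros; simp)+
  obtain C1 where C1: "C1-lipschitz_on {x..x+1} (\<lambda>y. exp (X y - X x))"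
    using lipschitz_on_exp_interval[OF lipschitz_on_diff[OF lips(1) c]] by blast
  obtain C2 where C2: "C2-lipschitz_on {x..x+1} (\<lambda>y. exp (X x - X y))"
    using lipschitz_on_exp_interval[OF lipschitz_on_diff[OF c lips(1)]] by blast
  obtain D1 where D1: "D1-lipschitz_on {x..x+1} (\<lambda>y. exp (X y - X x) * (p y - r y))"
    using lipschitz_on_mult_interval[OF C1 pr(1)] by blast
  obtain D2 where D2: "D2-lipschitz_on {x..x+1} (\<lambda>y. exp (X x - X y) * - (p y + r y))"
    using lipschitz_on_mult_interval[OF C2 pr(2)] by blast
  \<comment> \<open>From \<open>p' = r * q\<close> and \<open>r' = p * q - m\<close> follows
    \<open>(p - r)' = m - (p - r) * q\<close>, so the integrating factor \<open>exp X\<close> leaves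
    only the source. For \<open>p + r\<close> the integrating factor is
    \<open>exp (- X)\<close>.\<close>
  have "AE y in lebesgue. ((\<lambda>y. exp (X y - X x) * (p y - r y)) has_real_derivative exp (X y - X x) * m y) (at y)"
    using der
  proof eventually_elim
    case (elim y)
    show ?case
      by (rule DERIV_cong, (rule derivative_eq_intros elim refl)+) (simp add: algebra_simps)
  qed
  from fundamental_theorem_lipschitz_on[OF D1 this]
  have "((\<lambda>y. exp (X y - X x) * m y) has_integral
      exp (X (x+1) - X x) * (p (x+1) - r (x+1)) - exp (X x - X x) * (p x - r x)) {x..x+1}" by simp
  \<comment> \<open>\<open>X\<close> gains exactly 1 over a period while \<open>p\<close> and
    \<open>r\<close> return to their values; hence the factor \<open>exp 1 - 1\<close>.\<close>
  also have "exp (X (x+1) - X x) * (p (x+1) - r (x+1)) - exp (X x - X x) * (p x - r x) = (exp 1 - 1) * (p x - r x)"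
    unfolding per by (simp add: left_diff_distrib)
  finally show "((\<lambda>y. exp (X y - X x) * m y) has_integral (exp 1 - 1) * (p x - r x)) {x..x+1}" .
  have "AE y in lebesgue. ((\<lambda>y. exp (X x - X y) * - (p y + r y)) has_real_derivative exp (X x - X y) * m y) (at y)"
    using der
  proof eventually_elim
    case (elim y)
    show ?case
      by (rule DERIV_cong, (rule derivative_eq_intros elim refl)+) (simp add: algebra_simps)
  qed
  from fundamental_theorem_lipschitz_on[OF D2 this]
  have "((\<lambda>y. exp (X x - X y) * m y) has_integral
      exp (X x - X (x+1)) * - (p (x+1) + r (x+1)) - exp (X x - X x) * - (p x + r x)) {x..x+1}" by simp
  also have "exp (X x - X (x+1)) * - (p (x+1) + r (x+1)) - exp (X x - X x) * - (p x + r x) = (1 - exp (-1)) * (p x + r x)"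
    unfolding per by (simp add: algebra_simps)
  finally show "((\<lambda>y. exp (X x - X y) * m y) has_integral (1 - exp (-1)) * (p x + r x)) {x..x+1}" .
qed

lemma W2inf_torusD:
  assumes "Q \<in> W2inf_torus"
  shows "Q \<in> Lip_torus" "deriv Q \<in> Lip_torus" "(Q has_real_derivative deriv Q x) (at x)"
  using assms unfolding W2inf_torus_def by (auto simp: DERIV_deriv_iff_real_differentiable)

text \<open>Green's formula with the identity as flow. The ratios \<open>exp 1 / (exp 1 - 1)\<close>
  and \<open>1 / (1 - exp (-1))\<close> are at most 2, and periodicity costs another factor 2;
  \<open>Q\<close> and \<open>deriv Q\<close> are then half the sum and half the difference of two
  quantities bounded in this way. Since an L^1 norm suffices on the right, sources quadratic in
  \<open>u\<close> and its derivative can be compared through H^1 distances.\<close>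

lemma elliptic_bounds:
  assumes Q: "Q \<in> W2inf_torus" and g: "loc_ess_bounded g" "\<And>x. g (x + 1) = g x"
    and eq: "AE x in lebesgue. - (deriv (deriv Q) x - Q x) = g x"
  shows "\<bar>Q x\<bar> \<le> 4 * integral {0..1} (\<lambda>x. \<bar>g x\<bar>)" "\<bar>deriv Q x\<bar> \<le> 4 * integral {0..1} (\<lambda>x. \<bar>g x\<bar>)"
proof -
  define I where "I = integral {0..1} (\<lambda>x. \<bar>g x\<bar>)"
  obtain L1 L2 where L: "L1-lipschitz_on UNIV Q" "L2-lipschitz_on UNIV (deriv Q)"
      "\<forall>x. Q (x + 1) = Q x" "\<forall>x. deriv Q (x + 1) = deriv Q x"
    using W2inf_torusD[OF Q] unfolding Lip_torus_def by blast
  have id: "1-lipschitz_on UNIV (\<lambda>y::real. y)" by (simp add: lipschitz_on_def)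
  have der: "AE y in lebesgue. (deriv Q has_real_derivative Q y * 1 - g y) (at y)"
    using lipschitz_on_deriv_AE[OF L(2)] eq
  proof eventually_elim
    case (elim y)
    then have "deriv (deriv Q) y = Q y * 1 - g y" by linarith
    then show ?case using elim(1) by simp
  qed
  have "((\<lambda>y. exp (y - x) * g y) has_integral (exp 1 - 1) * (Q x - deriv Q x)) {x..x+1} \<and>
    ((\<lambda>y. exp (x - y) * g y) has_integral (1 - exp (-1)) * (Q x + deriv Q x)) {x..x+1}"
    by (intro conjI Green_torus[OF id L(1,2), of x "\<lambda>_. 1" g])
      (use L W2inf_torusD[OF Q] der in auto)
  note G = this[THEN conjunct1, THEN integral_unique] this[THEN conjunct2, THEN integral_unique]
  have e: "exp 1 \<ge> (2::real)" using exp_ge_add_one_self[of 1] by simp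
  have bound: "\<bar>integral {x..x+1} (\<lambda>y. k y * g y)\<bar> \<le> B * (2 * I)"
    if k: "continuous_on UNIV k" "\<And>y. y \<in> {x..x+1} \<Longrightarrow> \<bar>k y\<bar> \<le> B" and B: "B \<ge> 0" for k B
  proof -
    have lk: "loc_ess_bounded (\<lambda>y. k y * g y)"
      by (rule loc_ess_bounded_mult[OF loc_ess_bounded_continuous[OF k(1)] g(1)])
    have "\<bar>integral {x..x+1} (\<lambda>y. k y * g y)\<bar> \<le> integral {x..x+1} (\<lambda>y. \<bar>k y * g y\<bar>)"
      by (rule integral_abs_le[OF lk])
    also have "\<dots> \<le> integral {x..x+1} (\<lambda>y. B * \<bar>g y\<bar>)"
    proof (rule integral_mono_AE[OF loc_ess_bounded_abs[OF lk]])
      show "loc_ess_bounded (\<lambda>y. B * \<bar>g y\<bar>)" by (intro loc_ess_bounded_mult loc_ess_bounded_const loc_ess_bounded_abs g(1))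
    qed (auto intro!: mult_right_mono k(2) simp: abs_mult)
    also have "\<dots> = B * integral {x..x+1} (\<lambda>y. \<bar>g y\<bar>)" by simp
    also have "\<dots> \<le> B * (2 * I)" unfolding I_def using B
      by (intro mult_left_mono integral_periodic_le) (auto intro!: loc_ess_bounded_intros g(1) simp: g(2))
    finally show ?thesis .
  qed
  have I0: "I \<ge> 0" unfolding I_def
    by (intro integral_nonneg loc_ess_bounded_integrable_on loc_ess_bounded_abs g(1)) auto
  have 1: "\<bar>Q x - deriv Q x\<bar> \<le> 4 * I"
  proof -
    have "\<bar>(exp 1 - 1) * (Q x - deriv Q x)\<bar> \<le> exp 1 * (2 * I)"
      unfolding G(1)[symmetric] by (rule bound) (auto intro!: continuous_intros)
    moreover have "\<bar>(exp 1 - 1) * (Q x - deriv Q x)\<bar> = (exp 1 - 1) * \<bar>Q x - deriv Q x\<bar>"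
      using e by (simp add: abs_mult)
    moreover have "exp 1 * (2 * I) \<le> (exp 1 - 1) * (4 * I)"
    proof -
      have "0 \<le> (exp 1 - 2) * (2 * I)" using e I0 by (intro mult_nonneg_nonneg) auto
      then show ?thesis by (simp add: algebra_simps)
    qed
    ultimately have "(exp 1 - 1) * \<bar>Q x - deriv Q x\<bar> \<le> (exp 1 - 1) * (4 * I)" by linarith
    then show ?thesis using e by (subst (asm) mult_le_cancel_left_pos) auto
  qed
  have 2: "\<bar>Q x + deriv Q x\<bar> \<le> 4 * I"
  proof -
    have e': "exp (-1) \<le> (1/2::real)" using e by (simp add: exp_minus field_simps)
    have "\<bar>(1 - exp (-1)) * (Q x + deriv Q x)\<bar> \<le> 1 * (2 * I)"
      unfolding G(2)[symmetric] by (rule bound) (auto intro!: continuous_intros)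
    moreover have "\<bar>(1 - exp (-1)) * (Q x + deriv Q x)\<bar> = (1 - exp (-1)) * \<bar>Q x + deriv Q x\<bar>"
      using e' by (simp add: abs_mult)
    moreover have "(1/2) * \<bar>Q x + deriv Q x\<bar> \<le> (1 - exp (-1)) * \<bar>Q x + deriv Q x\<bar>"
      using e' by (intro mult_right_mono) auto
    ultimately have "(1/2) * \<bar>Q x + deriv Q x\<bar> \<le> 2 * I"
      unfolding mult_1 by (metis order_trans)
    then show ?thesis by simp
  qed
  show "\<bar>Q x\<bar> \<le> 4 * integral {0..1} (\<lambda>x. \<bar>g x\<bar>)" "\<bar>deriv Q x\<bar> \<le> 4 * integral {0..1} (\<lambda>x. \<bar>g x\<bar>)"
    using 1 2 unfolding I_def by linarith+
qed

section \<open>The space of Lipschitz functions on the torus and its norm\<close>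

lemma Lip_torus_diff:
  assumes "f \<in> Lip_torus" "g \<in> Lip_torus"
  shows "(\<lambda>x. f x - g x) \<in> Lip_torus"
  using assms unfolding Lip_torus_def by (auto intro: lipschitz_on_diff)

lemma Lip_torus_scale:
  assumes "f \<in> Lip_torus"
  shows "(\<lambda>x. c * f x) \<in> Lip_torus"
  using assms unfolding Lip_torus_def by (auto intro: lipschitz_on_cmult_real)

lemma Lip_torus_divide: "f \<in> Lip_torus \<Longrightarrow> (\<lambda>x. f x / c) \<in> Lip_torus"
  using Lip_torus_scale[of f "1/c"] by simp

lemma Lip_torus_bounded:
  assumes "f \<in> Lip_torus"
  shows "\<exists>B. \<forall>x. \<bar>f x\<bar> \<le> B"
  using Lip_torus_abs_le_H1[OF assms] by blast

text \<open>The infimum in \<open>Lip_norm\<close> is attained: each difference quotient lies below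
  every Lipschitz constant, hence below their infimum. Convergence in norm can thus be read as
  uniform convergence together with small Lipschitz constants.\<close>

lemma Lip_norm_bounds:
  assumes f: "f \<in> Lip_torus"
  shows "\<bar>f x\<bar> \<le> Lip_norm f" "(Lip_norm f)-lipschitz_on UNIV f"
proof -
  define S where "S = {C. C-lipschitz_on UNIV f}"
  obtain B where B: "\<And>x. \<bar>f x\<bar> \<le> B" using Lip_torus_bounded[OF f] by blast
  have ne: "S \<noteq> {}" using f by (auto simp: S_def Lip_torus_def)
  have pos: "C \<ge> 0" if "C \<in> S" for C using that lipschitz_on_nonneg by (auto simp: S_def)
  have I: "Inf S \<ge> 0" by (rule cInf_greatest[OF ne pos])
  have sup: "\<bar>f x\<bar> \<le> (SUP x. \<bar>f x\<bar>)" for x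
    using B by (intro cSUP_upper) (auto simp: bdd_above_def)
  have lip: "\<bar>f x - f y\<bar> \<le> Inf S * \<bar>x - y\<bar>" for x y
  proof (cases "x = y")
    case False
    have "\<bar>f x - f y\<bar> / \<bar>x - y\<bar> \<le> C" if "C \<in> S" for C
      using that False unfolding S_def lipschitz_on_def by (auto simp: dist_real_def divide_simps)
    then have "\<bar>f x - f y\<bar> / \<bar>x - y\<bar> \<le> Inf S" by (rule cInf_greatest[OF ne])
    then show ?thesis using False by (simp add: divide_simps)
  qed simp
  have eq: "Lip_norm f = (SUP x. \<bar>f x\<bar>) + Inf S" by (simp add: Lip_norm_def S_def)
  show "\<bar>f x\<bar> \<le> Lip_norm f" using sup[of x] I by (simp add: eq)
  show "(Lip_norm f)-lipschitz_on UNIV f"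
  proof (rule lipschitz_onI)
    fix x y
    have "\<bar>f x - f y\<bar> \<le> Inf S * \<bar>x - y\<bar>" by (rule lip)
    also have "\<dots> \<le> Lip_norm f * \<bar>x - y\<bar>"
      using sup[of 0] by (intro mult_right_mono) (auto simp: eq)
    finally show "dist (f x) (f y) \<le> Lip_norm f * dist x y" by (simp add: dist_real_def)
  qed (use sup[of 0] I eq in linarith)
qed

lemma Lip_norm_nonneg: "f \<in> Lip_torus \<Longrightarrow> 0 \<le> Lip_norm f"
  using Lip_norm_bounds(1)[of f 0] by linarith

lemma Lip_norm_le:
  assumes "\<And>x. \<bar>f x\<bar> \<le> e" "e-lipschitz_on UNIV f"
  shows "Lip_norm f \<le> 2 * e"
proof -
  have "(SUP x. \<bar>f x\<bar>) \<le> e" by (rule cSUP_least) (use assms in auto)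
  moreover have "Inf {C. C-lipschitz_on UNIV f} \<le> e"
    by (rule cInf_lower) (use assms(2) in \<open>auto intro!: bdd_belowI[of _ 0] lipschitz_on_nonneg\<close>)
  ultimately show ?thesis by (simp add: Lip_norm_def)
qed

section \<open>The flow and its velocity\<close>

lemma Lip_torus_add:
  assumes "f \<in> Lip_torus" "g \<in> Lip_torus"
  shows "(\<lambda>x. f x + g x) \<in> Lip_torus"
  using assms unfolding Lip_torus_def by (auto intro: lipschitz_on_add)

lemma Lip_torus_mult:
  assumes f: "f \<in> Lip_torus" and g: "g \<in> Lip_torus"
  shows "(\<lambda>x. f x * g x) \<in> Lip_torus"
proof -
  obtain K where K: "K-lipschitz_on UNIV f" "\<forall>x. f (x + 1) = f x" using f by (rule Lip_torusE)
  obtain M where M: "M-lipschitz_on UNIV g" "\<forall>x. g (x + 1) = g x" using g by (rule Lip_torusE)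
  obtain A where A: "\<And>x. \<bar>f x\<bar> \<le> A" using Lip_torus_bounded[OF f] by blast
  obtain B where B: "\<And>x. \<bar>g x\<bar> \<le> B" using Lip_torus_bounded[OF g] by blast
  have nn: "K \<ge> 0" "M \<ge> 0" "A \<ge> 0" "B \<ge> 0"
    using K(1) M(1) lipschitz_on_nonneg A[of 0] B[of 0] by (auto intro: order_trans[OF abs_ge_zero])
  have "(A * M + B * K)-lipschitz_on UNIV (\<lambda>x. f x * g x)"
  proof (rule lipschitz_onI)
    fix x y
    have 1: "\<bar>f x - f y\<bar> \<le> K * \<bar>x - y\<bar>" "\<bar>g x - g y\<bar> \<le> M * \<bar>x - y\<bar>"
      using K M unfolding lipschitz_on_def by (auto simp: dist_real_def)
    have "f x * g x - f y * g y = f x * (g x - g y) + (f x - f y) * g y" by (simp add: algebra_simps)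
    then have "\<bar>f x * g x - f y * g y\<bar> \<le> \<bar>f x\<bar> * \<bar>g x - g y\<bar> + \<bar>f x - f y\<bar> * \<bar>g y\<bar>"
      by (metis abs_mult abs_triangle_ineq)
    also have "\<dots> \<le> A * (M * \<bar>x - y\<bar>) + (K * \<bar>x - y\<bar>) * B"
      using 1 A B nn by (intro add_mono mult_mono) auto
    finally show "dist (f x * g x) (f y * g y) \<le> (A * M + B * K) * dist x y"
      by (simp add: dist_real_def algebra_simps)
  qed (use nn in auto)
  then show ?thesis using K(2) M(2) unfolding Lip_torus_def by auto
qed

lemma Lip_torus_imp_Linf_torus: "f \<in> Lip_torus \<Longrightarrow> f \<in> Linf_torus"
  using Lip_torus_bounded[of f] Lip_torus_loc_ess_bounded[of f]
  unfolding Linf_torus_def loc_ess_bounded_def by (auto simp: Lip_torus_def)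

lemma Linf_torus_diff:
  assumes "f \<in> Linf_torus" "g \<in> Linf_torus"
  shows "(\<lambda>x. f x - g x) \<in> Linf_torus"
proof -
  obtain C D where "AE x in lebesgue. \<bar>f x\<bar> \<le> C" "AE x in lebesgue. \<bar>g x\<bar> \<le> D"
    using assms unfolding Linf_torus_def by blast
  then have "AE x in lebesgue. \<bar>f x - g x\<bar> \<le> C + D" by eventually_elim auto
  then show ?thesis using assms unfolding Linf_torus_def by auto
qed

section \<open>Continuity in time of the velocity, the pressure and the flow\<close>

text \<open>\<open>\<eta>\<close> is the time derivative of the displacement in the Lipschitz norm,
  a separate datum until \<open>\<eta>_eq\<close> identifies it with the velocity along the flow.
  \<open>ut\<close> and \<open>P\<close> are the witnesses hidden in
  \<open>CH_solution\<close>.\<close>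

locale CH_flow =
  fixes T :: real and u ut P \<xi> \<eta> :: "real \<Rightarrow> real \<Rightarrow> real"
  assumes T_pos: "T > 0"
    and u_C0: "C0_into Lip_torus H1_norm_torus {-T<..<T} u"
    and u_C1: "C1_into Linf_torus L2_norm_torus {-T<..<T} u ut"
    and P_W2inf: "\<And>t. t \<in> {-T<..<T} \<Longrightarrow> P t \<in> W2inf_torus"
    and momentum: "\<And>t. t \<in> {-T<..<T} \<Longrightarrow>
      AE x in lebesgue. ut t x + deriv (\<lambda>y. (u t y)\<^sup>2 / 2 + P t y) x = 0"
    and elliptic: "\<And>t. t \<in> {-T<..<T} \<Longrightarrow>
      AE x in lebesgue. - (deriv (deriv (P t)) x - P t x) = (u t x)\<^sup>2 + (deriv (u t) x)\<^sup>2 / 2"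
    and flow: "flow_map T u \<xi>"
    and \<xi>_C1: "C1_into Lip_torus Lip_norm {-T<..<T} (\<lambda>t x. \<xi> t x - x) \<eta>"
begin

abbreviation I :: "real set" where "I \<equiv> {-T<..<T}"

lemma eventually_I: "t \<in> I \<Longrightarrow> \<forall>\<^sub>F s in at t. s \<in> I"
  by (rule eventually_at_in_open') auto

lemma at_I: "t \<in> I \<Longrightarrow> at t within I = at t"
  by (rule at_within_open) auto

lemma u_Lip: "t \<in> I \<Longrightarrow> u t \<in> Lip_torus"
  using u_C0 unfolding C0_into_def by blast

lemma u_H1_tendsto: "t \<in> I \<Longrightarrow> ((\<lambda>s. H1_norm_torus (\<lambda>x. u s x - u t x)) \<longlongrightarrow> 0) (at t)"
  using u_C0 at_I unfolding C0_into_def by fastforce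

lemma u_uniform:
  assumes t: "t \<in> I" and e: "e > 0"
  shows "\<forall>\<^sub>F s in at t. \<forall>x. \<bar>u s x - u t x\<bar> \<le> e"
proof -
  have "\<forall>\<^sub>F s in at t. H1_norm_torus (\<lambda>x. u s x - u t x) < e / 3"
    using order_tendstoD(2)[OF u_H1_tendsto[OF t], of "e/3"] e by simp
  then show ?thesis using eventually_I[OF t]
  proof eventually_elim
    case (elim s)
    show ?case
    proof
      fix x
      show "\<bar>u s x - u t x\<bar> \<le> e"
        using Lip_torus_abs_le_H1[OF Lip_torus_diff[OF u_Lip[OF elim(2)] u_Lip[OF t]], of x] elim(1) by simp
    qed
  qed
qed

text \<open>The elliptic source is quadratic in \<open>u\<close> and its derivative. With
  \<open>d\<close> the difference of the two times, it changes by squares of \<open>d\<close> and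
  \<open>deriv d\<close> and by terms linear in them, whose coefficients are controlled by
  \<open>B\<close> and \<open>L\<close>, both taken at time \<open>t\<close>. All of this is small
  in L^1 when \<open>d\<close> is small in H^1; no Lipschitz constant of \<open>u s\<close> enters
  the bound.\<close>

lemma elliptic_diff_bound:
  assumes t: "t \<in> I" and s: "s \<in> I"
    and B: "\<And>x. \<bar>u t x\<bar> \<le> B" and L: "L-lipschitz_on UNIV (u t)"
    and N: "N = H1_norm_torus (\<lambda>x. u s x - u t x)"
  shows "\<bar>P s x - P t x\<bar> \<le> 4 * (2 * N\<^sup>2 + (2 * B + L) * N)"
    "\<bar>deriv (P s) x - deriv (P t) x\<bar> \<le> 4 * (2 * N\<^sup>2 + (2 * B + L) * N)"
proof -
  define d where "d x = u s x - u t x" for x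
  have d: "d \<in> Lip_torus" unfolding d_def by (rule Lip_torus_diff[OF u_Lip[OF s] u_Lip[OF t]])
  have N0: "N \<ge> 0" and Nd: "N = H1_norm_torus d" unfolding N d_def by (auto simp: H1_norm_torus_nonneg)
  have B0: "B \<ge> 0" using B[of 0] by linarith
  have L0: "L \<ge> 0" using L lipschitz_on_nonneg by blast
  obtain Ls where Ls: "Ls-lipschitz_on UNIV (u s)" "\<forall>x. u s (x+1) = u s x" using u_Lip[OF s] by (rule Lip_torusE)
  have pert: "\<forall>x. u t (x+1) = u t x" using u_Lip[OF t] by (auto simp: Lip_torus_def)
  obtain Ld where Ld: "Ld-lipschitz_on UNIV d" "\<forall>x. d (x+1) = d x" using d by (rule Lip_torusE)
  define g where "g t x = (u t x)\<^sup>2 + (deriv (u t) x)\<^sup>2 / 2" for t x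
  have lg: "loc_ess_bounded (g s)" "loc_ess_bounded (g t)" unfolding g_def
    by (intro loc_ess_bounded_add loc_ess_bounded_divide_const loc_ess_bounded_power2
        Lip_torus_loc_ess_bounded Lip_torus_deriv_loc_ess_bounded u_Lip s t)+
  have ld: "loc_ess_bounded d" "loc_ess_bounded (deriv d)"
    using d by (auto intro: Lip_torus_loc_ess_bounded Lip_torus_deriv_loc_ess_bounded)
  define \<gamma> where "\<gamma> x = g s x - g t x" for x
  have l\<gamma>: "loc_ess_bounded \<gamma>" unfolding \<gamma>_def by (rule loc_ess_bounded_diff[OF lg])
  have per\<gamma>: "\<gamma> (x + 1) = \<gamma> x" for x
    unfolding \<gamma>_def g_def using Ls(2) pert deriv_periodic[of "u s"] deriv_periodic[of "u t"] by simp
  have DP: "(P \<tau> has_real_derivative deriv (P \<tau>) x) (at x)" if "\<tau> \<in> I" for \<tau> x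
    using W2inf_torusD(3)[OF P_W2inf[OF that]] .
  define Q where "Q x = P s x - P t x" for x
  have dQ: "(Q has_real_derivative deriv (P s) x - deriv (P t) x) (at x)" for x
    unfolding Q_def using DP s t by (auto intro!: derivative_eq_intros)
  have derQ: "deriv Q = (\<lambda>x. deriv (P s) x - deriv (P t) x)"
    using dQ DERIV_imp_deriv by blast
  have QW: "Q \<in> W2inf_torus"
    unfolding W2inf_torus_def mem_Collect_eq
  proof (intro conjI)
    show "Q \<in> Lip_torus" unfolding Q_def[abs_def]
      by (intro Lip_torus_diff W2inf_torusD(1) P_W2inf s t)
    show "deriv Q \<in> Lip_torus" unfolding derQ
      by (intro Lip_torus_diff W2inf_torusD(2) P_W2inf s t)
    show "\<forall>x. Q differentiable at x" using dQ by (auto simp: real_differentiable_def)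
  qed
  obtain Ps where Ps: "Ps-lipschitz_on UNIV (deriv (P s))" using W2inf_torusD(2)[OF P_W2inf[OF s]] by (rule Lip_torusE)
  obtain Pt where Pt: "Pt-lipschitz_on UNIV (deriv (P t))" using W2inf_torusD(2)[OF P_W2inf[OF t]] by (rule Lip_torusE)
  have eqQ: "AE x in lebesgue. - (deriv (deriv Q) x - Q x) = \<gamma> x"
    using elliptic[OF s] elliptic[OF t] lipschitz_on_deriv_AE[OF Ps] lipschitz_on_deriv_AE[OF Pt]
  proof eventually_elim
    case (elim x)
    have "deriv (deriv Q) x = deriv (deriv (P s)) x - deriv (deriv (P t)) x"
      unfolding derQ by (rule DERIV_imp_deriv[OF DERIV_diff[OF elim(3,4)]])
    then show ?case using elim(1,2) unfolding \<gamma>_def g_def Q_def by linarith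
  qed
  have bnd: "AE x in lebesgue. x \<in> {0..1} \<longrightarrow>
      \<bar>\<gamma> x\<bar> \<le> (d x)\<^sup>2 + 2 * B * \<bar>d x\<bar> + ((deriv d x)\<^sup>2 + L * \<bar>deriv d x\<bar>)"
    using lipschitz_on_deriv_AE[OF Ls(1)] lipschitz_on_deriv_AE[OF L]
  proof eventually_elim
    case (elim x)
    have dd: "deriv d x = deriv (u s) x - deriv (u t) x"
      unfolding d_def[abs_def] by (rule DERIV_imp_deriv[OF DERIV_diff[OF elim]])
    have Lx: "\<bar>deriv (u t) x\<bar> \<le> L" by (rule lipschitz_DERIV_abs_le[OF L elim(2)])
    have e1: "(u s x)\<^sup>2 - (u t x)\<^sup>2 = (d x)\<^sup>2 + 2 * u t x * d x"
      by (simp add: d_def power2_eq_square algebra_simps)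
    have e2: "(deriv (u s) x)\<^sup>2 - (deriv (u t) x)\<^sup>2 = (deriv d x)\<^sup>2 + 2 * deriv (u t) x * deriv d x"
      unfolding dd by (simp add: power2_eq_square algebra_simps)
    have "\<gamma> x = ((u s x)\<^sup>2 - (u t x)\<^sup>2) + ((deriv (u s) x)\<^sup>2 - (deriv (u t) x)\<^sup>2) / 2"
      unfolding \<gamma>_def g_def by (simp add: field_simps)
    also have "\<dots> = (d x)\<^sup>2 + 2 * u t x * d x + ((deriv d x)\<^sup>2 / 2 + deriv (u t) x * deriv d x)"
      unfolding e1 e2 by simp
    finally have "\<bar>\<gamma> x\<bar> \<le> (d x)\<^sup>2 + \<bar>2 * u t x * d x\<bar> + ((deriv d x)\<^sup>2 / 2 + \<bar>deriv (u t) x * deriv d x\<bar>)"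
      using zero_le_power2[of "d x"] zero_le_power2[of "deriv d x"] by linarith
    moreover have "\<bar>2 * u t x * d x\<bar> \<le> 2 * B * \<bar>d x\<bar>"
      using mult_right_mono[OF B[of x], of "\<bar>d x\<bar>"] by (simp add: abs_mult)
    moreover have "\<bar>deriv (u t) x * deriv d x\<bar> \<le> L * \<bar>deriv d x\<bar>"
      using mult_right_mono[OF Lx, of "\<bar>deriv d x\<bar>"] by (simp add: abs_mult)
    moreover have "(deriv d x)\<^sup>2 / 2 \<le> (deriv d x)\<^sup>2" by simp
    ultimately show ?case by linarith
  qed
  note b2 = H1_norm_torus_bounds[OF d, folded Nd]
  have b1: "integral {0..1} (\<lambda>x. \<bar>d x\<bar>) \<le> N" "integral {0..1} (\<lambda>x. \<bar>deriv d x\<bar>) \<le> N"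
    by (rule integral_abs_le_L2[OF _ _ N0]; use ld b2 in auto)+
  have i: "(\<lambda>x. (d x)\<^sup>2) integrable_on {0..1}" "(\<lambda>x. (deriv d x)\<^sup>2) integrable_on {0..1}"
     "(\<lambda>x. \<bar>d x\<bar>) integrable_on {0..1}" "(\<lambda>x. \<bar>deriv d x\<bar>) integrable_on {0..1}"
    using ld by (auto intro!: loc_ess_bounded_integrable_on loc_ess_bounded_power2 loc_ess_bounded_abs)
  have "integral {0..1} (\<lambda>x. \<bar>\<gamma> x\<bar>) \<le>
      integral {0..1} (\<lambda>x. (d x)\<^sup>2 + 2 * B * \<bar>d x\<bar> + ((deriv d x)\<^sup>2 + L * \<bar>deriv d x\<bar>))"
    by (rule integral_mono_AE[OF loc_ess_bounded_abs[OF l\<gamma>] _ bnd])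
      (intro loc_ess_bounded_add loc_ess_bounded_mult loc_ess_bounded_const loc_ess_bounded_abs loc_ess_bounded_power2 ld)
  also have "\<dots> = integral {0..1} (\<lambda>x. (d x)\<^sup>2) + 2 * B * integral {0..1} (\<lambda>x. \<bar>d x\<bar>)
      + (integral {0..1} (\<lambda>x. (deriv d x)\<^sup>2) + L * integral {0..1} (\<lambda>x. \<bar>deriv d x\<bar>))"
    by (rule integral_unique) (intro has_integral_add has_integral_mult_right integrable_integral i)
  also have "\<dots> \<le> N\<^sup>2 + 2 * B * N + (N\<^sup>2 + L * N)"
    using b1 b2 B0 L0 by (intro add_mono mult_left_mono) auto
  also have "\<dots> = 2 * N\<^sup>2 + (2 * B + L) * N" by (simp add: algebra_simps)
  finally have G: "integral {0..1} (\<lambda>x. \<bar>\<gamma> x\<bar>) \<le> 2 * N\<^sup>2 + (2 * B + L) * N" .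
  have "\<bar>Q x\<bar> \<le> 4 * integral {0..1} (\<lambda>x. \<bar>\<gamma> x\<bar>)" "\<bar>deriv Q x\<bar> \<le> 4 * integral {0..1} (\<lambda>x. \<bar>\<gamma> x\<bar>)"
    using elliptic_bounds[OF QW l\<gamma> per\<gamma> eqQ] by blast+
  then show "\<bar>P s x - P t x\<bar> \<le> 4 * (2 * N\<^sup>2 + (2 * B + L) * N)"
    "\<bar>deriv (P s) x - deriv (P t) x\<bar> \<le> 4 * (2 * N\<^sup>2 + (2 * B + L) * N)"
    unfolding derQ Q_def using mult_left_mono[OF G, of 4] by (auto intro: order_trans)
qed

lemma P_uniform:
  assumes t: "t \<in> I" and e: "e > 0"
  shows "\<forall>\<^sub>F s in at t. \<forall>x. \<bar>P s x - P t x\<bar> \<le> e \<and> \<bar>deriv (P s) x - deriv (P t) x\<bar> \<le> e"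
proof -
  obtain B where B: "\<And>x. \<bar>u t x\<bar> \<le> B" using Lip_torus_bounded[OF u_Lip[OF t]] by blast
  obtain L where L: "L-lipschitz_on UNIV (u t)" using u_Lip[OF t] by (rule Lip_torusE)
  let ?N = "\<lambda>s. H1_norm_torus (\<lambda>x. u s x - u t x)"
  have "((\<lambda>s. 4 * (2 * (?N s)\<^sup>2 + (2 * B + L) * ?N s)) \<longlongrightarrow> 4 * (2 * 0\<^sup>2 + (2 * B + L) * 0)) (at t)"
    by (intro tendsto_intros u_H1_tendsto t)
  then have "\<forall>\<^sub>F s in at t. 4 * (2 * (?N s)\<^sup>2 + (2 * B + L) * ?N s) < e"
    using e by (intro order_tendstoD(2)) auto
  then show ?thesis using eventually_I[OF t]
  proof eventually_elim
    case (elim s)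
    show ?case using elliptic_diff_bound[OF t elim(2) B L refl] elim(1) by (meson less_imp_le order_trans)
  qed
qed

lemma displacement_Lip: "t \<in> I \<Longrightarrow> (\<lambda>x. \<xi> t x - x) \<in> Lip_torus"
  using \<xi>_C1 unfolding C1_into_def by blast

lemma \<eta>_Lip: "t \<in> I \<Longrightarrow> \<eta> t \<in> Lip_torus"
  using \<xi>_C1 unfolding C1_into_def C0_into_def by blast

lemma \<eta>_uniform:
  assumes t: "t \<in> I" and e: "e > 0"
  shows "\<forall>\<^sub>F s in at t. (\<forall>x. \<bar>\<eta> s x - \<eta> t x\<bar> \<le> e) \<and> e-lipschitz_on UNIV (\<lambda>x. \<eta> s x - \<eta> t x)"
proof -
  have "((\<lambda>s. Lip_norm (\<lambda>x. \<eta> s x - \<eta> t x)) \<longlongrightarrow> 0) (at t)"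
    using \<xi>_C1 t at_I[OF t] unfolding C1_into_def C0_into_def by fastforce
  then have "\<forall>\<^sub>F s in at t. Lip_norm (\<lambda>x. \<eta> s x - \<eta> t x) < e"
    using e by (rule order_tendstoD(2))
  then show ?thesis using eventually_I[OF t]
  proof eventually_elim
    case (elim s)
    note * = Lip_norm_bounds[OF Lip_torus_diff[OF \<eta>_Lip[OF elim(2)] \<eta>_Lip[OF t]]]
    then show ?case using elim(1) by (meson less_imp_le order_trans lipschitz_on_le)
  qed
qed

lemma \<xi>_quotient_uniform:
  assumes t: "t \<in> I" and e: "e > 0"
  shows "\<forall>\<^sub>F s in at t. (\<forall>x. \<bar>(\<xi> s x - \<xi> t x) / (s - t) - \<eta> t x\<bar> \<le> e) \<and>
     e-lipschitz_on UNIV (\<lambda>x. (\<xi> s x - \<xi> t x) / (s - t) - \<eta> t x)"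
proof -
  let ?D = "\<lambda>s x. ((\<xi> s x - x) - (\<xi> t x - x)) / (s - t) - \<eta> t x"
  have "((\<lambda>s. Lip_norm (?D s)) \<longlongrightarrow> 0) (at t)"
    using \<xi>_C1 t at_I[OF t] unfolding C1_into_def by fastforce
  then have "\<forall>\<^sub>F s in at t. Lip_norm (?D s) < e"
    using e by (rule order_tendstoD(2))
  then show ?thesis using eventually_I[OF t]
  proof eventually_elim
    case (elim s)
    have eq: "?D s = (\<lambda>x. (\<xi> s x - \<xi> t x) / (s - t) - \<eta> t x)" by simp
    have "?D s \<in> Lip_torus"
      by (intro Lip_torus_diff Lip_torus_divide displacement_Lip \<eta>_Lip elim t)
    then have "(\<lambda>x. (\<xi> s x - \<xi> t x) / (s - t) - \<eta> t x) \<in> Lip_torus" by (simp only: eq)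
    note * = Lip_norm_bounds[OF this]
    then show ?case using elim(1) by (auto intro: order_trans less_imp_le lipschitz_on_le)
  qed
qed

lemma \<xi>_DERIV_\<eta>:
  assumes t: "t \<in> I"
  shows "((\<lambda>s. \<xi> s x) has_real_derivative \<eta> t x) (at t)"
  unfolding has_field_derivative_iff
proof (rule tendstoI)
  fix e :: real assume e: "e > 0"
  show "\<forall>\<^sub>F s in at t. dist ((\<xi> s x - \<xi> t x) / (s - t)) (\<eta> t x) < e"
    using \<xi>_quotient_uniform[OF t half_gt_zero[OF e]]
  proof eventually_elim
    case (elim s)
    then have "\<bar>(\<xi> s x - \<xi> t x) / (s - t) - \<eta> t x\<bar> \<le> e / 2" by blast
    then show ?case using e by (simp add: dist_real_def)
  qed
qed

lemma \<xi>_uniform: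
  assumes t: "t \<in> I" and e: "e > 0"
  shows "\<forall>\<^sub>F s in at t. (\<forall>x. \<bar>\<xi> s x - \<xi> t x\<bar> \<le> e) \<and> e-lipschitz_on UNIV (\<lambda>x. \<xi> s x - \<xi> t x)"
proof -
  define N where "N = Lip_norm (\<eta> t)"
  note \<eta>b = Lip_norm_bounds[OF \<eta>_Lip[OF t], folded N_def]
  have N: "N \<ge> 0" using Lip_norm_nonneg[OF \<eta>_Lip[OF t]] by (simp add: N_def)
  have "\<forall>\<^sub>F s in at t. dist s t < e / (N + 1)" using e N
    by (auto simp: eventually_at intro!: exI[of _ "e/(N+1)"])
  then show ?thesis using \<xi>_quotient_uniform[OF t zero_less_one]
      eventually_neq_at_within[of t t UNIV]
  proof eventually_elim
    case (elim s)
    define D where "D x = (\<xi> s x - \<xi> t x) / (s - t) - \<eta> t x" for x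
    have eq: "\<xi> s x - \<xi> t x = (s - t) * (D x + \<eta> t x)" for x
      using elim(3) by (simp add: D_def)
    have D: "\<bar>D x\<bar> \<le> 1" "1-lipschitz_on UNIV D" for x
      using elim(2) by (auto simp: D_def[abs_def])
    have l: "(1 + N)-lipschitz_on UNIV (\<lambda>x. D x + \<eta> t x)"
      by (rule lipschitz_on_add[OF D(2) \<eta>b(2)])
    have st: "\<bar>s - t\<bar> * (1 + N) \<le> e"
      using elim(1) N by (simp add: dist_real_def field_simps)
    have "(\<bar>s - t\<bar> * (1 + N))-lipschitz_on UNIV (\<lambda>x. (s - t) * (D x + \<eta> t x))"
      by (rule lipschitz_on_cmult_real[OF l])
    then have "e-lipschitz_on UNIV (\<lambda>x. \<xi> s x - \<xi> t x)"
      unfolding eq[abs_def] using st by (rule lipschitz_on_le)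
    moreover have "\<bar>\<xi> s x - \<xi> t x\<bar> \<le> e" for x
    proof -
      have "\<bar>\<xi> s x - \<xi> t x\<bar> = \<bar>s - t\<bar> * \<bar>D x + \<eta> t x\<bar>" unfolding eq by (rule abs_mult)
      also have "\<dots> \<le> \<bar>s - t\<bar> * (1 + N)"
        using D(1)[of x] \<eta>b(1)[of x] by (intro mult_left_mono) auto
      finally show ?thesis using st by linarith
    qed
    ultimately show ?case by blast
  qed
qed

lemma \<xi>_lipschitz: "t \<in> I \<Longrightarrow> \<exists>L. L-lipschitz_on UNIV (\<xi> t)"
proof -
  assume t: "t \<in> I"
  obtain L where L: "L-lipschitz_on UNIV (\<lambda>x. \<xi> t x - x)" using displacement_Lip[OF t] by (rule Lip_torusE)
  have id: "1-lipschitz_on UNIV (\<lambda>y::real. y)" by (simp add: lipschitz_on_def)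
  show ?thesis using lipschitz_on_add[OF L id] by auto
qed

lemma \<xi>_periodic: "t \<in> I \<Longrightarrow> \<xi> t (x + 1) = \<xi> t x + 1"
  using flow unfolding flow_map_def by blast

lemma \<xi>_zero: "\<xi> 0 x = x"
  using flow T_pos unfolding flow_map_def by (auto simp: zero_ereal_def[symmetric])

lemma \<xi>_tendsto:
  assumes t: "t \<in> I" shows "((\<lambda>s. \<xi> s x) \<longlongrightarrow> \<xi> t x) (at t)"
  using DERIV_isCont[OF \<xi>_DERIV_\<eta>[OF t]] by (simp add: isCont_def)

lemma Lagrangian_tendsto:
  fixes F :: "real \<Rightarrow> real \<Rightarrow> real"
  assumes t: "t \<in> I" and F: "\<And>e. e > 0 \<Longrightarrow> \<forall>\<^sub>F s in at t. \<forall>x. \<bar>F s x - F t x\<bar> \<le> e"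
    and c: "isCont (F t) (\<xi> t x)"
  shows "((\<lambda>s. F s (\<xi> s x)) \<longlongrightarrow> F t (\<xi> t x)) (at t)"
proof (rule tendstoI)
  fix e :: real assume e: "e > 0"
  have "((\<lambda>s. F t (\<xi> s x)) \<longlongrightarrow> F t (\<xi> t x)) (at t)"
    by (rule isCont_tendsto_compose[OF c \<xi>_tendsto[OF t]])
  then have "\<forall>\<^sub>F s in at t. dist (F t (\<xi> s x)) (F t (\<xi> t x)) < e/2" using e by (intro tendstoD) auto
  then show "\<forall>\<^sub>F s in at t. dist (F s (\<xi> s x)) (F t (\<xi> t x)) < e"
    using F[OF half_gt_zero[OF e]]
  proof eventually_elim
    case (elim s)
    have "\<bar>F s (\<xi> s x) - F t (\<xi> s x)\<bar> \<le> e/2" using elim(2) by blast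
    then show ?case using elim(1) unfolding dist_real_def by linarith
  qed
qed

lemma Lip_isCont: "f \<in> Lip_torus \<Longrightarrow> isCont f x"
  using Lip_torus_continuous[of f UNIV] by (simp add: continuous_on_eq_continuous_at)

lemma u_along_tendsto: "t \<in> I \<Longrightarrow> ((\<lambda>s. u s (\<xi> s x)) \<longlongrightarrow> u t (\<xi> t x)) (at t)"
  by (rule Lagrangian_tendsto) (blast intro: u_uniform u_Lip Lip_isCont)+

text \<open>Both sides are time derivatives of the same trajectory: one by differentiability of the
  displacement in norm, the other by differentiating the integral equation, whose integrand is
  continuous in time.\<close>

lemma \<eta>_eq:
  assumes t: "t \<in> I"
  shows "\<eta> t x = u t (\<xi> t x)"
proof -
  \<comment> \<open>A compact time interval inside \<open>I\<close>, symmetric about 0, with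
    \<open>t\<close> in its interior.\<close>
  define c where "c = (\<bar>t\<bar> + T) / 2"
  have c: "\<bar>t\<bar> < c" "c < T" using t by (auto simp: c_def)
  have cont: "continuous_on {-c..c} (\<lambda>s. u s (\<xi> s x))"
    using c u_along_tendsto
    by (intro continuous_at_imp_continuous_on ballI) (auto simp: isCont_def)
  have "((\<lambda>w. LBINT s=0..w. u s (\<xi> s x)) has_vector_derivative u t (\<xi> t x)) (at t within {-c..c})"
    using interval_integral_FTC2[of "-c" 0 c "\<lambda>s. u s (\<xi> s x)" t, OF _ _ cont] c
    by (auto simp: zero_ereal_def)
  then have "((\<lambda>w. x + (LBINT s=0..w. u s (\<xi> s x))) has_real_derivative u t (\<xi> t x)) (at t)"
    using c by (auto simp: at_within_Icc_at has_real_derivative_iff_has_vector_derivative intro!: derivative_eq_intros)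
  then have "((\<lambda>s. \<xi> s x) has_real_derivative u t (\<xi> t x)) (at t)"
  proof (rule has_field_derivative_transform_within_open[of _ _ _ I])
    fix s assume "s \<in> I"
    then show "x + (LBINT s=0..s. u s (\<xi> s x)) = \<xi> s x"
      using flow unfolding flow_map_def by (metis zero_ereal_def)
  qed (use t in auto)
  then show ?thesis using \<xi>_DERIV_\<eta>[OF t] DERIV_unique by blast
qed

end

section \<open>The acceleration along a trajectory\<close>

lemma MVT_segment:
  fixes f :: "real \<Rightarrow> real"
  assumes "a \<noteq> b" and der: "\<And>y. y \<in> closed_segment a b \<Longrightarrow> (f has_real_derivative f' y) (at y)"
  shows "\<exists>y\<in>open_segment a b. f b - f a = (b - a) * f' y"
proof (cases "a < b")
  case True
  then show ?thesis using MVT2[OF True, of f f'] der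
    by (auto simp: closed_segment_eq_real_ivl open_segment_eq_real_ivl)
next
  case False
  then have "b < a" using assms(1) by simp
  then obtain y where y: "b < y" "y < a" "f a - f b = (a - b) * f' y"
    using MVT2[OF \<open>b < a\<close>, of f f'] der by (auto simp: closed_segment_eq_real_ivl)
  have "f b - f a = (b - a) * f' y" using y(3) by (simp add: algebra_simps)
  then show ?thesis using y by (auto simp: open_segment_eq_real_ivl)
qed

context CH_flow
begin

lemma potential_Lip: "t \<in> I \<Longrightarrow> (\<lambda>y. (u t y)\<^sup>2 / 2 + P t y) \<in> Lip_torus"
  unfolding power2_eq_square
  by (intro Lip_torus_add Lip_torus_divide Lip_torus_mult u_Lip W2inf_torusD(1) P_W2inf)

text \<open>The momentum equation tested against the indicator of an interval; in this form its
  exceptional set in space disappears.\<close>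

lemma integral_ut:
  assumes t: "t \<in> I" and ab: "a \<le> b"
  shows "integral {a..b} (ut t) =
    - (((u t b)\<^sup>2 / 2 + P t b) - ((u t a)\<^sup>2 / 2 + P t a))"
proof -
  let ?W = "\<lambda>y. (u t y)\<^sup>2 / 2 + P t y"
  obtain L where L: "L-lipschitz_on UNIV ?W" using potential_Lip[OF t] by (rule Lip_torusE)
  have "((\<lambda>x. - deriv ?W x) has_integral - (?W b - ?W a)) {a..b}"
    by (rule has_integral_neg[OF fundamental_theorem_lipschitz[OF L ab]])
  then have "(ut t has_integral - (?W b - ?W a)) {a..b}"
  proof (rule has_integral_spike[rotated 2])
    show "negligible {x. \<not> ut t x + deriv ?W x = 0}"
      using momentum[OF t] unfolding AE_lebesgue_iff_negligible .
  qed auto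
  then show ?thesis by (rule integral_unique)
qed

lemma DERIV_window_integral:
  fixes f :: "real \<Rightarrow> real"
  assumes "continuous_on UNIV f" and \<epsilon>: "0 < \<epsilon>" "\<epsilon> \<le> 1"
  shows "((\<lambda>a. integral {a..a+\<epsilon>} f) has_real_derivative f (a + \<epsilon>) - f a) (at a)"
proof -
  define J where "J z = integral {a-2..z} f" for z
  have c: "continuous_on S f" for S using assms(1) by (rule continuous_on_subset) auto
  have J: "(J has_real_derivative f z) (at z)" if "z \<in> {a-2<..<a+3}" for z
  proof -
    have "(J has_vector_derivative f z) (at z within {a-2..a+3})"
      unfolding J_def by (rule integral_has_vector_derivative[OF c]) (use that in auto)
    then show ?thesis using that by (simp add: at_within_Icc_at has_real_derivative_iff_has_vector_derivative)
  qed
  have "((\<lambda>a'. J (a' + \<epsilon>) - J a') has_real_derivative f (a + \<epsilon>) - f a) (at a)"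
  proof (rule DERIV_diff)
    show "((\<lambda>a'. J (a' + \<epsilon>)) has_real_derivative f (a + \<epsilon>)) (at a)"
      using J[of "a + \<epsilon>"] \<epsilon> by (subst DERIV_shift[symmetric]) simp
    show "(J has_real_derivative f a) (at a)" by (rule J) simp
  qed
  then show ?thesis
  proof (rule has_field_derivative_transform_within_open[of _ _ _ "{a-1<..<a+1}"])
    fix z assume z: "z \<in> {a-1<..<a+1}"
    have "integral {a-2..z} f + integral {z..z+\<epsilon>} f = integral {a-2..z+\<epsilon>} f"
      by (rule Henstock_Kurzweil_Integration.integral_combine)
        (use z \<epsilon> in \<open>auto intro: integrable_continuous_interval c\<close>)
    then show "J (z + \<epsilon>) - J z = integral {z..z+\<epsilon>} f" by (simp add: J_def)
  qed auto
qed

text \<open>The increment splits into the change of \<open>u\<close> over the same window, governed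
  by the L^2 derivative \<open>ut\<close>, and the shift of the window for frozen
  \<open>u t\<close>. The first gives minus the increment of the flux
  \<open>u\<^sup>2/2 + P\<close>; the second gives the increment of \<open>u\<close> times the speed
  of the window, which moves rigidly with its left end. Together they form the square of the
  increment of \<open>u\<close>.\<close>

lemma window_along_flow_DERIV:
  assumes t: "t \<in> I" and \<epsilon>: "0 < \<epsilon>" "\<epsilon> \<le> 1"
  shows "((\<lambda>s. integral {\<xi> s x..\<xi> s x + \<epsilon>} (u s)) has_real_derivative
     - ((u t (\<xi> t x + \<epsilon>) - u t (\<xi> t x))\<^sup>2 / 2 + (P t (\<xi> t x + \<epsilon>) - P t (\<xi> t x)))) (at t)"
proof -
  define W where "W y = (u t y)\<^sup>2 / 2 + P t y" for y
  define \<Theta> where "\<Theta> s a = integral {a..a+\<epsilon>} (u s)" for s a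
  define z where "z = \<xi> t x"
  have cont: "isCont (u t) y" "isCont (P t) y" for y
    using Lip_isCont u_Lip[OF t] W2inf_torusD(1)[OF P_W2inf[OF t]] by auto
  have cuu: "continuous_on UNIV (u t)" by (rule Lip_torus_continuous[OF u_Lip[OF t]])
  have z: "((\<lambda>s. \<xi> s x) \<longlongrightarrow> z) (at t)" unfolding z_def by (rule \<xi>_tendsto[OF t])
  have q: "((\<lambda>s. (\<Theta> s (\<xi> s x) - \<Theta> t (\<xi> s x)) / (s - t)) \<longlongrightarrow> - (W (z + \<epsilon>) - W z)) (at t)"
  proof -
    define N where "N s = L2_norm_torus (\<lambda>x. (u s x - u t x) / (s - t) - ut t x)" for s
    have N: "(N \<longlongrightarrow> 0) (at t)"
      using u_C1 t at_I[OF t] unfolding C1_into_def N_def by fastforce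
    have W: "((\<lambda>s. - (W (\<xi> s x + \<epsilon>) - W (\<xi> s x))) \<longlongrightarrow> - (W (z + \<epsilon>) - W z)) (at t)"
      unfolding W_def by (intro tendsto_intros isCont_tendsto_compose[OF cont(1)] isCont_tendsto_compose[OF cont(2)] z) auto
    \<comment> \<open>The flux is evaluated at the moving position \<open>\<xi> s x\<close>, where
      the L^2 bound holds equally well; its continuity in space is used only afterwards, in the
      limit.\<close>
    have "((\<lambda>s. (\<Theta> s (\<xi> s x) - \<Theta> t (\<xi> s x)) / (s - t) + (W (\<xi> s x + \<epsilon>) - W (\<xi> s x))) \<longlongrightarrow> 0) (at t)"
    proof (rule Lim_null_comparison)
      show "((\<lambda>s. 2 * N s) \<longlongrightarrow> 0) (at t)" using tendsto_mult_right_zero[OF N] by simp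
      show "\<forall>\<^sub>F s in at t. norm ((\<Theta> s (\<xi> s x) - \<Theta> t (\<xi> s x)) / (s - t) + (W (\<xi> s x + \<epsilon>) - W (\<xi> s x))) \<le> 2 * N s"
        using eventually_I[OF t]
      proof eventually_elim
        case (elim s)
        let ?a = "\<xi> s x"
        have utL: "ut t \<in> Linf_torus" using u_C1 t unfolding C1_into_def C0_into_def by blast
        have q: "(\<lambda>x. (u s x - u t x) / (s - t)) \<in> Linf_torus"
          by (intro Lip_torus_imp_Linf_torus Lip_torus_divide Lip_torus_diff u_Lip elim t)
        have i: "u s integrable_on {?a..?a+\<epsilon>}" "u t integrable_on {?a..?a+\<epsilon>}" "ut t integrable_on {?a..?a+\<epsilon>}"
          using Lip_torus_loc_ess_bounded u_Lip elim t Linf_torus_loc_ess_bounded utL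
          by (auto intro!: loc_ess_bounded_integrable_on)
        have "((\<lambda>x. (u s x - u t x) / (s - t) - ut t x) has_integral
            (\<Theta> s ?a - \<Theta> t ?a) / (s - t) - integral {?a..?a+\<epsilon>} (ut t)) {?a..?a+\<epsilon>}"
          unfolding \<Theta>_def using i
          by (intro has_integral_diff has_integral_divide integrable_integral)
        then have "(\<Theta> s ?a - \<Theta> t ?a) / (s - t) + (W (?a + \<epsilon>) - W ?a) =
            integral {?a..?a+\<epsilon>} (\<lambda>x. (u s x - u t x) / (s - t) - ut t x)"
          using integral_ut[OF t, of ?a "?a + \<epsilon>"] \<epsilon> by (simp add: W_def integral_unique)
        also have "\<bar>\<dots>\<bar> \<le> 2 * N s" unfolding N_def
          by (rule integral_le_L2_norm_torus[OF Linf_torus_diff[OF q utL]]) (use \<epsilon> in auto)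
        finally show ?case by simp
      qed
    qed
    from tendsto_add[OF this W] show ?thesis by simp
  qed
  have "((\<lambda>s. \<Theta> t (\<xi> s x)) has_real_derivative (u t (z + \<epsilon>) - u t z) * \<eta> t x) (at t)"
    unfolding \<Theta>_def z_def
    by (rule DERIV_chain2[where g = "\<lambda>s. \<xi> s x", OF DERIV_window_integral[OF cuu \<epsilon>] \<xi>_DERIV_\<eta>[OF t]])
  then have q2: "((\<lambda>s. (\<Theta> t (\<xi> s x) - \<Theta> t (\<xi> t x)) / (s - t)) \<longlongrightarrow> (u t (z + \<epsilon>) - u t z) * u t z) (at t)"
    unfolding has_field_derivative_iff \<eta>_eq[OF t] z_def .
  have "((\<lambda>s. (\<Theta> s (\<xi> s x) - \<Theta> t (\<xi> t x)) / (s - t)) \<longlongrightarrow>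
      - (W (z + \<epsilon>) - W z) + (u t (z + \<epsilon>) - u t z) * u t z) (at t)"
    using tendsto_add[OF q q2] by (simp add: add_divide_distrib[symmetric])
  also have "- (W (z + \<epsilon>) - W z) + (u t (z + \<epsilon>) - u t z) * u t z =
     - ((u t (z + \<epsilon>) - u t z)\<^sup>2 / 2 + (P t (z + \<epsilon>) - P t z))"
    by (simp add: W_def power2_eq_square field_simps)
  finally show ?thesis unfolding has_field_derivative_iff \<Theta>_def z_def .
qed

text \<open>The point is a threshold \<open>\<epsilon>0\<close> common to all \<open>t\<close> near
  \<open>t0\<close>, since the window is later shrunk at fixed \<open>t\<close>. At
  \<open>t0\<close> the velocity is Lipschitz, so its squared increment over
  \<open>\<epsilon>\<close> is of order \<open>\<epsilon>\<close>; at \<open>t\<close> the Hoelder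
  bound adds only a multiple of the squared H^1 distance, free of \<open>\<epsilon>\<close>.\<close>

lemma window_rate_bound:
  assumes t0: "t0 \<in> I" and e: "e > 0"
  shows "\<exists>\<epsilon>0>0. \<forall>\<^sub>F t in at t0. t \<in> I \<and> (\<forall>\<epsilon>. 0 < \<epsilon> \<and> \<epsilon> \<le> \<epsilon>0 \<longrightarrow>
     \<bar>((u t (\<xi> t x + \<epsilon>) - u t (\<xi> t x))\<^sup>2 / 2 + (P t (\<xi> t x + \<epsilon>) - P t (\<xi> t x))) / \<epsilon>
       - deriv (P t0) (\<xi> t0 x)\<bar> \<le> e)"
proof -
  obtain L where L: "L-lipschitz_on UNIV (u t0)" using u_Lip[OF t0] by (rule Lip_torusE)
  obtain K where K: "K-lipschitz_on UNIV (deriv (P t0))" using W2inf_torusD(2)[OF P_W2inf[OF t0]] by (rule Lip_torusE)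
  have nn: "L \<ge> 0" "K \<ge> 0" using L K lipschitz_on_nonneg by blast+
  \<comment> \<open>The quadratic term is allowed \<open>e/4\<close> for the Lipschitz part and
    \<open>e/4\<close> for the H^1 distance. The slope of the pressure is allowed \<open>e/8\<close>
    each for the change of \<open>P\<close>, the length of the window and the motion of the
    trajectory. Adding 1 to \<open>L\<^sup>2\<close> and \<open>K\<close> avoids division by
    zero.\<close>
  define \<epsilon>0 where "\<epsilon>0 = min 1 (min (e / (4 * (L\<^sup>2 + 1))) (e / (8 * (K + 1))))"
  have \<epsilon>0: "\<epsilon>0 > 0" using e nn by (auto simp: \<epsilon>0_def add_nonneg_pos)
  have \<epsilon>01: "\<epsilon>0 \<le> 1" "\<epsilon>0 \<le> e / (4 * (L\<^sup>2 + 1))" "\<epsilon>0 \<le> e / (8 * (K + 1))" by (auto simp: \<epsilon>0_def)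
  have L2: "L\<^sup>2 * \<epsilon>0 \<le> e/4"
  proof -
    have "0 < 4 * (L\<^sup>2 + 1)" by (simp add: add_nonneg_pos)
    then have "\<epsilon>0 * (4 * (L\<^sup>2 + 1)) \<le> e" using \<epsilon>01(2) by (simp only: pos_le_divide_eq)
    then have "(L\<^sup>2 + 1) * \<epsilon>0 \<le> e/4" by (simp add: algebra_simps)
    then show ?thesis using \<epsilon>0 by (simp add: algebra_simps)
  qed
  have K2: "K * \<epsilon>0 \<le> e/8"
  proof -
    have "(K + 1) * \<epsilon>0 \<le> e/8" using \<epsilon>01(3) nn by (simp add: field_simps)
    then show ?thesis using \<epsilon>0 by (simp add: algebra_simps)
  qed
  define N where "N t = H1_norm_torus (\<lambda>x. u t x - u t0 x)" for t
  have "((\<lambda>t. 2 * (N t)\<^sup>2) \<longlongrightarrow> 2 * 0\<^sup>2) (at t0)"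
    unfolding N_def by (intro tendsto_intros u_H1_tendsto t0)
  then have evN: "\<forall>\<^sub>F t in at t0. 2 * (N t)\<^sup>2 < e/4" using e by (intro order_tendstoD(2)) auto
  have evP: "\<forall>\<^sub>F t in at t0. \<forall>x. \<bar>P t x - P t0 x\<bar> \<le> e/8 \<and> \<bar>deriv (P t) x - deriv (P t0) x\<bar> \<le> e/8"
    using P_uniform[OF t0, of "e/8"] e by simp
  have "((\<lambda>t. K * \<bar>\<xi> t x - \<xi> t0 x\<bar>) \<longlongrightarrow> K * \<bar>\<xi> t0 x - \<xi> t0 x\<bar>) (at t0)"
    by (intro tendsto_intros \<xi>_tendsto t0)
  then have ev\<xi>: "\<forall>\<^sub>F t in at t0. K * \<bar>\<xi> t x - \<xi> t0 x\<bar> < e/8" using e by (intro order_tendstoD(2)) auto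
  have "\<forall>\<^sub>F t in at t0. t \<in> I \<and> (\<forall>\<epsilon>. 0 < \<epsilon> \<and> \<epsilon> \<le> \<epsilon>0 \<longrightarrow>
     \<bar>((u t (\<xi> t x + \<epsilon>) - u t (\<xi> t x))\<^sup>2 / 2 + (P t (\<xi> t x + \<epsilon>) - P t (\<xi> t x))) / \<epsilon>
       - deriv (P t0) (\<xi> t0 x)\<bar> \<le> e)"
    using evN evP ev\<xi> eventually_I[OF t0]
  proof eventually_elim
    case (elim t)
    have "\<bar>((u t (\<xi> t x + \<epsilon>) - u t (\<xi> t x))\<^sup>2 / 2 + (P t (\<xi> t x + \<epsilon>) - P t (\<xi> t x))) / \<epsilon>
       - deriv (P t0) (\<xi> t0 x)\<bar> \<le> e" if \<epsilon>: "0 < \<epsilon>" "\<epsilon> \<le> \<epsilon>0" for \<epsilon>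
    proof -
      define z where "z = \<xi> t x"
      define d where "d x = u t x - u t0 x" for x
      have d: "d \<in> Lip_torus" unfolding d_def by (rule Lip_torus_diff[OF u_Lip[OF elim(4)] u_Lip[OF t0]])
      have d1: "(d (z + \<epsilon>) - d z)\<^sup>2 \<le> 2 * \<epsilon> * (N t)\<^sup>2"
        using Lip_torus_osc_le_H1[OF d, of z "z + \<epsilon>"] \<epsilon> \<epsilon>01 unfolding N_def d_def by simp
      have "\<bar>u t0 (z + \<epsilon>) - u t0 z\<bar> \<le> L * \<epsilon>"
        using lipschitz_onD[OF L, of "z + \<epsilon>" z] \<epsilon> by (simp add: dist_real_def)
      then have d2: "(u t0 (z + \<epsilon>) - u t0 z)\<^sup>2 \<le> (L * \<epsilon>)\<^sup>2"
        using \<epsilon> nn by (subst abs_le_square_iff[symmetric]) auto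
      define a b where "a = u t0 (z + \<epsilon>) - u t0 z" and "b = d (z + \<epsilon>) - d z"
      have "0 \<le> (a - b)\<^sup>2" by simp
      then have "(a + b)\<^sup>2 \<le> 2 * a\<^sup>2 + 2 * b\<^sup>2" by (simp add: power2_eq_square algebra_simps)
      moreover have "u t (z + \<epsilon>) - u t z = a + b" by (simp add: a_def b_def d_def)
      ultimately have "(u t (z + \<epsilon>) - u t z)\<^sup>2 \<le> 2 * (L * \<epsilon>)\<^sup>2 + 2 * (2 * \<epsilon> * (N t)\<^sup>2)"
        using d1 d2 unfolding a_def[symmetric] b_def[symmetric] by (simp only:)
      then have "(u t (z + \<epsilon>) - u t z)\<^sup>2 / 2 \<le> (L\<^sup>2 * \<epsilon> + 2 * (N t)\<^sup>2) * \<epsilon>"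
        by (simp add: power2_eq_square algebra_simps)
      then have A: "(u t (z + \<epsilon>) - u t z)\<^sup>2 / 2 / \<epsilon> \<le> L\<^sup>2 * \<epsilon> + 2 * (N t)\<^sup>2"
        using \<epsilon> by (simp add: pos_divide_le_eq)
      have "L\<^sup>2 * \<epsilon> \<le> L\<^sup>2 * \<epsilon>0" using \<epsilon> by (intro mult_left_mono) auto
      then have A': "(u t (z + \<epsilon>) - u t z)\<^sup>2 / 2 / \<epsilon> \<le> e/2" using A L2 elim(1) by linarith
      have A0: "0 \<le> (u t (z + \<epsilon>) - u t z)\<^sup>2 / 2 / \<epsilon>" using \<epsilon> by simp
      obtain y where y: "z < y" "y < z + \<epsilon>" "P t (z + \<epsilon>) - P t z = (z + \<epsilon> - z) * deriv (P t) y"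
        using MVT2[of z "z + \<epsilon>" "P t" "deriv (P t)"] W2inf_torusD(3)[OF P_W2inf[OF elim(4)]] \<epsilon> by auto
      have B: "(P t (z + \<epsilon>) - P t z) / \<epsilon> = deriv (P t) y" using y \<epsilon> by simp
      have "\<bar>deriv (P t0) y - deriv (P t0) (\<xi> t0 x)\<bar> \<le> K * \<bar>y - \<xi> t0 x\<bar>"
        using K unfolding lipschitz_on_def by (auto simp: dist_real_def)
      also have "\<dots> \<le> K * (\<epsilon>0 + \<bar>\<xi> t x - \<xi> t0 x\<bar>)"
        using y \<epsilon> nn by (intro mult_left_mono) (auto simp: z_def)
      also have "\<dots> \<le> e/8 + e/8" using K2 elim(3) by (simp add: algebra_simps)
      finally have "\<bar>deriv (P t) y - deriv (P t0) (\<xi> t0 x)\<bar> \<le> e/8 + (e/8 + e/8)"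
        using elim(2)[rule_format, of y] by linarith
      then have "\<bar>(u t (z + \<epsilon>) - u t z)\<^sup>2 / 2 / \<epsilon> + (P t (z + \<epsilon>) - P t z) / \<epsilon> - deriv (P t0) (\<xi> t0 x)\<bar> \<le> e"
        using A0 A' e unfolding B by linarith
      then show ?thesis unfolding z_def add_divide_distrib[symmetric] .
    qed
    then show ?case using elim(4) by blast
  qed
  then show ?thesis using \<epsilon>0 by blast
qed

text \<open>Only \<open>u\<close> in \<open>C\<^sup>1(L\<^sup>2)\<close> is available, so \<open>u\<close> is averaged over the moving window
  \<open>[\<xi>, \<xi> + \<epsilon>]\<close>; the time derivative of the average is \<open>- ((\<Delta>u)\<^sup>2/2 + \<Delta>P)/\<epsilon>\<close>, in which the
  transport terms have cancelled.\<close>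

lemma velocity_DERIV:
  assumes t0: "t0 \<in> I"
  shows "((\<lambda>t. u t (\<xi> t x)) has_real_derivative - deriv (P t0) (\<xi> t0 x)) (at t0)"
  unfolding has_field_derivative_iff
proof (rule tendstoI)
  fix e :: real assume e: "e > 0"
  define r where "r = deriv (P t0) (\<xi> t0 x)"
  define R where "R \<epsilon> t = ((u t (\<xi> t x + \<epsilon>) - u t (\<xi> t x))\<^sup>2 / 2 + (P t (\<xi> t x + \<epsilon>) - P t (\<xi> t x))) / \<epsilon>" for \<epsilon> t
  define M where "M \<epsilon> t = integral {\<xi> t x..\<xi> t x + \<epsilon>} (u t) / \<epsilon>" for \<epsilon> t
  obtain \<epsilon>0 where \<epsilon>0: "\<epsilon>0 > 0" and ev: "\<forall>\<^sub>F t in at t0. t \<in> I \<and> (\<forall>\<epsilon>. 0 < \<epsilon> \<and> \<epsilon> \<le> \<epsilon>0 \<longrightarrow> \<bar>R \<epsilon> t - r\<bar> \<le> e/2)"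
    using window_rate_bound[OF t0 half_gt_zero[OF e], of x] unfolding R_def r_def by blast
  obtain d where d: "d > 0" "\<And>t. t \<noteq> t0 \<Longrightarrow> dist t t0 < d \<Longrightarrow> t \<in> I \<and> (\<forall>\<epsilon>. 0 < \<epsilon> \<and> \<epsilon> \<le> \<epsilon>0 \<longrightarrow> \<bar>R \<epsilon> t - r\<bar> \<le> e/2)"
    using ev unfolding eventually_at by auto
  have dI: "t \<in> I" if "dist t t0 < d" for t using d(2)[of t] that t0 by (cases "t = t0") auto
  have M: "(M \<epsilon> has_real_derivative - R \<epsilon> t) (at t)" if "t \<in> I" "0 < \<epsilon>" "\<epsilon> \<le> 1" for \<epsilon> t
    using DERIV_cdivide[OF window_along_flow_DERIV[OF that, of x], of \<epsilon>] unfolding M_def R_def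
    by (simp only: divide_minus_left)
  have Mlim: "((\<lambda>\<epsilon>. M \<epsilon> t) \<longlongrightarrow> u t (\<xi> t x)) (at_right 0)" if t: "t \<in> I" for t
  proof -
    obtain L where L: "L-lipschitz_on UNIV (u t)" using u_Lip[OF t] by (rule Lip_torusE)
    have L0: "L \<ge> 0" using L lipschitz_on_nonneg by blast
    have "((\<lambda>\<epsilon>. M \<epsilon> t - u t (\<xi> t x)) \<longlongrightarrow> 0) (at_right 0)"
    proof (rule Lim_null_comparison)
      show "((\<lambda>\<epsilon>. L * \<epsilon>) \<longlongrightarrow> 0) (at_right 0)"
        by (rule tendsto_mult_right_zero) (rule tendsto_ident_at)
      show "\<forall>\<^sub>F \<epsilon> in at_right 0. norm (M \<epsilon> t - u t (\<xi> t x)) \<le> L * \<epsilon>"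
        unfolding eventually_at_right_field
      proof (intro exI[of _ 1] conjI allI impI)
        fix \<epsilon> :: real assume \<epsilon>: "0 < \<epsilon>" "\<epsilon> < 1"
        define z where "z = \<xi> t x"
        have "((\<lambda>y. u t y - u t z) has_integral integral {z..z+\<epsilon>} (u t) - \<epsilon> *\<^sub>R u t z) {z..z+\<epsilon>}"
          using has_integral_const_real[of "u t z" z "z+\<epsilon>"] \<epsilon>
          by (intro has_integral_diff integrable_integral loc_ess_bounded_integrable_on
              Lip_torus_loc_ess_bounded u_Lip t) auto
        then have "norm (integral {z..z+\<epsilon>} (u t) - \<epsilon> *\<^sub>R u t z) \<le> (L * \<epsilon>) * measure lborel {z..z+\<epsilon>}"
        proof (rule has_integral_bound_real[rotated 2])
          fix y assume y: "y \<in> {z..z + \<epsilon>} - {}"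
          have "\<bar>u t y - u t z\<bar> \<le> L * \<bar>y - z\<bar>" using L unfolding lipschitz_on_def by (auto simp: dist_real_def)
          also have "\<dots> \<le> L * \<epsilon>" using y L0 by (intro mult_left_mono) auto
          finally show "norm (u t y - u t z) \<le> L * \<epsilon>" by simp
        qed (use L0 \<epsilon> in auto)
        then have "\<bar>integral {z..z+\<epsilon>} (u t) - \<epsilon> * u t z\<bar> \<le> (L * \<epsilon>) * \<epsilon>" using \<epsilon> by simp
        moreover have "integral {z..z+\<epsilon>} (u t) - \<epsilon> * u t z = \<epsilon> * (M \<epsilon> t - u t z)"
          using \<epsilon> by (simp add: M_def z_def right_diff_distrib)
        ultimately have "\<epsilon> * \<bar>M \<epsilon> t - u t z\<bar> \<le> \<epsilon> * (L * \<epsilon>)" using \<epsilon> by (simp add: abs_mult mult.commute)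
        then show "norm (M \<epsilon> t - u t (\<xi> t x)) \<le> L * \<epsilon>" using \<epsilon> by (simp add: z_def)
      qed auto
    qed
    then show ?thesis by (rule Lim_transform2[rotated, OF _ Lim_null[THEN iffD2], rotated]) (simp add: Lim_null)
  qed
  \<comment> \<open>For fixed \<open>\<epsilon>\<close> the mean value theorem in time gives the
    estimate with the average \<open>M \<epsilon>\<close> in place of the velocity. The bound on
    \<open>R\<close> does not depend on \<open>\<epsilon>\<close>, so it survives the limit, in
    which the average tends to the velocity by Lipschitz continuity in space.\<close>
  have main: "\<bar>(u t (\<xi> t x) - u t0 (\<xi> t0 x)) + r * (t - t0)\<bar> \<le> e/2 * \<bar>t - t0\<bar>"
    if t: "t \<noteq> t0" "dist t t0 < d" for t
  proof (rule tendsto_upperbound)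
    show "((\<lambda>\<epsilon>. \<bar>(M \<epsilon> t - M \<epsilon> t0) + r * (t - t0)\<bar>) \<longlongrightarrow>
        \<bar>(u t (\<xi> t x) - u t0 (\<xi> t0 x)) + r * (t - t0)\<bar>) (at_right 0)"
      by (intro tendsto_intros Mlim t0 dI t)
    show "\<forall>\<^sub>F \<epsilon> in at_right 0. \<bar>(M \<epsilon> t - M \<epsilon> t0) + r * (t - t0)\<bar> \<le> e/2 * \<bar>t - t0\<bar>"
      unfolding eventually_at_right_field
    proof (intro exI[of _ "min 1 \<epsilon>0"] conjI allI impI)
      fix \<epsilon> :: real assume \<epsilon>: "0 < \<epsilon>" "\<epsilon> < min 1 \<epsilon>0"
      have seg: "dist y t0 < d" if "y \<in> closed_segment t0 t" for y
        using dist_in_closed_segment[OF that] t by (auto simp: dist_commute)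
      obtain y where y: "y \<in> open_segment t0 t" "M \<epsilon> t - M \<epsilon> t0 = (t - t0) * - R \<epsilon> y"
        using MVT_segment[of t0 t "M \<epsilon>" "\<lambda>t. - R \<epsilon> t"] t \<epsilon> M dI seg by (metis less_imp_le min_less_iff_conj)
      have "y \<noteq> t0" "y \<in> closed_segment t0 t" using y(1) by (auto simp: open_segment_def)
      then have "\<bar>R \<epsilon> y - r\<bar> \<le> e/2" using d(2)[of y] seg \<epsilon> by auto
      then have "\<bar>t - t0\<bar> * \<bar>R \<epsilon> y - r\<bar> \<le> \<bar>t - t0\<bar> * (e/2)" by (rule mult_left_mono) simp
      moreover have "(M \<epsilon> t - M \<epsilon> t0) + r * (t - t0) = - ((t - t0) * (R \<epsilon> y - r))"
        unfolding y(2) by (simp add: algebra_simps)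
      ultimately show "\<bar>(M \<epsilon> t - M \<epsilon> t0) + r * (t - t0)\<bar> \<le> e/2 * \<bar>t - t0\<bar>"
        by (simp add: abs_mult mult.commute)
    qed (use \<epsilon>0 in auto)
  qed simp
  show "\<forall>\<^sub>F t in at t0. dist ((u t (\<xi> t x) - u t0 (\<xi> t0 x)) / (t - t0)) (- deriv (P t0) (\<xi> t0 x)) < e"
    unfolding eventually_at
  proof (intro exI[of _ d] conjI ballI impI)
    fix t assume t: "t \<noteq> t0 \<and> dist t t0 < d"
    have "(u t (\<xi> t x) - u t0 (\<xi> t0 x)) / (t - t0) - - r = ((u t (\<xi> t x) - u t0 (\<xi> t0 x)) + r * (t - t0)) / (t - t0)"
      using t by (simp add: field_simps)
    then have "\<bar>(u t (\<xi> t x) - u t0 (\<xi> t0 x)) / (t - t0) - - r\<bar> \<le> e/2"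
      using main[of t] t by (simp add: abs_divide pos_divide_le_eq)
    then show "dist ((u t (\<xi> t x) - u t0 (\<xi> t0 x)) / (t - t0)) (- deriv (P t0) (\<xi> t0 x)) < e"
      using e unfolding dist_real_def r_def by linarith
  qed (use d in auto)
qed

end

section \<open>Slopes along the flow\<close>

text \<open>The difference quotients of \<open>f\<close> and \<open>g\<close> at \<open>x\<close>
  differ by at most \<open>e\<close>, so those of \<open>f\<close> oscillate arbitrarily little and
  converge. Differentiability at a prescribed point is thus carried from rational times to all
  times.\<close>

lemma differentiable_lipschitz_closure:
  fixes f :: "real \<Rightarrow> real"
  assumes approx: "\<And>e. e > 0 \<Longrightarrow> \<exists>g. g differentiable at x \<and> e-lipschitz_on UNIV (\<lambda>y. g y - f y)"
  shows "f differentiable at x"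
proof -
  define Q where "Q h y = (h y - h x) / (y - x)" for h :: "real \<Rightarrow> real" and y
  have near: "\<bar>Q g y - Q f y\<bar> \<le> e" if "e-lipschitz_on UNIV (\<lambda>y. g y - f y)" "y \<noteq> x" for g e y
  proof -
    have "\<bar>(g y - f y) - (g x - f x)\<bar> \<le> e * \<bar>y - x\<bar>"
      using that(1) unfolding lipschitz_on_def by (auto simp: dist_real_def)
    moreover have "Q g y - Q f y = ((g y - f y) - (g x - f x)) / (y - x)"
      by (simp add: Q_def diff_divide_distrib)
    ultimately show ?thesis using that(2) by (simp add: pos_divide_le_eq)
  qed
  have ev: "\<exists>l. \<forall>\<^sub>F y in at x. \<bar>Q f y - l\<bar> \<le> e" if e: "e > 0" for e
  proof -
    obtain g where g: "g differentiable at x" "(e/2)-lipschitz_on UNIV (\<lambda>y. g y - f y)"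
      using approx[of "e/2"] e by auto
    obtain l where "(g has_real_derivative l) (at x)" using g(1) real_differentiable_def by blast
    then have "(Q g \<longlongrightarrow> l) (at x)" unfolding Q_def has_field_derivative_iff .
    then have "\<forall>\<^sub>F y in at x. dist (Q g y) l < e/2" using e by (intro tendstoD) auto
    then have "\<forall>\<^sub>F y in at x. \<bar>Q f y - l\<bar> \<le> e" using eventually_neq_at_within[of x x UNIV]
    proof eventually_elim
      case (elim y)
      then show ?case using near[OF g(2) elim(2)] unfolding dist_real_def by linarith
    qed
    then show ?thesis ..
  qed
  obtain l1 where l1: "\<forall>\<^sub>F y in at x. \<bar>Q f y - l1\<bar> \<le> 1" using ev[of 1] by auto
  have "\<exists>l. (Q f \<longlongrightarrow> l) (at x)"
  proof (rule convergent_filter_of_dichotomy)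
    show "\<forall>\<^sub>F y in at x. l1 - 1 \<le> Q f y" "\<forall>\<^sub>F y in at x. Q f y \<le> l1 + 1"
      using l1 by (auto elim: eventually_mono)
    fix \<alpha> \<beta> :: real assume ab: "\<alpha> < \<beta>"
    obtain l where l: "\<forall>\<^sub>F y in at x. \<bar>Q f y - l\<bar> \<le> (\<beta> - \<alpha>) / 2" using ev[of "(\<beta> - \<alpha>) / 2"] ab by auto
    show "(\<forall>\<^sub>F y in at x. \<alpha> \<le> Q f y) \<or> (\<forall>\<^sub>F y in at x. Q f y \<le> \<beta>)"
    proof (cases "l \<ge> (\<alpha> + \<beta>) / 2")
      case True
      have "\<forall>\<^sub>F y in at x. \<alpha> \<le> Q f y" using l
      proof eventually_elim
        case (elim y) then show ?case using True unfolding abs_le_iff by (simp add: field_simps)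
      qed
      then show ?thesis ..
    next
      case False
      have "\<forall>\<^sub>F y in at x. Q f y \<le> \<beta>" using l
      proof eventually_elim
        case (elim y) then show ?case using False unfolding abs_le_iff by (simp add: field_simps)
      qed
      then show ?thesis ..
    qed
  qed auto
  then show ?thesis
    unfolding Q_def by (auto simp: real_differentiable_def has_field_derivative_iff)
qed

lemma deriv_lipschitz_diff_le:
  fixes f g :: "real \<Rightarrow> real"
  assumes "e-lipschitz_on UNIV (\<lambda>y. g y - f y)"
    "(f has_real_derivative a) (at x)" "(g has_real_derivative b) (at x)"
  shows "\<bar>b - a\<bar> \<le> e"
  by (rule lipschitz_DERIV_abs_le[OF assms(1) DERIV_diff[OF assms(3,2)]])

lemma lipschitz_on_of_AE_derivative:
  fixes f :: "real \<Rightarrow> real"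
  assumes L: "L-lipschitz_on UNIV f" and e: "e \<ge> 0"
    and der: "AE x in lebesgue. \<exists>D. (f has_real_derivative D) (at x) \<and> \<bar>D\<bar> \<le> e"
  shows "e-lipschitz_on UNIV f"
proof -
  have le: "\<bar>f y - f x\<bar> \<le> e * (y - x)" if "x \<le> y" for x y
  proof -
    have "\<bar>f y - f x\<bar> = \<bar>integral {x..y} (deriv f)\<bar>"
      using fundamental_theorem_lipschitz[OF L that] by (simp add: integral_unique)
    also have "\<dots> \<le> integral {x..y} (\<lambda>x. \<bar>deriv f x\<bar>)"
      by (rule integral_abs_le[OF loc_ess_bounded_deriv[OF L]])
    also have "\<dots> \<le> integral {x..y} (\<lambda>x. e)"
    proof (rule integral_mono_AE[OF loc_ess_bounded_abs[OF loc_ess_bounded_deriv[OF L]] loc_ess_bounded_const])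
      show "AE z in lebesgue. z \<in> {x..y} \<longrightarrow> \<bar>deriv f z\<bar> \<le> e"
        using der by eventually_elim (metis DERIV_imp_deriv)
    qed
    finally show ?thesis using that by (simp add: mult.commute)
  qed
  show ?thesis
  proof (rule lipschitz_onI[OF _ e])
    fix x y show "dist (f x) (f y) \<le> e * dist x y"
      using le[of x y] le[of y x] by (cases "x \<le> y") (auto simp: dist_real_def abs_minus_commute)
  qed
qed

text \<open>An interchange of the derivatives in time and space at a fixed point: a remainder with
  Lipschitz constant \<open>e\<close> has slope at most \<open>e\<close> in modulus wherever it is
  differentiable.\<close>

lemma DERIV_of_lipschitz_quotient:
  fixes F :: "real \<Rightarrow> real \<Rightarrow> real"
  assumes quot: "\<And>e. e > 0 \<Longrightarrow> \<forall>\<^sub>F s in at t. e-lipschitz_on UNIV (\<lambda>y. (F s y - F t y) / (s - t) - G y)"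
    and F: "\<forall>\<^sub>F s in at t. (F s has_real_derivative f s) (at x)" "(F t has_real_derivative f t) (at x)"
    and G: "(G has_real_derivative g) (at x)"
  shows "(f has_real_derivative g) (at t)"
  unfolding has_field_derivative_iff
proof (rule tendstoI)
  fix e :: real assume e: "e > 0"
  show "\<forall>\<^sub>F s in at t. dist ((f s - f t) / (s - t)) g < e"
    using quot[OF half_gt_zero[OF e]] F(1)
  proof eventually_elim
    case (elim s)
    have "((\<lambda>y. (F s y - F t y) / (s - t)) has_real_derivative (f s - f t) / (s - t)) (at x)"
      by (rule DERIV_cdivide[OF DERIV_diff[OF elim(2) F(2)]])
    from deriv_lipschitz_diff_le[OF elim(1) G this] show ?case using e unfolding dist_real_def by linarith
  qed
qed

lemma uniform_limitI_le:
  fixes f :: "'a \<Rightarrow> 'b \<Rightarrow> real"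
  assumes "\<And>e. e > 0 \<Longrightarrow> \<forall>\<^sub>F s in A. \<forall>x\<in>S. \<bar>f s x - l x\<bar> \<le> e"
  shows "uniform_limit S f l A"
proof (rule uniform_limitI)
  fix e :: real assume e: "e > 0"
  show "\<forall>\<^sub>F s in A. \<forall>x\<in>S. dist (f s x) (l x) < e"
    using assms[OF half_gt_zero[OF e]]
  proof eventually_elim
    case (elim s)
    show ?case
    proof
      fix x assume "x \<in> S"
      then have "\<bar>f s x - l x\<bar> \<le> e / 2" using elim by blast
      then show "dist (f s x) (l x) < e" using e unfolding dist_real_def by linarith
    qed
  qed
qed

lemma uniform_limitD_le:
  fixes f :: "'a \<Rightarrow> 'b \<Rightarrow> real"
  assumes "uniform_limit S f l A" "e > 0"
  shows "\<forall>\<^sub>F s in A. \<forall>x\<in>S. \<bar>f s x - l x\<bar> \<le> e"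
  using uniform_limitD[OF assms] by eventually_elim (auto simp: dist_real_def intro: less_imp_le)

lemma uniform_limit_slope_rate:
  fixes p v q w :: "real \<Rightarrow> real \<Rightarrow> real"
  assumes lim: "uniform_limit S p (p t) A" "uniform_limit S v (v t) A"
      "uniform_limit S q (q t) A" "uniform_limit S w (w t) A"
    and bd: "\<And>x. x \<in> S \<Longrightarrow> \<bar>p t x\<bar> \<le> B" "\<And>x. x \<in> S \<Longrightarrow> \<bar>v t x\<bar> \<le> B"
      "\<And>x. x \<in> S \<Longrightarrow> \<bar>q t x\<bar> \<le> B" "\<And>x. x \<in> S \<Longrightarrow> \<bar>w t x\<bar> \<le> B"
    and c: "c > 0" "\<And>x. x \<in> S \<Longrightarrow> c \<le> q t x"
  shows "uniform_limit S (\<lambda>s x. (p s x - v s x * v s x) * q s x - (w s x * w s x) / (2 * q s x))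
      (\<lambda>x. (p t x - v t x * v t x) * q t x - (w t x * w t x) / (2 * q t x)) A"
proof -
  have b: "bounded ((p t) ` S)" "bounded ((v t) ` S)" "bounded ((q t) ` S)" "bounded ((w t) ` S)"
    using bd by (auto simp: bounded_iff intro!: exI[of _ B])
  have sq: "\<bar>a * a\<bar> \<le> B * B" if "\<bar>a\<bar> \<le> B" for a
    using mult_mono[OF that that] that by (simp add: abs_mult)
  have b2: "bounded ((\<lambda>x. v t x * v t x) ` S)" "bounded ((\<lambda>x. w t x * w t x) ` S)"
    using bd(2,4) sq by (auto simp: bounded_iff intro!: exI[of _ "B * B"])
  have "bounded ((\<lambda>x. p t x - v t x * v t x) ` S)"
  proof -
    have "\<bar>p t x - v t x * v t x\<bar> \<le> B + B * B" if "x \<in> S" for x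
      using bd(1)[OF that] sq[OF bd(2)[OF that]] by linarith
    then show ?thesis by (auto simp: bounded_iff intro!: exI[of _ "B + B * B"])
  qed
  moreover have "uniform_limit S (\<lambda>s x. p s x - v s x * v s x) (\<lambda>x. p t x - v t x * v t x) A"
    by (intro uniform_limit_minus uniform_lim_mult lim b)
  ultimately have 1: "uniform_limit S (\<lambda>s x. (p s x - v s x * v s x) * q s x) (\<lambda>x. (p t x - v t x * v t x) * q t x) A"
    by (intro uniform_lim_mult lim b)
  have 2: "uniform_limit S (\<lambda>s x. (w s x * w s x) / (q s x + q s x)) (\<lambda>x. (w t x * w t x) / (q t x + q t x)) A"
  proof (rule uniform_lim_divide)
    show "uniform_limit S (\<lambda>s x. w s x * w s x) (\<lambda>x. w t x * w t x) A"
      by (intro uniform_lim_mult lim b)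
    show "uniform_limit S (\<lambda>s x. q s x + q s x) (\<lambda>x. q t x + q t x) A"
      by (intro uniform_limit_add lim)
    show "c \<le> norm (q t x + q t x)" if "x \<in> S" for x using c(1) c(2)[OF that] by simp
  qed (use b2 c in auto)
  show ?thesis using uniform_limit_minus[OF 1 2] by (simp only: mult_2)
qed

section \<open>Lagrangian unknowns and the slope of the pressure gradient\<close>

context CH_flow
begin

text \<open>Stated through increments, the bound has no exceptional points, passes to limits in time
  for a fixed \<open>c\<close>, and gives \<open>\<xi> t\<close> a Lipschitz inverse.
  \<open>stretched_q_ge\<close> is its version for slopes.\<close>

definition stretched :: "real \<Rightarrow> bool" where
  "stretched t \<longleftrightarrow> (\<exists>c>0. \<forall>x y. x \<le> y \<longrightarrow> c * (y - x) \<le> \<xi> t y - \<xi> t x)"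

definition q :: "real \<Rightarrow> real \<Rightarrow> real" where "q t x = deriv (\<xi> t) x"
definition w :: "real \<Rightarrow> real \<Rightarrow> real" where "w t x = deriv (\<eta> t) x"
definition p :: "real \<Rightarrow> real \<Rightarrow> real" where "p t x = P t (\<xi> t x)"
definition r :: "real \<Rightarrow> real \<Rightarrow> real" where "r t x = deriv (P t) (\<xi> t x)"
text \<open>This is the space derivative of \<open>r\<close>: the elliptic equation expresses the
  second derivative of \<open>P\<close> by \<open>P\<close>, \<open>u\<close> and
  \<open>u_x\<close>, the latter equals \<open>w/q\<close> along the flow, and the chain rule
  multiplies by \<open>q\<close>.\<close>

definition \<rho> :: "real \<Rightarrow> real \<Rightarrow> real" where
  "\<rho> t x = (p t x - \<eta> t x * \<eta> t x) * q t x - (w t x * w t x) / (2 * q t x)"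

lemma \<eta>_DERIV:
  assumes t: "t \<in> I"
  shows "((\<lambda>s. \<eta> s x) has_real_derivative - r t x) (at t)"
  unfolding r_def
proof (rule has_field_derivative_transform_within_open[OF velocity_DERIV[OF t]])
  show "open I" "t \<in> I" using t by auto
qed (simp add: \<eta>_eq)

lemma p_DERIV_space:
  assumes "t \<in> I" "(\<xi> t has_real_derivative d) (at x)"
  shows "(p t has_real_derivative r t x * d) (at x)"
  unfolding p_def r_def by (rule DERIV_chain2[OF W2inf_torusD(3)[OF P_W2inf[OF assms(1)]] assms(2)])

lemma Lip_along:
  assumes t: "t \<in> I" and f: "f \<in> Lip_torus"
  shows "(\<lambda>x. f (\<xi> t x)) \<in> Lip_torus"
proof -
  obtain K where K: "K-lipschitz_on UNIV (\<xi> t)" using \<xi>_lipschitz[OF t] by blast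
  obtain L where L: "L-lipschitz_on UNIV f" "\<forall>x. f (x + 1) = f x" using f by (rule Lip_torusE)
  have "(L * K)-lipschitz_on UNIV (\<lambda>x. f (\<xi> t x))"
    by (rule lipschitz_on_compose2[OF K lipschitz_on_subset[OF L(1)]]) simp
  then show ?thesis using L(2) \<xi>_periodic[OF t] unfolding Lip_torus_def by auto
qed

lemma p_Lip: "t \<in> I \<Longrightarrow> p t \<in> Lip_torus" and r_Lip: "t \<in> I \<Longrightarrow> r t \<in> Lip_torus"
  using Lip_along W2inf_torusD(1,2)[OF P_W2inf] unfolding p_def[abs_def] r_def[abs_def] by blast+

lemma along_uniform:
  assumes t: "t \<in> I" and e: "e > 0" and f: "F t \<in> Lip_torus"
    and F: "\<And>e. e > 0 \<Longrightarrow> \<forall>\<^sub>F s in at t. \<forall>x. \<bar>F s x - F t x\<bar> \<le> (e::real)"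
  shows "\<forall>\<^sub>F s in at t. \<forall>x. \<bar>F s (\<xi> s x) - F t (\<xi> t x)\<bar> \<le> e"
proof -
  obtain L where L: "L-lipschitz_on UNIV (F t)" using f by (rule Lip_torusE)
  have L0: "L \<ge> 0" using L lipschitz_on_nonneg by blast
  define K where "K = L + 1"
  have K: "K > 0" "L \<le> K" using L0 by (auto simp: K_def)
  have pos: "e / (2 * K) > 0" using e K by simp
  have "\<forall>\<^sub>F s in at t. \<forall>x. \<bar>\<xi> s x - \<xi> t x\<bar> \<le> e / (2 * K)"
    by (rule eventually_mono[OF \<xi>_uniform[OF t pos]]) blast
  then show ?thesis using F[OF half_gt_zero[OF e]]
  proof eventually_elim
    case (elim s)
    show ?case
    proof
      fix x
      have "\<bar>F t (\<xi> s x) - F t (\<xi> t x)\<bar> \<le> L * \<bar>\<xi> s x - \<xi> t x\<bar>"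
        using lipschitz_onD[OF L, of "\<xi> s x" "\<xi> t x"] by (simp add: dist_real_def)
      also have "\<dots> \<le> K * (e / (2 * K))" using elim(1) K by (intro mult_mono) auto
      also have "\<dots> = e / 2" using K by simp
      finally show "\<bar>F s (\<xi> s x) - F t (\<xi> t x)\<bar> \<le> e" using elim(2)[rule_format, of "\<xi> s x"] by linarith
    qed
  qed
qed

lemma p_uniform:
  assumes t: "t \<in> I" and e: "e > 0"
  shows "\<forall>\<^sub>F s in at t. \<forall>x. \<bar>p s x - p t x\<bar> \<le> e"
  unfolding p_def
proof (rule along_uniform[where F = P, OF t e W2inf_torusD(1)[OF P_W2inf[OF t]]])
  fix e :: real assume "e > 0"
  from P_uniform[OF t this] show "\<forall>\<^sub>F s in at t. \<forall>x. \<bar>P s x - P t x\<bar> \<le> e" by eventually_elim auto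
qed

lemma r_uniform:
  assumes t: "t \<in> I" and e: "e > 0"
  shows "\<forall>\<^sub>F s in at t. \<forall>x. \<bar>r s x - r t x\<bar> \<le> e"
  unfolding r_def
proof (rule along_uniform[where F = "\<lambda>t. deriv (P t)", OF t e W2inf_torusD(2)[OF P_W2inf[OF t]]])
  fix e :: real assume "e > 0"
  from P_uniform[OF t this] show "\<forall>\<^sub>F s in at t. \<forall>x. \<bar>deriv (P s) x - deriv (P t) x\<bar> \<le> e" by eventually_elim auto
qed

lemma stretched_q_ge:
  assumes "0 < c" "\<forall>x y. x \<le> y \<longrightarrow> c * (y - x) \<le> \<xi> t y - \<xi> t x" "(\<xi> t has_real_derivative d) (at x)"
  shows "c \<le> d"
proof (rule tendsto_lowerbound)
  show "((\<lambda>y. (\<xi> t y - \<xi> t x) / (y - x)) \<longlongrightarrow> d) (at x)"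
    using assms(3) unfolding has_field_derivative_iff .
  have "c \<le> (\<xi> t y - \<xi> t x) / (y - x)" if "y \<noteq> x" for y
  proof (cases "x < y")
    case True then show ?thesis using assms(2)[rule_format, of x y] by (simp add: pos_le_divide_eq)
  next
    case False
    then have "y < x" using that by simp
    then have "(\<xi> t x - \<xi> t y) / (x - y) \<ge> c" using assms(2)[rule_format, of y x] by (simp add: pos_le_divide_eq)
    moreover have "(\<xi> t y - \<xi> t x) / (y - x) = (\<xi> t x - \<xi> t y) / (x - y)"
      by (metis minus_diff_eq minus_divide_divide)
    ultimately show ?thesis by simp
  qed
  then show "\<forall>\<^sub>F y in at x. c \<le> (\<xi> t y - \<xi> t x) / (y - x)"
    by (auto simp: eventually_at intro!: exI[of _ 1])
qed simp

text \<open>The inverse of \<open>\<xi> t\<close> is Lipschitz with constant \<open>1/c\<close> and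
  so maps null sets to null sets. This is what makes the elliptic equation and the differentiability
  of \<open>u t\<close>, both valid almost everywhere in the Eulerian variable, usable along the
  flow.\<close>

lemma stretched_preimage_null:
  assumes s: "stretched t" and Z: "AE z in lebesgue. Q z"
  shows "AE x in lebesgue. Q (\<xi> t x)"
proof -
  obtain c where c: "c > 0" "\<And>x y. x \<le> y \<Longrightarrow> c * (y - x) \<le> \<xi> t y - \<xi> t x"
    using s unfolding stretched_def by blast
  have exp: "c * \<bar>y - x\<bar> \<le> \<bar>\<xi> t y - \<xi> t x\<bar>" for x y
    using c(2)[of x y] c(2)[of y x] by (cases "x \<le> y") auto
  have inj: "inj (\<xi> t)"
  proof (rule injI)
    fix x y assume "\<xi> t x = \<xi> t y"
    then have "c * \<bar>y - x\<bar> \<le> 0" using exp[of y x] by simp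
    then show "x = y" using c(1) by (simp add: mult_le_0_iff)
  qed
  define S where "S = {z. \<not> Q z} \<inter> range (\<xi> t)"
  define g where "g = inv (\<xi> t)"
  have g: "g (\<xi> t x) = x" for x unfolding g_def using inj by simp
  have "negligible S" using Z unfolding AE_lebesgue_iff_negligible S_def by (rule negligible_subset) auto
  then have "negligible (g ` S)"
  proof (rule negligible_locally_Lipschitz_image[rotated])
    fix z assume z: "z \<in> S"
    have "\<forall>y \<in> S \<inter> UNIV. norm (g y - g z) \<le> (1 / c) * norm (y - z)"
    proof
      fix y assume "y \<in> S \<inter> UNIV"
      then obtain a b where "y = \<xi> t a" "z = \<xi> t b" using z by (auto simp: S_def)
      then show "norm (g y - g z) \<le> (1 / c) * norm (y - z)"
        using exp[of a b] c(1) by (simp add: g field_simps)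
    qed
    then show "\<exists>T B. open T \<and> z \<in> T \<and> (\<forall>y \<in> S \<inter> T. norm (g y - g z) \<le> B * norm (y - z))"
      by (intro exI[of _ UNIV] exI[of _ "1/c"]) auto
  qed simp
  moreover have "{x. \<not> Q (\<xi> t x)} \<subseteq> g ` S"
  proof
    fix x assume "x \<in> {x. \<not> Q (\<xi> t x)}"
    then have "\<xi> t x \<in> S" by (simp add: S_def)
    then show "x \<in> g ` S" using g by (metis image_eqI)
  qed
  ultimately show ?thesis unfolding AE_lebesgue_iff_negligible by (rule negligible_subset)
qed

lemma \<xi>_DERIV_AE: "t \<in> I \<Longrightarrow> AE x in lebesgue. (\<xi> t has_real_derivative q t x) (at x)"
  unfolding q_def using \<xi>_lipschitz lipschitz_on_deriv_AE by blast

lemma \<eta>_DERIV_AE: "t \<in> I \<Longrightarrow> AE x in lebesgue. (\<eta> t has_real_derivative w t x) (at x)"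
  unfolding w_def using \<eta>_Lip lipschitz_on_deriv_AE Lip_torusE by metis

lemma r_DERIV_AE:
  assumes t: "t \<in> I" and s: "stretched t"
  shows "AE x in lebesgue. (r t has_real_derivative \<rho> t x) (at x)"
proof -
  obtain L where L: "L-lipschitz_on UNIV (u t)" using u_Lip[OF t] by (rule Lip_torusE)
  obtain K where K: "K-lipschitz_on UNIV (deriv (P t))" using W2inf_torusD(2)[OF P_W2inf[OF t]] by (rule Lip_torusE)
  have "AE z in lebesgue. (u t has_real_derivative deriv (u t) z) (at z) \<and>
      (deriv (P t) has_real_derivative P t z - (u t z)\<^sup>2 - (deriv (u t) z)\<^sup>2 / 2) (at z)"
    using lipschitz_on_deriv_AE[OF L] lipschitz_on_deriv_AE[OF K] elliptic[OF t]
  proof eventually_elim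
    case (elim z)
    have "deriv (deriv (P t)) z = P t z - (u t z)\<^sup>2 - (deriv (u t) z)\<^sup>2 / 2" using elim(3) by linarith
    then show ?case using elim(1,2) by simp
  qed
  from stretched_preimage_null[OF s this]
  show ?thesis using \<xi>_DERIV_AE[OF t] \<eta>_DERIV_AE[OF t]
  proof eventually_elim
    case (elim x)
    obtain c where c: "c > 0" "\<forall>x y. x \<le> y \<longrightarrow> c * (y - x) \<le> \<xi> t y - \<xi> t x" using s unfolding stretched_def by blast
    have q0: "q t x > 0" using stretched_q_ge[OF c elim(2)] c(1) by linarith
    define d where "d = deriv (u t) (\<xi> t x)"
    have "((\<lambda>y. u t (\<xi> t y)) has_real_derivative d * q t x) (at x)"
      unfolding d_def using DERIV_chain2[OF _ elim(2)] elim(1) by blast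
    then have "(\<eta> t has_real_derivative d * q t x) (at x)" unfolding \<eta>_eq[OF t, abs_def] .
    \<comment> \<open>This identifies \<open>u_x\<close> along the flow as \<open>w/q\<close>, so
      that it can be eliminated from the slope of \<open>r\<close>.\<close>
    then have w: "w t x = d * q t x" using elim(3) DERIV_unique by blast
    have "(r t has_real_derivative (P t (\<xi> t x) - (u t (\<xi> t x))\<^sup>2 - d\<^sup>2 / 2) * q t x) (at x)"
      unfolding r_def[abs_def] d_def using DERIV_chain2[OF _ elim(2)] elim(1) by blast
    moreover have "(P t (\<xi> t x) - (u t (\<xi> t x))\<^sup>2 - d\<^sup>2 / 2) * q t x = \<rho> t x"
      unfolding \<rho>_def p_def w \<eta>_eq[OF t] using q0 by (simp add: power2_eq_square field_simps)
    ultimately show ?case by simp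
  qed
qed

end

section \<open>The slope system off a common null set\<close>

lemma lipschitz_mono_of_AE_derivative:
  fixes f :: "real \<Rightarrow> real"
  assumes L: "L-lipschitz_on UNIV f" and xy: "x \<le> y"
    and der: "AE x in lebesgue. \<exists>D. (f has_real_derivative D) (at x) \<and> 0 \<le> D"
  shows "f x \<le> f y"
proof -
  have "f y - f x = integral {x..y} (deriv f)"
    using fundamental_theorem_lipschitz[OF L xy] by (simp add: integral_unique)
  moreover have "integral {x..y} (\<lambda>_. 0) \<le> integral {x..y} (deriv f)"
  proof (rule integral_mono_AE[OF loc_ess_bounded_const loc_ess_bounded_deriv[OF L]])
    show "AE z in lebesgue. z \<in> {x..y} \<longrightarrow> 0 \<le> deriv f z"
      using der by eventually_elim (metis DERIV_imp_deriv)
  qed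
  ultimately show ?thesis by simp
qed

text \<open>For \<open>a \<le> b\<close> the function \<open>f y * exp (K * y)\<close> is
  nondecreasing; otherwise \<open>f y * exp (- (K * y))\<close> is nonincreasing. The segment covers
  both orientations because the flow is followed in both directions of time.\<close>

lemma Gronwall_lower_bound:
  fixes f :: "real \<Rightarrow> real"
  assumes der: "\<And>y. y \<in> closed_segment a b \<Longrightarrow> (f has_real_derivative f' y) (at y)"
    and le: "\<And>y. y \<in> closed_segment a b \<Longrightarrow> \<bar>f' y\<bar> \<le> K * f y"
  shows "f a * exp (- K * \<bar>b - a\<bar>) \<le> f b"
proof (cases "a \<le> b")
  case True
  then have seg: "closed_segment a b = {a..b}" by (simp add: closed_segment_eq_real_ivl)
  have "f a * exp (K * a) \<le> f b * exp (K * b)"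
  proof (rule DERIV_nonneg_imp_nondecreasing[OF True])
    fix y assume y: "a \<le> y" "y \<le> b"
    then have ys: "y \<in> closed_segment a b" using seg by simp
    have "((\<lambda>y. f y * exp (K * y)) has_real_derivative (f' y + K * f y) * exp (K * y)) (at y)"
      by (rule DERIV_cong, (rule derivative_eq_intros der[OF ys] refl)+) (simp add: algebra_simps)
    moreover have "0 \<le> (f' y + K * f y) * exp (K * y)" using le[OF ys] by (intro mult_nonneg_nonneg) auto
    ultimately show "\<exists>z. ((\<lambda>y. f y * exp (K * y)) has_real_derivative z) (at y) \<and> 0 \<le> z" by blast
  qed
  then have "f a * exp (K * a) * exp (- (K * b)) \<le> f b * exp (K * b) * exp (- (K * b))" by (rule mult_right_mono) simp
  then have "f a * (exp (K * a) * exp (- (K * b))) \<le> f b * (exp (K * b) * exp (- (K * b)))" by (simp only: mult.assoc)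
  moreover have "exp (K * a) * exp (- (K * b)) = exp (- K * \<bar>b - a\<bar>)"
    unfolding exp_add[symmetric] using True by (simp add: algebra_simps)
  ultimately show ?thesis by (simp add: exp_minus)
next
  case False
  then have ba: "b \<le> a" by simp
  then have seg: "closed_segment a b = {b..a}" using False by (simp add: closed_segment_eq_real_ivl)
  have "f b * exp (- (K * b)) \<ge> f a * exp (- (K * a))"
  proof (rule DERIV_nonpos_imp_nonincreasing[OF ba])
    fix y assume y: "b \<le> y" "y \<le> a"
    then have ys: "y \<in> closed_segment a b" using seg by simp
    have "((\<lambda>y. f y * exp (- (K * y))) has_real_derivative (f' y - K * f y) * exp (- (K * y))) (at y)"
      by (rule DERIV_cong, (rule derivative_eq_intros der[OF ys] refl)+) (simp add: algebra_simps)
    moreover have "(f' y - K * f y) * exp (- (K * y)) \<le> 0" using le[OF ys] by (intro mult_nonpos_nonneg) auto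
    ultimately show "\<exists>z. ((\<lambda>y. f y * exp (- (K * y))) has_real_derivative z) (at y) \<and> z \<le> 0" by blast
  qed
  then have "f a * exp (- (K * a)) * exp (K * b) \<le> f b * exp (- (K * b)) * exp (K * b)" by (rule mult_right_mono) simp
  then have "f a * (exp (- (K * a)) * exp (K * b)) \<le> f b * (exp (- (K * b)) * exp (K * b))" by (simp only: mult.assoc)
  moreover have "exp (- (K * a)) * exp (K * b) = exp (- K * \<bar>b - a\<bar>)"
    unfolding exp_add[symmetric] using False by (simp add: algebra_simps)
  ultimately show ?thesis by (simp add: exp_minus)
qed

lemma eventually_at_rational:
  fixes t :: real
  assumes "\<forall>\<^sub>F s in at t. R s"
  shows "\<exists>s\<in>\<rat>. R s"
proof -
  obtain d where d: "d > 0" "\<And>s. s \<noteq> t \<Longrightarrow> dist s t < d \<Longrightarrow> R s"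
    using assms unfolding eventually_at by auto
  obtain s where "s \<in> \<rat>" "t < s" "s < t + d" using Rats_dense_in_real[of t "t + d"] d(1) by auto
  then show ?thesis using d(2)[of s] by (auto simp: dist_real_def)
qed

context CH_flow
begin

text \<open>Along the flow this is \<open>u_x\<close> squared times the volume element
  \<open>q\<close>, the derivative part of the energy density. As an unknown of its own it removes
  the division from the equation for \<open>w\<close>.\<close>

definition h :: "real \<Rightarrow> real \<Rightarrow> real" where "h t x = (w t x * w t x) / q t x"

lemma eventually_J: "(t::real) \<in> {a<..<b} \<Longrightarrow> \<forall>\<^sub>F s in at t. s \<in> {a<..<b}"
  by (rule eventually_at_in_open') auto

text \<open>At each rational time the slopes exist off a null set, and there are countably many such
  times. At any other time the maps are approximated in the Lipschitz seminorm by those at nearby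
  rational times, so the same null set serves.\<close>

lemma spatial_derivatives_all_times:
  assumes J: "{a<..<b} \<subseteq> I"
  obtains N where "negligible N"
    "\<And>x t. x \<notin> N \<Longrightarrow> t \<in> {a<..<b} \<Longrightarrow> (\<xi> t has_real_derivative q t x) (at x)"
    "\<And>x t. x \<notin> N \<Longrightarrow> t \<in> {a<..<b} \<Longrightarrow> (\<eta> t has_real_derivative w t x) (at x)"
proof
  define N where "N = (\<Union>s\<in>\<rat> \<inter> {a<..<b}. {x. \<not> (\<xi> s differentiable at x \<and> \<eta> s differentiable at x)})"
  show "negligible N" unfolding N_def
  proof (rule negligible_countable_Union)
    show "countable ((\<lambda>s. {x. \<not> (\<xi> s differentiable at x \<and> \<eta> s differentiable at x)}) ` (\<rat> \<inter> {a<..<b}))"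
      by (intro countable_image countable_Int1 countable_rat)
    fix A assume "A \<in> (\<lambda>s. {x. \<not> (\<xi> s differentiable at x \<and> \<eta> s differentiable at x)}) ` (\<rat> \<inter> {a<..<b})"
    then obtain s where s: "s \<in> I" "A = {x. \<not> (\<xi> s differentiable at x \<and> \<eta> s differentiable at x)}" using J by blast
    have "AE x in lebesgue. \<xi> s differentiable at x \<and> \<eta> s differentiable at x"
      using \<xi>_DERIV_AE[OF s(1)] \<eta>_DERIV_AE[OF s(1)] by eventually_elim (auto simp: real_differentiable_def)
    then show "negligible A" unfolding s(2) AE_lebesgue_iff_negligible .
  qed
  fix x t assume x: "x \<notin> N" and t: "t \<in> {a<..<b}"
  have tI: "t \<in> I" using t J by blast
  have "\<xi> t differentiable at x"
  proof (rule differentiable_lipschitz_closure)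
    fix e :: real assume e: "e > 0"
    have "\<forall>\<^sub>F s in at t. s \<in> {a<..<b} \<and> e-lipschitz_on UNIV (\<lambda>x. \<xi> s x - \<xi> t x)"
      using eventually_conj[OF eventually_J[OF t] \<xi>_uniform[OF tI e]] by (rule eventually_mono) blast
    from eventually_at_rational[OF this]
    show "\<exists>g. g differentiable at x \<and> e-lipschitz_on UNIV (\<lambda>y. g y - \<xi> t y)" using x by (auto simp: N_def)
  qed
  then show "(\<xi> t has_real_derivative q t x) (at x)" by (simp add: q_def DERIV_deriv_iff_real_differentiable)
  have "\<eta> t differentiable at x"
  proof (rule differentiable_lipschitz_closure)
    fix e :: real assume e: "e > 0"
    have "\<forall>\<^sub>F s in at t. s \<in> {a<..<b} \<and> e-lipschitz_on UNIV (\<lambda>x. \<eta> s x - \<eta> t x)"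
      using eventually_conj[OF eventually_J[OF t] \<eta>_uniform[OF tI e]] by (rule eventually_mono) blast
    from eventually_at_rational[OF this]
    show "\<exists>g. g differentiable at x \<and> e-lipschitz_on UNIV (\<lambda>y. g y - \<eta> t y)" using x by (auto simp: N_def)
  qed
  then show "(\<eta> t has_real_derivative w t x) (at x)" by (simp add: w_def DERIV_deriv_iff_real_differentiable)
qed

lemma \<rho>_uniform:
  assumes J: "{a<..<b} \<subseteq> I" and st: "\<forall>t\<in>{a<..<b}. stretched t"
    and Nq: "\<forall>x\<in>-N. \<forall>t\<in>{a<..<b}. (\<xi> t has_real_derivative q t x) (at x)"
    and Nw: "\<forall>x\<in>-N. \<forall>t\<in>{a<..<b}. (\<eta> t has_real_derivative w t x) (at x)"
    and t: "t \<in> {a<..<b}" and e: "e > 0"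
  shows "\<forall>\<^sub>F s in at t. \<forall>x\<in>-N. \<bar>\<rho> s x - \<rho> t x\<bar> \<le> e"
proof -
  have tI: "t \<in> I" using t J by blast
  obtain c where c: "c > 0" "\<forall>x y. x \<le> y \<longrightarrow> c * (y - x) \<le> \<xi> t y - \<xi> t x" using bspec[OF st t] unfolding stretched_def by blast
  obtain B1 where B1: "\<And>x. \<bar>p t x\<bar> \<le> B1" using Lip_torus_bounded[OF p_Lip[OF tI]] by blast
  obtain B2 where B2: "\<And>x. \<bar>\<eta> t x\<bar> \<le> B2" using Lip_torus_bounded[OF \<eta>_Lip[OF tI]] by blast
  obtain B3 where B3: "B3-lipschitz_on UNIV (\<xi> t)" using \<xi>_lipschitz[OF tI] by blast
  obtain B4 where B4: "B4-lipschitz_on UNIV (\<eta> t)" using \<eta>_Lip[OF tI] by (rule Lip_torusE)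
  define B where "B = max (max B1 B2) (max B3 B4)"
  have "uniform_limit (-N) (\<lambda>s x. (p s x - \<eta> s x * \<eta> s x) * q s x - (w s x * w s x) / (2 * q s x))
      (\<lambda>x. (p t x - \<eta> t x * \<eta> t x) * q t x - (w t x * w t x) / (2 * q t x)) (at t)"
  proof (rule uniform_limit_slope_rate[where B = B and c = c])
    show "uniform_limit (- N) p (p t) (at t)"
      by (rule uniform_limitI_le) (rule eventually_mono[OF p_uniform[OF tI]], auto)
    show "uniform_limit (- N) \<eta> (\<eta> t) (at t)"
      by (rule uniform_limitI_le) (rule eventually_mono[OF \<eta>_uniform[OF tI]], auto)
    show "uniform_limit (- N) q (q t) (at t)"
    proof (rule uniform_limitI_le)
      fix e :: real assume e: "e > 0"
      show "\<forall>\<^sub>F s in at t. \<forall>x\<in>- N. \<bar>q s x - q t x\<bar> \<le> e"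
        using eventually_conj[OF eventually_J[OF t] \<xi>_uniform[OF tI e]]
        by (rule eventually_mono) (auto intro!: deriv_lipschitz_diff_le[OF _ Nq[rule_format] Nq[rule_format]] t)
    qed
    show "uniform_limit (- N) w (w t) (at t)"
    proof (rule uniform_limitI_le)
      fix e :: real assume e: "e > 0"
      show "\<forall>\<^sub>F s in at t. \<forall>x\<in>- N. \<bar>w s x - w t x\<bar> \<le> e"
        using eventually_conj[OF eventually_J[OF t] \<eta>_uniform[OF tI e]]
        by (rule eventually_mono) (auto intro!: deriv_lipschitz_diff_le[OF _ Nw[rule_format] Nw[rule_format]] t)
    qed
    fix x assume x: "x \<in> - N"
    show "\<bar>p t x\<bar> \<le> B" "\<bar>\<eta> t x\<bar> \<le> B" using B1[of x] B2[of x] by (auto simp: B_def)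
    show "\<bar>q t x\<bar> \<le> B" using lipschitz_DERIV_abs_le[OF B3 Nq[rule_format, OF _ t]] x by (fastforce simp: B_def)
    show "\<bar>w t x\<bar> \<le> B" using lipschitz_DERIV_abs_le[OF B4 Nw[rule_format, OF _ t]] x by (fastforce simp: B_def)
    show "c \<le> q t x" using stretched_q_ge[OF c Nq[rule_format, OF _ t]] x by simp
  qed (rule c)
  from uniform_limitD_le[OF this e] show ?thesis unfolding \<rho>_def .
qed

text \<open>Continuity of the pressure in time only yields uniform convergence of \<open>r\<close>.
  Its slope \<open>\<rho>\<close>, however, is an expression in \<open>p\<close>,
  \<open>\<eta>\<close>, \<open>q\<close>, \<open>w\<close>, which converge uniformly off a null
  set, with \<open>q\<close> bounded below at time \<open>t\<close>; small slopes almost everywhere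
  then bound the Lipschitz constant.\<close>

lemma r_lipschitz_uniform:
  assumes J: "{a<..<b} \<subseteq> I" and st: "\<forall>t\<in>{a<..<b}. stretched t"
    and t: "t \<in> {a<..<b}" and e: "e > 0"
  shows "\<forall>\<^sub>F s in at t. e-lipschitz_on UNIV (\<lambda>x. r s x - r t x)"
proof -
  have tI: "t \<in> I" using t J by blast
  obtain N where N: "negligible N"
    "\<And>x t. x \<notin> N \<Longrightarrow> t \<in> {a<..<b} \<Longrightarrow> (\<xi> t has_real_derivative q t x) (at x)"
    "\<And>x t. x \<notin> N \<Longrightarrow> t \<in> {a<..<b} \<Longrightarrow> (\<eta> t has_real_derivative w t x) (at x)"
    using spatial_derivatives_all_times[OF J] by blast
  have Nq: "\<forall>x\<in>-N. \<forall>t\<in>{a<..<b}. (\<xi> t has_real_derivative q t x) (at x)"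
    and Nw: "\<forall>x\<in>-N. \<forall>t\<in>{a<..<b}. (\<eta> t has_real_derivative w t x) (at x)"
    using N(2,3) by blast+
  have AEN: "AE x in lebesgue. x \<in> - N" using N(1) by (simp add: AE_lebesgue_iff_negligible)
  show ?thesis using \<rho>_uniform[OF J st Nq Nw t e] eventually_J[OF t]
  proof eventually_elim
    case (elim s)
    have sI: "s \<in> I" using elim(2) J by blast
    obtain L1 where L1: "L1-lipschitz_on UNIV (r s)" using r_Lip[OF sI] by (rule Lip_torusE)
    obtain L2 where L2: "L2-lipschitz_on UNIV (r t)" using r_Lip[OF tI] by (rule Lip_torusE)
    show ?case
    proof (rule lipschitz_on_of_AE_derivative[OF lipschitz_on_diff[OF L1 L2] less_imp_le[OF e]])
      show "AE x in lebesgue. \<exists>D. ((\<lambda>x. r s x - r t x) has_real_derivative D) (at x) \<and> \<bar>D\<bar> \<le> e"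
        using AEN r_DERIV_AE[OF sI bspec[OF st elim(2)]] r_DERIV_AE[OF tI bspec[OF st t]]
      proof eventually_elim
        case (elim x)
        have "((\<lambda>x. r s x - r t x) has_real_derivative \<rho> s x - \<rho> t x) (at x)" by (rule DERIV_diff[OF elim(2,3)])
        moreover have "\<bar>\<rho> s x - \<rho> t x\<bar> \<le> e"
          using \<open>\<forall>x\<in>-N. \<bar>\<rho> s x - \<rho> t x\<bar> \<le> e\<close> elim(1) by blast
        ultimately show ?case by blast
      qed
    qed
  qed
qed

text \<open>The mean value theorem in time is applied to the increment of \<open>\<eta>\<close>
  between two points, so the quotient becomes an increment of \<open>- r\<close> at an intermediate
  time, which is Lipschitz close to \<open>- r t\<close>. In effect the velocity is differentiable
  in time for the Lipschitz seminorm.\<close>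

lemma \<eta>_quotient_lipschitz:
  assumes J: "{a<..<b} \<subseteq> I" and st: "\<forall>t\<in>{a<..<b}. stretched t"
    and t: "t \<in> {a<..<b}" and e: "e > 0"
  shows "\<forall>\<^sub>F s in at t. e-lipschitz_on UNIV (\<lambda>x. (\<eta> s x - \<eta> t x) / (s - t) - - r t x)"
proof -
  obtain d where d: "d > 0" "\<And>s. s \<noteq> t \<Longrightarrow> dist s t < d \<Longrightarrow> s \<in> {a<..<b} \<and> e-lipschitz_on UNIV (\<lambda>x. r s x - r t x)"
    using eventually_conj[OF eventually_J[OF t] r_lipschitz_uniform[OF J st t e]] unfolding eventually_at by auto
  show ?thesis unfolding eventually_at
  proof (intro exI[of _ d] conjI ballI impI)
    fix s assume s: "s \<noteq> t \<and> dist s t < d"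
    show "e-lipschitz_on UNIV (\<lambda>x. (\<eta> s x - \<eta> t x) / (s - t) - - r t x)"
    proof (rule lipschitz_onI[OF _ less_imp_le[OF e]])
      fix x y
      have sJ: "\<sigma> \<in> {a<..<b}" if "\<sigma> \<in> closed_segment t s" for \<sigma>
        using dist_in_closed_segment[OF that] d(2)[of \<sigma>] s t by (cases "\<sigma> = t") (auto simp: dist_commute)
      obtain \<sigma> where \<sigma>: "\<sigma> \<in> open_segment t s"
          "(\<eta> s x - \<eta> s y) - (\<eta> t x - \<eta> t y) = (s - t) * (- r \<sigma> x - - r \<sigma> y)"
      proof -
        have "\<exists>\<sigma>\<in>open_segment t s. (\<eta> s x - \<eta> s y) - (\<eta> t x - \<eta> t y) = (s - t) * (- r \<sigma> x - - r \<sigma> y)"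
        proof (rule MVT_segment)
          show "t \<noteq> s" using s by simp
          fix \<sigma> assume "\<sigma> \<in> closed_segment t s"
          then have "\<sigma> \<in> I" using sJ J by blast
          then show "((\<lambda>\<sigma>. \<eta> \<sigma> x - \<eta> \<sigma> y) has_real_derivative - r \<sigma> x - - r \<sigma> y) (at \<sigma>)"
            by (intro DERIV_diff \<eta>_DERIV)
        qed
        then show thesis using that by blast
      qed
      have \<sigma>t: "\<sigma> \<noteq> t" "dist \<sigma> t < d"
        using \<sigma>(1) dist_in_closed_segment[of \<sigma> t s] s by (auto simp: open_segment_def dist_commute)
      have "\<bar>(r \<sigma> x - r t x) - (r \<sigma> y - r t y)\<bar> \<le> e * \<bar>x - y\<bar>"
        using d(2)[OF \<sigma>t] lipschitz_onD[of e UNIV "\<lambda>x. r \<sigma> x - r t x" x y] by (auto simp: dist_real_def)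
      moreover have "((\<eta> s x - \<eta> t x) / (s - t) - - r t x) - ((\<eta> s y - \<eta> t y) / (s - t) - - r t y)
          = - ((r \<sigma> x - r t x) - (r \<sigma> y - r t y))"
      proof -
        have "(\<eta> s x - \<eta> t x) / (s - t) - (\<eta> s y - \<eta> t y) / (s - t) = ((\<eta> s x - \<eta> s y) - (\<eta> t x - \<eta> t y)) / (s - t)"
          by (simp add: diff_divide_distrib)
        also have "\<dots> = - r \<sigma> x - - r \<sigma> y" unfolding \<sigma>(2) using s by simp
        finally show ?thesis by linarith
      qed
      ultimately show "dist ((\<eta> s x - \<eta> t x) / (s - t) - - r t x) ((\<eta> s y - \<eta> t y) / (s - t) - - r t y) \<le> e * dist x y"
        unfolding dist_real_def by (metis abs_minus_cancel)
    qed
  qed (use d in auto)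
qed

text \<open>Off one null set the points decouple: at each of them the slopes obey an ODE in time,
  coupled to other points only through \<open>p\<close>. For \<open>r\<close> the closure argument
  yields some slope at every time; comparison with rational times identifies it as
  \<open>\<rho>\<close>.\<close>

lemma characteristic_system:
  assumes J: "{a<..<b} \<subseteq> I" and st: "\<forall>t\<in>{a<..<b}. stretched t"
  obtains N where "negligible N"
    "\<And>x t. x \<notin> N \<Longrightarrow> t \<in> {a<..<b} \<Longrightarrow> (\<xi> t has_real_derivative q t x) (at x)"
    "\<And>x t. x \<notin> N \<Longrightarrow> t \<in> {a<..<b} \<Longrightarrow> (\<eta> t has_real_derivative w t x) (at x)"
    "\<And>x t. x \<notin> N \<Longrightarrow> t \<in> {a<..<b} \<Longrightarrow> (r t has_real_derivative \<rho> t x) (at x)"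
    "\<And>x t. x \<notin> N \<Longrightarrow> t \<in> {a<..<b} \<Longrightarrow> q t x > 0"
    "\<And>x t. x \<notin> N \<Longrightarrow> t \<in> {a<..<b} \<Longrightarrow> ((\<lambda>s. q s x) has_real_derivative w t x) (at t)"
    "\<And>x t. x \<notin> N \<Longrightarrow> t \<in> {a<..<b} \<Longrightarrow> ((\<lambda>s. w s x) has_real_derivative - \<rho> t x) (at t)"
    "\<And>x t. x \<notin> N \<Longrightarrow> t \<in> {a<..<b} \<Longrightarrow>
       ((\<lambda>s. h s x) has_real_derivative 2 * (\<eta> t x * \<eta> t x - p t x) * w t x) (at t)"
proof -
  obtain N0 where N0: "negligible N0"
    "\<And>x t. x \<notin> N0 \<Longrightarrow> t \<in> {a<..<b} \<Longrightarrow> (\<xi> t has_real_derivative q t x) (at x)"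
    "\<And>x t. x \<notin> N0 \<Longrightarrow> t \<in> {a<..<b} \<Longrightarrow> (\<eta> t has_real_derivative w t x) (at x)"
    using spatial_derivatives_all_times[OF J] by blast
  have Nq: "\<forall>x\<in>-N0. \<forall>t\<in>{a<..<b}. (\<xi> t has_real_derivative q t x) (at x)"
    and Nw: "\<forall>x\<in>-N0. \<forall>t\<in>{a<..<b}. (\<eta> t has_real_derivative w t x) (at x)"
    using N0(2,3) by blast+
  define N1 where "N1 = (\<Union>s\<in>\<rat> \<inter> {a<..<b}. {x. \<not> (r s has_real_derivative \<rho> s x) (at x)})"
  have N1: "negligible N1" unfolding N1_def
  proof (rule negligible_countable_Union)
    show "countable ((\<lambda>s. {x. \<not> (r s has_real_derivative \<rho> s x) (at x)}) ` (\<rat> \<inter> {a<..<b}))"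
      by (intro countable_image countable_Int1 countable_rat)
    fix A assume "A \<in> (\<lambda>s. {x. \<not> (r s has_real_derivative \<rho> s x) (at x)}) ` (\<rat> \<inter> {a<..<b})"
    then obtain s where s: "s \<in> I" "stretched s" "A = {x. \<not> (r s has_real_derivative \<rho> s x) (at x)}" using J st by blast
    then show "negligible A" using r_DERIV_AE[OF s(1,2)] by (simp add: AE_lebesgue_iff_negligible)
  qed
  have R: "(r t has_real_derivative \<rho> t x) (at x)" if x: "x \<notin> N0 \<union> N1" and t: "t \<in> {a<..<b}" for x t
  proof -
    have near: "\<exists>s\<in>\<rat> \<inter> {a<..<b}. e-lipschitz_on UNIV (\<lambda>x. r s x - r t x) \<and> \<bar>\<rho> s x - \<rho> t x\<bar> \<le> e" if e: "e > 0" for e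
    proof -
      have "\<forall>\<^sub>F s in at t. s \<in> {a<..<b} \<and> e-lipschitz_on UNIV (\<lambda>x. r s x - r t x) \<and> \<bar>\<rho> s x - \<rho> t x\<bar> \<le> e"
        using eventually_J[OF t] r_lipschitz_uniform[OF J st t e] \<rho>_uniform[OF J st Nq Nw t e]
        by eventually_elim (use x in auto)
      from eventually_at_rational[OF this] show ?thesis by blast
    qed
    have DR: "(r s has_real_derivative \<rho> s x) (at x)" if "s \<in> \<rat> \<inter> {a<..<b}" for s using x that by (auto simp: N1_def)
    have "r t differentiable at x"
    proof (rule differentiable_lipschitz_closure)
      fix e :: real assume "e > 0"
      from near[OF this] show "\<exists>g. g differentiable at x \<and> e-lipschitz_on UNIV (\<lambda>y. g y - r t y)"
        using DR real_differentiable_def by blast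
    qed
    then obtain l where l: "(r t has_real_derivative l) (at x)" using real_differentiable_def by blast
    have "\<bar>l - \<rho> t x\<bar> \<le> e" if e: "e > 0" for e
    proof -
      obtain s where s: "s \<in> \<rat> \<inter> {a<..<b}" "(e/2)-lipschitz_on UNIV (\<lambda>x. r s x - r t x)" "\<bar>\<rho> s x - \<rho> t x\<bar> \<le> e/2"
        using near[OF half_gt_zero[OF e]] by blast
      have "\<bar>\<rho> s x - l\<bar> \<le> e/2" by (rule deriv_lipschitz_diff_le[OF s(2) l DR[OF s(1)]])
      then show ?thesis using s(3) by linarith
    qed
    then have "\<bar>l - \<rho> t x\<bar> \<le> 0" by (rule field_le_epsilon) simp
    then show ?thesis using l by simp
  qed
  have Q: "q t x > 0" if x: "x \<notin> N0" and t: "t \<in> {a<..<b}" for x t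
  proof -
    obtain c where c: "c > 0" "\<forall>x y. x \<le> y \<longrightarrow> c * (y - x) \<le> \<xi> t y - \<xi> t x" using bspec[OF st t] unfolding stretched_def by blast
    show ?thesis using stretched_q_ge[OF c N0(2)[OF x t]] c(1) by linarith
  qed
  have Dq: "((\<lambda>s. q s x) has_real_derivative w t x) (at t)" if x: "x \<notin> N0" and t: "t \<in> {a<..<b}" for x t
  proof (rule DERIV_of_lipschitz_quotient)
    have tI: "t \<in> I" using t J by blast
    show "\<forall>\<^sub>F s in at t. e-lipschitz_on UNIV (\<lambda>y. (\<xi> s y - \<xi> t y) / (s - t) - \<eta> t y)" if "e > 0" for e
      using \<xi>_quotient_uniform[OF tI that] by (rule eventually_mono) (rule conjunct2)
    show "\<forall>\<^sub>F s in at t. (\<xi> s has_real_derivative q s x) (at x)"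
      by (rule eventually_mono[OF eventually_J[OF t] N0(2)[OF x]])
    show "(\<xi> t has_real_derivative q t x) (at x)" by (rule N0(2)[OF x t])
    show "(\<eta> t has_real_derivative w t x) (at x)" by (rule N0(3)[OF x t])
  qed
  have Dw: "((\<lambda>s. w s x) has_real_derivative - \<rho> t x) (at t)" if x: "x \<notin> N0 \<union> N1" and t: "t \<in> {a<..<b}" for x t
  proof (rule DERIV_of_lipschitz_quotient)
    have x0: "x \<notin> N0" using x by blast
    show "\<forall>\<^sub>F s in at t. e-lipschitz_on UNIV (\<lambda>y. (\<eta> s y - \<eta> t y) / (s - t) - - r t y)" if "e > 0" for e
      by (rule \<eta>_quotient_lipschitz[OF J st t that])
    show "\<forall>\<^sub>F s in at t. (\<eta> s has_real_derivative w s x) (at x)"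
      by (rule eventually_mono[OF eventually_J[OF t] N0(3)[OF x0]])
    show "(\<eta> t has_real_derivative w t x) (at x)" by (rule N0(3)[OF x0 t])
    show "((\<lambda>x. - r t x) has_real_derivative - \<rho> t x) (at x)" by (rule DERIV_minus[OF R[OF x t]])
  qed
  have Dh: "((\<lambda>s. h s x) has_real_derivative 2 * (\<eta> t x * \<eta> t x - p t x) * w t x) (at t)"
    if x: "x \<notin> N0 \<union> N1" and t: "t \<in> {a<..<b}" for x t
  proof -
    have x0: "x \<notin> N0" using x by blast
    have q0: "q t x \<noteq> 0" using Q[OF x0 t] by simp
    have "((\<lambda>s. h s x) has_real_derivative
       ((- \<rho> t x * w t x + - \<rho> t x * w t x) * q t x - (w t x * w t x) * w t x) / (q t x * q t x)) (at t)"
      unfolding h_def by (rule DERIV_divide[OF DERIV_mult'[OF Dw[OF x t] Dw[OF x t], THEN DERIV_cong] Dq[OF x0 t] q0]) simp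
    \<comment> \<open>With \<open>- \<rho>\<close> as the derivative of \<open>w\<close>, that is
      \<open>(\<eta>\<^sup>2 - p) q + w\<^sup>2/(2 q)\<close>, the two terms in
      \<open>w\<^sup>3\<close> from the quotient rule cancel. This is why the equation for
      \<open>h\<close> contains no division.\<close>
    moreover have "((- \<rho> t x * w t x + - \<rho> t x * w t x) * q t x - (w t x * w t x) * w t x) / (q t x * q t x)
        = 2 * (\<eta> t x * \<eta> t x - p t x) * w t x"
      unfolding \<rho>_def using q0 by (simp add: field_simps)
    ultimately show ?thesis by simp
  qed
  show thesis
    by (rule that[of "N0 \<union> N1"]) (use N0 N1 R Q Dq Dw Dh in \<open>auto intro: negligible_Un\<close>)
qed

section \<open>Persistence of the lower bound on the slope of the flow\<close>

text \<open>The slope \<open>q\<close> alone cannot be followed up to \<open>c\<close>, since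
  \<open>q' = w\<close> and \<open>w\<^sup>2 = q * h\<close> give no bound on \<open>w/q\<close>;
  the sum \<open>q + h\<close> has a bounded logarithmic derivative. The identity
  \<open>h = 2 (p - \<eta>\<^sup>2) q - 2 \<rho>\<close> then turns its lower bound into one on
  increments of \<open>\<xi>\<close> and \<open>r\<close>, which have limits at \<open>c\<close>
  even if \<open>h\<close> has none.\<close>

lemma stretched_endpoint:
  assumes J: "{a<..<b} \<subseteq> I" and ab: "a < b" and st: "\<forall>t\<in>{a<..<b}. stretched t"
    and c: "c \<in> {a, b}" "c \<in> I"
  shows "stretched c"
proof -
  obtain N where N: "negligible N"
    "\<And>x t. x \<notin> N \<Longrightarrow> t \<in> {a<..<b} \<Longrightarrow> (\<xi> t has_real_derivative q t x) (at x)"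
    "\<And>x t. x \<notin> N \<Longrightarrow> t \<in> {a<..<b} \<Longrightarrow> (\<eta> t has_real_derivative w t x) (at x)"
    "\<And>x t. x \<notin> N \<Longrightarrow> t \<in> {a<..<b} \<Longrightarrow> (r t has_real_derivative \<rho> t x) (at x)"
    "\<And>x t. x \<notin> N \<Longrightarrow> t \<in> {a<..<b} \<Longrightarrow> q t x > 0"
    "\<And>x t. x \<notin> N \<Longrightarrow> t \<in> {a<..<b} \<Longrightarrow> ((\<lambda>s. q s x) has_real_derivative w t x) (at t)"
    "\<And>x t. x \<notin> N \<Longrightarrow> t \<in> {a<..<b} \<Longrightarrow> ((\<lambda>s. w s x) has_real_derivative - \<rho> t x) (at t)"
    "\<And>x t. x \<notin> N \<Longrightarrow> t \<in> {a<..<b} \<Longrightarrow>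
       ((\<lambda>s. h s x) has_real_derivative 2 * (\<eta> t x * \<eta> t x - p t x) * w t x) (at t)"
    using characteristic_system[OF J st] by blast
  obtain B1 where B1: "\<And>x. \<bar>p c x\<bar> \<le> B1" using Lip_torus_bounded[OF p_Lip[OF c(2)]] by blast
  obtain B2 where B2: "\<And>x. \<bar>\<eta> c x\<bar> \<le> B2" using Lip_torus_bounded[OF \<eta>_Lip[OF c(2)]] by blast
  define B where "B = max B1 B2 + 1"
  have ev: "\<forall>\<^sub>F s in at c. \<forall>x. \<bar>p s x\<bar> \<le> B \<and> \<bar>\<eta> s x\<bar> \<le> B"
    using p_uniform[OF c(2) zero_less_one] \<eta>_uniform[OF c(2) zero_less_one]
  proof eventually_elim
    case (elim s)
    show ?case
    proof
      fix x
      have "\<bar>p s x - p c x\<bar> \<le> 1" "\<bar>\<eta> s x - \<eta> c x\<bar> \<le> 1" using elim by blast+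
      then show "\<bar>p s x\<bar> \<le> B \<and> \<bar>\<eta> s x\<bar> \<le> B" using B1[of x] B2[of x] unfolding B_def by (auto simp: max_def)
    qed
  qed
  have B0: "B \<ge> 0" using B1[of 0] by (auto simp: B_def)
  obtain \<delta> where \<delta>: "\<delta> > 0" "\<And>s x. s \<noteq> c \<Longrightarrow> dist s c < \<delta> \<Longrightarrow> \<bar>p s x\<bar> \<le> B \<and> \<bar>\<eta> s x\<bar> \<le> B"
    using ev unfolding eventually_at by auto
  \<comment> \<open>\<open>K\<close> bounds \<open>1 + 2 (\<eta>\<^sup>2 - p)\<close>, the
    coefficient of \<open>w\<close> in the derivative of \<open>q + h\<close>, and likewise
    \<open>1 + 2 (p - \<eta>\<^sup>2)\<close>, the coefficient of \<open>q\<close> once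
    \<open>h\<close> has been expressed by \<open>\<rho>\<close>.\<close>
  define K where "K = 1 + 2 * (B + B * B)"
  have K: "K \<ge> 1" using B0 by (simp add: K_def)
  have coef: "\<bar>\<eta> s x * \<eta> s x - p s x\<bar> \<le> B + B * B" if "s \<noteq> c" "dist s c < \<delta>" for s x
  proof -
    have "\<bar>\<eta> s x\<bar> * \<bar>\<eta> s x\<bar> \<le> B * B" using \<delta>(2)[OF that, of x] by (intro mult_mono) auto
    then have "\<bar>\<eta> s x * \<eta> s x\<bar> \<le> B * B" by (simp add: abs_mult)
    then show ?thesis using \<delta>(2)[OF that, of x] by linarith
  qed
  define m where "m = min \<delta> (b - a)"
  have m: "m > 0" using \<delta> ab by (simp add: m_def)
  \<comment> \<open>A fixed interior time, close enough to \<open>c\<close> for the bounds on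
    \<open>p\<close> and \<open>\<eta>\<close>. The interval \<open>J'\<close> between it and
    \<open>c\<close> is where the estimate is propagated.\<close>
  define t1 where "t1 = (if c = a then a + m / 2 else b - m / 2)"
  have t1: "t1 \<in> {a<..<b}" "t1 \<noteq> c" "dist t1 c < \<delta>"
  proof -
    have "m \<le> b - a" "m \<le> \<delta>" by (auto simp: m_def)
    then show "t1 \<in> {a<..<b}" "t1 \<noteq> c" "dist t1 c < \<delta>"
      using m c(1) ab unfolding t1_def by (auto simp: dist_real_def)
  qed
  define J' where "J' = (if c = a then {a<..<t1} else {t1<..<b})"
  have seg: "y \<in> {a<..<b} \<and> y \<noteq> c \<and> dist y c < \<delta>" if "s \<in> J'" "y \<in> closed_segment t1 s" for s y
    using that t1 c(1) unfolding J'_def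
    by (auto simp: closed_segment_eq_real_ivl dist_real_def split: if_splits)
  obtain c1 where c1: "c1 > 0" "\<forall>x y. x \<le> y \<longrightarrow> c1 * (y - x) \<le> \<xi> t1 y - \<xi> t1 x"
    using bspec[OF st t1(1)] unfolding stretched_def by blast
  define \<kappa> where "\<kappa> = c1 * exp (- K * (b - a))"
  have \<kappa>: "\<kappa> > 0" using c1 by (simp add: \<kappa>_def)
  have grow: "\<kappa> \<le> q s x + h s x" if x: "x \<notin> N" and s: "s \<in> J'" for x s
  proof -
    have "(q t1 x + h t1 x) * exp (- K * \<bar>s - t1\<bar>) \<le> q s x + h s x"
    proof (rule Gronwall_lower_bound)
      fix y assume y: "y \<in> closed_segment t1 s"
      have yJ: "y \<in> {a<..<b}" "y \<noteq> c" "dist y c < \<delta>" using seg[OF s y] by auto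
      show "((\<lambda>s. q s x + h s x) has_real_derivative w y x + 2 * (\<eta> y x * \<eta> y x - p y x) * w y x) (at y)"
        by (rule DERIV_add[OF N(6)[OF x yJ(1)] N(8)[OF x yJ(1)]])
      have q0: "q y x > 0" by (rule N(5)[OF x yJ(1)])
      have h0: "h y x \<ge> 0" using q0 by (simp add: h_def)
      \<comment> \<open>The modulus of \<open>w\<close> is the geometric mean of \<open>q\<close>
        and \<open>h\<close>, hence below their sum; this closes the Gronwall estimate.\<close>
      have "w y x * w y x = q y x * h y x" using q0 by (simp add: h_def)
      moreover have "0 \<le> (q y x - h y x)\<^sup>2" by simp
      ultimately have "(w y x)\<^sup>2 \<le> (q y x + h y x)\<^sup>2"
        using q0 h0 by (simp add: power2_eq_square algebra_simps)
      then have w: "\<bar>w y x\<bar> \<le> q y x + h y x" using q0 h0 by (simp add: power2_le_iff_abs_le)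
      have "\<bar>w y x + 2 * (\<eta> y x * \<eta> y x - p y x) * w y x\<bar> = \<bar>1 + 2 * (\<eta> y x * \<eta> y x - p y x)\<bar> * \<bar>w y x\<bar>"
        by (simp add: abs_mult[symmetric] algebra_simps)
      also have "\<dots> \<le> K * (q y x + h y x)"
        using coef[OF yJ(2,3), of x] w K unfolding K_def by (intro mult_mono) (auto simp: abs_le_iff)
      finally show "\<bar>w y x + 2 * (\<eta> y x * \<eta> y x - p y x) * w y x\<bar> \<le> K * (q y x + h y x)" .
    qed
    moreover have "\<kappa> \<le> (q t1 x + h t1 x) * exp (- K * \<bar>s - t1\<bar>)"
      unfolding \<kappa>_def
    proof (rule mult_mono)
      have "c1 \<le> q t1 x" by (rule stretched_q_ge[OF c1 N(2)[OF x t1(1)]])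
      moreover have "h t1 x \<ge> 0" using N(5)[OF x t1(1)] by (simp add: h_def)
      ultimately show "c1 \<le> q t1 x + h t1 x" by simp
      then show "0 \<le> q t1 x + h t1 x" using c1 by linarith
      have "\<bar>s - t1\<bar> \<le> b - a" using s t1 unfolding J'_def by (auto split: if_splits)
      then show "exp (- K * (b - a)) \<le> exp (- K * \<bar>s - t1\<bar>)" using K by (simp add: mult_left_mono)
    qed simp
    ultimately show ?thesis by linarith
  qed
  have J'J: "s \<in> {a<..<b}" "s \<noteq> c" "dist s c < \<delta>" if "s \<in> J'" for s using seg[OF that, of s] by auto
  \<comment> \<open>On slopes this says \<open>\<kappa> \<le> q + h \<le> K q - 2 \<rho>\<close>.
    Integrated in space, the right-hand side involves only \<open>\<xi>\<close> and
    \<open>r\<close>, which converge as \<open>s\<close> tends to \<open>c\<close>.\<close>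
  have ineq: "\<kappa> * (y - x) \<le> K * (\<xi> s y - \<xi> s x) - 2 * (r s y - r s x) \<and> 0 \<le> \<xi> s y - \<xi> s x" if xy: "x \<le> y" and s: "s \<in> J'" for x y s
  proof -
    have sI: "s \<in> I" using J'J(1)[OF s] J by blast
    obtain L1 where L1: "L1-lipschitz_on UNIV (\<xi> s)" using \<xi>_lipschitz[OF sI] by blast
    obtain L2 where L2: "L2-lipschitz_on UNIV (r s)" using r_Lip[OF sI] by (rule Lip_torusE)
    have L3: "1-lipschitz_on UNIV (\<lambda>z::real. z)" by (simp add: lipschitz_on_def)
    have AEN: "AE x in lebesgue. x \<notin> N" using N(1) by (simp add: AE_lebesgue_iff_negligible)
    have "K * \<xi> s x - 2 * r s x - \<kappa> * x \<le> K * \<xi> s y - 2 * r s y - \<kappa> * y"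
    proof (rule lipschitz_mono_of_AE_derivative[OF _ xy])
      show "(\<bar>K\<bar> * L1 + \<bar>2\<bar> * L2 + \<bar>\<kappa>\<bar> * 1)-lipschitz_on UNIV (\<lambda>z. K * \<xi> s z - 2 * r s z - \<kappa> * z)"
        by (intro lipschitz_on_diff lipschitz_on_cmult_real L1 L2 L3)
      show "AE z in lebesgue. \<exists>D. ((\<lambda>z. K * \<xi> s z - 2 * r s z - \<kappa> * z) has_real_derivative D) (at z) \<and> 0 \<le> D"
        using AEN
      proof eventually_elim
        case (elim z)
        have "((\<lambda>z. K * \<xi> s z - 2 * r s z - \<kappa> * z) has_real_derivative K * q s z - 2 * \<rho> s z - \<kappa>) (at z)"
          using N(2)[OF elim J'J(1)[OF s]] N(4)[OF elim J'J(1)[OF s]] by (auto intro!: derivative_eq_intros)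
        moreover have "0 \<le> K * q s z - 2 * \<rho> s z - \<kappa>"
        proof -
          have q0: "q s z > 0" by (rule N(5)[OF elim J'J(1)[OF s]])
          have "h s z = 2 * ((p s z - \<eta> s z * \<eta> s z) * q s z) - 2 * \<rho> s z"
            using q0 by (simp add: \<rho>_def h_def)
          moreover have "(p s z - \<eta> s z * \<eta> s z) * q s z \<le> (B + B * B) * q s z"
            using coef[OF J'J(2,3)[OF s], of z] q0 by (intro mult_right_mono) linarith+
          moreover have "K * q s z = q s z + 2 * ((B + B * B) * q s z)" by (simp add: K_def algebra_simps)
          ultimately show ?thesis using grow[OF elim s] by linarith
        qed
        ultimately show ?case by blast
      qed
    qed
    moreover obtain cs where cs: "cs > 0" "\<forall>x y. x \<le> y \<longrightarrow> cs * (y - x) \<le> \<xi> s y - \<xi> s x"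
      using bspec[OF st J'J(1)[OF s]] unfolding stretched_def by blast
    then have "0 \<le> \<xi> s y - \<xi> s x" using xy by (meson diff_ge_0_iff_ge less_imp_le mult_nonneg_nonneg order_trans)
    ultimately show ?thesis by (simp add: algebra_simps)
  qed
  have nb: "at c within J' \<noteq> bot"
    using t1 c(1) unfolding J'_def by (auto simp: trivial_limit_within islimpt_greaterThanLessThan1 islimpt_greaterThanLessThan2)
  have lim\<xi>: "((\<lambda>s. \<xi> s x) \<longlongrightarrow> \<xi> c x) (at c within J')" for x
    by (rule tendsto_within_subset[OF \<xi>_tendsto[OF c(2)]]) simp
  have limr: "((\<lambda>s. r s x) \<longlongrightarrow> r c x) (at c within J')" for x
  proof -
    have "((\<lambda>s. r s x) \<longlongrightarrow> r c x) (at c)"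
    proof (rule tendstoI)
      fix e :: real assume e: "e > 0"
      show "\<forall>\<^sub>F s in at c. dist (r s x) (r c x) < e"
        using r_uniform[OF c(2) half_gt_zero[OF e]]
      proof eventually_elim
        case (elim s)
        have "\<bar>r s x - r c x\<bar> \<le> e/2" using elim by blast
        then show ?case using e unfolding dist_real_def by linarith
      qed
    qed
    then show ?thesis by (rule tendsto_within_subset) simp
  qed
  have evJ': "\<forall>\<^sub>F s in at c within J'. s \<in> J'" by (simp add: eventually_at_filter)
  obtain L where L: "L-lipschitz_on UNIV (deriv (P c))" using W2inf_torusD(2)[OF P_W2inf[OF c(2)]] by (rule Lip_torusE)
  have L0: "L \<ge> 0" using L lipschitz_on_nonneg by blast
  show ?thesis unfolding stretched_def
  \<comment> \<open>At time \<open>c\<close> itself \<open>r\<close> is the Lipschitz function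
    \<open>deriv (P c)\<close> composed with \<open>\<xi> c\<close>, so its increment is at most
    \<open>L\<close> times that of \<open>\<xi> c\<close>, without any stretching at
    \<open>c\<close>. Absorbing it gives the denominator.\<close>
  proof (intro exI[of _ "\<kappa> / (K + 2 * L)"] conjI allI impI)
    show "\<kappa> / (K + 2 * L) > 0" using \<kappa> K L0 by simp
    fix x y :: real assume xy: "x \<le> y"
    have 1: "\<kappa> * (y - x) \<le> K * (\<xi> c y - \<xi> c x) - 2 * (r c y - r c x)"
    proof (rule tendsto_lowerbound[OF _ _ nb])
      show "((\<lambda>s. K * (\<xi> s y - \<xi> s x) - 2 * (r s y - r s x)) \<longlongrightarrow> K * (\<xi> c y - \<xi> c x) - 2 * (r c y - r c x)) (at c within J')"
        by (intro tendsto_intros lim\<xi> limr)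
      show "\<forall>\<^sub>F s in at c within J'. \<kappa> * (y - x) \<le> K * (\<xi> s y - \<xi> s x) - 2 * (r s y - r s x)"
        using evJ' by eventually_elim (use ineq[OF xy] in blast)
    qed
    have 2: "0 \<le> \<xi> c y - \<xi> c x"
    proof (rule tendsto_lowerbound[OF _ _ nb])
      show "((\<lambda>s. \<xi> s y - \<xi> s x) \<longlongrightarrow> \<xi> c y - \<xi> c x) (at c within J')" by (intro tendsto_intros lim\<xi>)
      show "\<forall>\<^sub>F s in at c within J'. 0 \<le> \<xi> s y - \<xi> s x"
        using evJ' by eventually_elim (use ineq[OF xy] in blast)
    qed
    have "\<bar>r c y - r c x\<bar> \<le> L * \<bar>\<xi> c y - \<xi> c x\<bar>"
      using lipschitz_onD[OF L, of "\<xi> c y" "\<xi> c x"] by (simp add: dist_real_def r_def)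
    then have "\<kappa> * (y - x) \<le> (K + 2 * L) * (\<xi> c y - \<xi> c x)" using 1 2 by (simp add: algebra_simps)
    then show "\<kappa> / (K + 2 * L) * (y - x) \<le> \<xi> c y - \<xi> c x"
      using K L0 by (simp add: pos_divide_le_eq mult.commute)
  qed
qed

lemma stretched_open:
  assumes t: "t \<in> I" and s: "stretched t"
  shows "\<forall>\<^sub>F s in at t. stretched s"
proof -
  obtain c where c: "c > 0" "\<And>x y. x \<le> y \<Longrightarrow> c * (y - x) \<le> \<xi> t y - \<xi> t x" using s unfolding stretched_def by blast
  show ?thesis using \<xi>_uniform[OF t half_gt_zero[OF c(1)]]
  proof eventually_elim
    case (elim s)
    show ?case unfolding stretched_def
    proof (intro exI[of _ "c/2"] conjI allI impI)
      fix x y :: real assume xy: "x \<le> y"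
      have "\<bar>(\<xi> s y - \<xi> t y) - (\<xi> s x - \<xi> t x)\<bar> \<le> c/2 * (y - x)"
        using lipschitz_onD[OF conjunct2[OF elim], of y x] xy by (simp add: dist_real_def)
      moreover have "c * (y - x) = c/2 * (y - x) + c/2 * (y - x)" by (simp add: algebra_simps)
      ultimately show "c/2 * (y - x) \<le> \<xi> s y - \<xi> s x" using c(2)[OF xy] by linarith
    qed (use c in simp)
  qed
qed

lemma stretched_zero: "stretched 0"
  unfolding stretched_def by (intro exI[of _ 1]) (simp add: \<xi>_zero)

text \<open>Stretching is an open condition, so the failure time nearest to 0 on either side would
  itself be a failure, at the end of an interval of stretched times;
  \<open>stretched_endpoint\<close> excludes this.\<close>

lemma stretched_all:
  assumes t: "t \<in> I"
  shows "stretched t"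
proof (rule ccontr)
  assume nt: "\<not> stretched t"
  consider "t > 0" | "t < 0" using nt stretched_zero by (cases "t = 0") (auto, linarith)
  then show False
  proof cases
    case 1
    define S where "S = {s \<in> {0..t}. \<not> stretched s}"
    define b where "b = Inf S"
    have tS: "t \<in> S" using 1 nt by (simp add: S_def)
    have bdd: "bdd_below S" by (auto simp: S_def intro: bdd_belowI[of _ 0])
    have b1: "0 \<le> b" unfolding b_def by (rule cInf_greatest) (use tS in \<open>auto simp: S_def\<close>)
    have b2: "b \<le> t" unfolding b_def by (rule cInf_lower[OF tS bdd])
    note b = b1 b2
    have bI: "b \<in> I" using b t T_pos by auto
    have below: "stretched s" if "0 \<le> s" "s < b" for s
    proof (rule ccontr)
      assume "\<not> stretched s"
      then have "s \<in> S" using that b by (simp add: S_def)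
      then have "b \<le> s" unfolding b_def by (rule cInf_lower[OF _ bdd])
      then show False using that by simp
    qed
    have nb: "\<not> stretched b"
    proof
      assume sb: "stretched b"
      then obtain d where d: "d > 0" "\<And>s. s \<noteq> b \<Longrightarrow> dist s b < d \<Longrightarrow> stretched s"
        using stretched_open[OF bI] unfolding eventually_at by auto
      have "Inf S < b + d" using d(1) by (simp only: b_def less_add_same_cancel1)
      then obtain s where s: "s \<in> S" "s < b + d" using cInf_lessD[of S "b + d"] tS by blast
      have "b \<le> s" unfolding b_def by (rule cInf_lower[OF s(1) bdd])
      then have "stretched s" using d(2)[of s] s sb by (cases "s = b") (auto simp: dist_real_def)
      then show False using s by (simp add: S_def)
    qed
    have b0: "0 < b" using b(1) nb stretched_zero by (cases "b = 0") auto
    have "stretched b"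
      by (rule stretched_endpoint[of 0 b]) (use b0 bI below t T_pos b in \<open>auto simp: subset_iff\<close>)
    then show False using nb by simp
  next
    case 2
    define S where "S = {s \<in> {t..0}. \<not> stretched s}"
    define b where "b = Sup S"
    have tS: "t \<in> S" using 2 nt by (simp add: S_def)
    have bdd: "bdd_above S" by (auto simp: S_def intro: bdd_aboveI[of _ 0])
    have b1: "b \<le> 0" unfolding b_def by (rule cSup_least) (use tS in \<open>auto simp: S_def\<close>)
    have b2: "t \<le> b" unfolding b_def by (rule cSup_upper[OF tS bdd])
    note b = b1 b2
    have bI: "b \<in> I" using b t T_pos by auto
    have above: "stretched s" if "s \<le> 0" "b < s" for s
    proof (rule ccontr)
      assume "\<not> stretched s"
      then have "s \<in> S" using that b by (simp add: S_def)
      then have "s \<le> b" unfolding b_def by (rule cSup_upper[OF _ bdd])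
      then show False using that by simp
    qed
    have nb: "\<not> stretched b"
    proof
      assume sb: "stretched b"
      then obtain d where d: "d > 0" "\<And>s. s \<noteq> b \<Longrightarrow> dist s b < d \<Longrightarrow> stretched s"
        using stretched_open[OF bI] unfolding eventually_at by auto
      have "b - d < Sup S" using d(1) unfolding b_def by simp
      then obtain s where s: "s \<in> S" "b - d < s" using less_cSupD[of S "b - d"] tS by blast
      have "s \<le> b" unfolding b_def by (rule cSup_upper[OF s(1) bdd])
      then have "stretched s" using d(2)[of s] s sb by (cases "s = b") (auto simp: dist_real_def)
      then show False using s by (simp add: S_def)
    qed
    have b0: "b < 0" using b(1) nb stretched_zero by (cases "b = 0") auto
    have "stretched b"
      by (rule stretched_endpoint[of b 0]) (use b0 bI above t T_pos b in \<open>auto simp: subset_iff\<close>)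
    then show False using nb by simp
  qed
qed

end

section \<open>Truncated expansions in time\<close>

definition \<omega> :: "nat \<Rightarrow> real" where "\<omega> k = 1 / (real k + 1)\<^sup>2"

lemma \<omega>_nonneg: "0 \<le> \<omega> k" and \<omega>_0: "\<omega> 0 = 1" and \<omega>_le_1: "\<omega> k \<le> 1"
proof -
  have "(real k + 1)\<^sup>2 \<ge> 1\<^sup>2" by (rule power_mono) auto
  then show "0 \<le> \<omega> k" "\<omega> 0 = 1" "\<omega> k \<le> 1" by (auto simp: \<omega>_def divide_simps)
qed

text \<open>Comparison with the telescoping sum of \<open>1/x - 1/(x+1)\<close>; the subtracted term
  is what lets the induction close.\<close>

lemma sum_\<omega>_le: "(\<Sum>j\<le>k. \<omega> j) \<le> 2 - 1 / (real k + 1)"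
proof (induction k)
  case (Suc k)
  define x where "x = real k + 1"
  have x: "x > 0" by (simp add: x_def)
  have "1 / (x + 1)\<^sup>2 \<le> 1 / (x * (x + 1))"
    using x by (intro divide_left_mono) (auto simp: power2_eq_square)
  also have "\<dots> = 1 / x - 1 / (x + 1)" using x by (simp add: field_simps)
  finally show ?case using Suc.IH by (simp add: \<omega>_def x_def add.commute)
qed (simp add: \<omega>_def)

text \<open>With \<open>a\<close>, \<open>b\<close>, \<open>c\<close> equal to \<open>j+1\<close>,
  \<open>k-j+1\<close>, \<open>k+1\<close>, the inequality \<open>c \<le> a + b\<close> gives
  \<open>c\<^sup>2 \<le> 2 a\<^sup>2 + 2 b\<^sup>2\<close>: the larger index supplies the weight
  \<open>\<omega> k\<close>, and the other weight is summable. As the weights sum to at most 2, the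
  constant is \<open>2 * 2 + 2 * 2\<close>.\<close>

lemma \<omega>_convolution: "(\<Sum>j\<le>k. \<omega> j * \<omega> (k - j)) \<le> 8 * \<omega> k"
proof -
  have "\<omega> j * \<omega> (k - j) \<le> \<omega> k * (2 * \<omega> j + 2 * \<omega> (k - j))" if "j \<le> k" for j
  proof -
    define a b c where "a = real j + 1" and "b = real (k - j) + 1" and "c = real k + 1"
    have pos: "a > 0" "b > 0" "c > 0" by (auto simp: a_def b_def c_def)
    have cab: "c \<le> a + b" using that by (simp add: a_def b_def c_def of_nat_diff)
    have "c\<^sup>2 \<le> (a + b)\<^sup>2" using cab pos by (intro power_mono) auto
    also have "\<dots> \<le> 2 * b\<^sup>2 + 2 * a\<^sup>2"
      using zero_le_power2[of "a - b"] by (simp add: power2_eq_square algebra_simps)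
    finally have "c\<^sup>2 / (a\<^sup>2 * b\<^sup>2 * c\<^sup>2) \<le> (2 * b\<^sup>2 + 2 * a\<^sup>2) / (a\<^sup>2 * b\<^sup>2 * c\<^sup>2)"
      by (rule divide_right_mono) simp
    moreover have "c\<^sup>2 / (a\<^sup>2 * b\<^sup>2 * c\<^sup>2) = 1 / a\<^sup>2 * (1 / b\<^sup>2)" using pos by simp
    moreover have "(2 * b\<^sup>2 + 2 * a\<^sup>2) / (a\<^sup>2 * b\<^sup>2 * c\<^sup>2) = 1 / c\<^sup>2 * (2 * (1 / a\<^sup>2) + 2 * (1 / b\<^sup>2))"
      using pos by (simp add: divide_simps)
    ultimately show ?thesis by (simp add: \<omega>_def a_def b_def c_def)
  qed
  then have "(\<Sum>j\<le>k. \<omega> j * \<omega> (k - j)) \<le> (\<Sum>j\<le>k. \<omega> k * (2 * \<omega> j + 2 * \<omega> (k - j)))"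
    by (intro sum_mono) auto
  also have "\<dots> = \<omega> k * (2 * (\<Sum>j\<le>k. \<omega> j) + 2 * (\<Sum>j\<le>k. \<omega> (k - j)))"
    by (simp only: sum_distrib_left[symmetric] sum.distrib)
  also have "(\<Sum>j\<le>k. \<omega> (k - j)) = (\<Sum>j\<le>k. \<omega> j)"
    by (rule sum.reindex_bij_witness[of _ "\<lambda>j. k - j" "\<lambda>j. k - j"]) auto
  also have "\<omega> k * (2 * (\<Sum>j\<le>k. \<omega> j) + 2 * (\<Sum>j\<le>k. \<omega> j)) \<le> \<omega> k * 8"
  proof (rule mult_left_mono[OF _ \<omega>_nonneg])
    have "0 \<le> 1 / (real k + 1)" by simp
    then show "2 * (\<Sum>j\<le>k. \<omega> j) + 2 * (\<Sum>j\<le>k. \<omega> j) \<le> 8" using sum_\<omega>_le[of k] by linarith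
  qed
  finally show ?thesis by simp
qed

text \<open>Integration in time moves a coefficient from order \<open>k\<close> to
  \<open>k+1\<close> and divides it by \<open>k+1\<close>, while the weights shrink by at most a
  factor 4. This is the 4 in the hypothesis of \<open>jet_integrate\<close>.\<close>

lemma \<omega>_Suc_le: "\<omega> k / (real k + 1) \<le> 4 * \<omega> (Suc k)"
proof -
  define x where "x = real k + 1"
  have x: "x \<ge> 1" by (simp add: x_def)
  have "(x + 1)\<^sup>2 \<le> (2 * x)\<^sup>2" using x by (intro power_mono) auto
  also have "\<dots> = 4 * x\<^sup>2" by (simp add: power_mult_distrib)
  also have "\<dots> \<le> 4 * (x\<^sup>2 * x)" using mult_left_mono[of 1 x "4 * x\<^sup>2"] x by (simp add: mult.assoc)
  finally have "1 / (x\<^sup>2 * x) \<le> 4 / (x + 1)\<^sup>2" using x by (simp add: divide_simps mult.commute)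
  then show ?thesis by (simp add: \<omega>_def x_def add.commute)
qed

text \<open>Truncated expansions in time with bounds uniform in space. The weights \<open>\<omega>\<close> keep the class
  closed under products at the cost of a factor independent of \<open>C\<close> and \<open>n\<close>.\<close>

definition jet :: "real \<Rightarrow> real \<Rightarrow> nat \<Rightarrow> (real \<Rightarrow> real \<Rightarrow> real) \<Rightarrow> (nat \<Rightarrow> real \<Rightarrow> real) \<Rightarrow> real \<Rightarrow> bool" where
  "jet \<delta> C n f a M \<longleftrightarrow>
     (\<forall>k\<le>n. \<forall>x. \<bar>a k x\<bar> \<le> M * C ^ k * \<omega> k) \<and>
     (\<forall>k\<le>n. \<forall>s x. \<bar>s\<bar> \<le> \<delta> \<longrightarrow> \<bar>f s x - (\<Sum>j<k. s ^ j * a j x)\<bar> \<le> M * (C * \<bar>s\<bar>) ^ k * \<omega> k) \<and>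
     (\<forall>k\<le>n. a k \<in> borel_measurable lebesgue) \<and>
     (\<forall>s. \<bar>s\<bar> \<le> \<delta> \<longrightarrow> f s \<in> borel_measurable lebesgue)"

lemma jetI:
  assumes "\<And>k x. k \<le> n \<Longrightarrow> \<bar>a k x\<bar> \<le> M * C ^ k * \<omega> k"
    "\<And>k s x. k \<le> n \<Longrightarrow> \<bar>s\<bar> \<le> \<delta> \<Longrightarrow> \<bar>f s x - (\<Sum>j<k. s ^ j * a j x)\<bar> \<le> M * (C * \<bar>s\<bar>) ^ k * \<omega> k"
    "\<And>k. k \<le> n \<Longrightarrow> a k \<in> borel_measurable lebesgue"
    "\<And>s. \<bar>s\<bar> \<le> \<delta> \<Longrightarrow> f s \<in> borel_measurable lebesgue"
  shows "jet \<delta> C n f a M"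
  using assms unfolding jet_def by blast

lemma jetD:
  assumes "jet \<delta> C n f a M"
  shows "k \<le> n \<Longrightarrow> \<bar>a k x\<bar> \<le> M * C ^ k * \<omega> k"
    "k \<le> n \<Longrightarrow> \<bar>s\<bar> \<le> \<delta> \<Longrightarrow> \<bar>f s x - (\<Sum>j<k. s ^ j * a j x)\<bar> \<le> M * (C * \<bar>s\<bar>) ^ k * \<omega> k"
    "k \<le> n \<Longrightarrow> a k \<in> borel_measurable lebesgue"
    "\<bar>s\<bar> \<le> \<delta> \<Longrightarrow> f s \<in> borel_measurable lebesgue"
  using assms unfolding jet_def by blast+

lemma jet_bounds:
  assumes "jet \<delta> C n f a M" "C > 0"
  shows "\<bar>a 0 x\<bar> \<le> M" "\<bar>s\<bar> \<le> \<delta> \<Longrightarrow> \<bar>f s x\<bar> \<le> M" "M \<ge> 0"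
proof -
  show 1: "\<bar>a 0 x\<bar> \<le> M" for x using jetD(1)[OF assms(1), of 0 x] by (simp add: \<omega>_0)
  show "\<bar>s\<bar> \<le> \<delta> \<Longrightarrow> \<bar>f s x\<bar> \<le> M" using jetD(2)[OF assms(1), of 0 s x] by (simp add: \<omega>_0)
  show "M \<ge> 0" using 1[of 0] by linarith
qed

lemma jet_cmult:
  assumes "jet \<delta> C n f a M"
  shows "jet \<delta> C n (\<lambda>s x. c * f s x) (\<lambda>k x. c * a k x) (\<bar>c\<bar> * M)"
proof (rule jetI)
  fix k s x assume k: "k \<le> n"
  have "\<bar>c\<bar> * \<bar>a k x\<bar> \<le> \<bar>c\<bar> * (M * C ^ k * \<omega> k)" using jetD(1)[OF assms k] by (rule mult_left_mono) simp
  then show "\<bar>c * a k x\<bar> \<le> \<bar>c\<bar> * M * C ^ k * \<omega> k" by (simp add: abs_mult mult.assoc)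
  show "(\<lambda>x. c * a k x) \<in> borel_measurable lebesgue" using jetD(3)[OF assms k] by simp
next
  fix k s x assume k: "k \<le> n" and s: "\<bar>s\<bar> \<le> \<delta>"
  have "c * f s x - (\<Sum>j<k. s ^ j * (c * a j x)) = c * (f s x - (\<Sum>j<k. s ^ j * a j x))"
    by (simp add: right_diff_distrib sum_distrib_left mult.left_commute)
  moreover have "\<bar>c\<bar> * \<bar>f s x - (\<Sum>j<k. s ^ j * a j x)\<bar> \<le> \<bar>c\<bar> * (M * (C * \<bar>s\<bar>) ^ k * \<omega> k)"
    using jetD(2)[OF assms k s] by (rule mult_left_mono) simp
  ultimately show "\<bar>c * f s x - (\<Sum>j<k. s ^ j * (c * a j x))\<bar> \<le> \<bar>c\<bar> * M * (C * \<bar>s\<bar>) ^ k * \<omega> k"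
    by (simp add: abs_mult mult.assoc)
qed (use jetD(4)[OF assms] in auto)

lemma jet_add:
  assumes f: "jet \<delta> C n f a M" and g: "jet \<delta> C n g b N"
  shows "jet \<delta> C n (\<lambda>s x. f s x + g s x) (\<lambda>k x. a k x + b k x) (M + N)"
proof (rule jetI)
  fix k s x assume k: "k \<le> n"
  have "\<bar>a k x + b k x\<bar> \<le> M * C ^ k * \<omega> k + N * C ^ k * \<omega> k"
    using jetD(1)[OF f k, of x] jetD(1)[OF g k, of x] by linarith
  then show "\<bar>a k x + b k x\<bar> \<le> (M + N) * C ^ k * \<omega> k" by (simp add: distrib_right)
  show "(\<lambda>x. a k x + b k x) \<in> borel_measurable lebesgue" using jetD(3)[OF f k] jetD(3)[OF g k] by simp
next
  fix k s x assume k: "k \<le> n" and s: "\<bar>s\<bar> \<le> \<delta>"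
  have "f s x + g s x - (\<Sum>j<k. s ^ j * (a j x + b j x)) =
      (f s x - (\<Sum>j<k. s ^ j * a j x)) + (g s x - (\<Sum>j<k. s ^ j * b j x))"
    by (simp add: distrib_left sum.distrib)
  then have "\<bar>f s x + g s x - (\<Sum>j<k. s ^ j * (a j x + b j x))\<bar> \<le> M * (C * \<bar>s\<bar>) ^ k * \<omega> k + N * (C * \<bar>s\<bar>) ^ k * \<omega> k"
    using jetD(2)[OF f k s, of x] jetD(2)[OF g k s, of x] by linarith
  then show "\<bar>f s x + g s x - (\<Sum>j<k. s ^ j * (a j x + b j x))\<bar> \<le> (M + N) * (C * \<bar>s\<bar>) ^ k * \<omega> k"
    by (simp add: distrib_right)
next
  fix s assume "\<bar>s\<bar> \<le> \<delta>"
  then show "(\<lambda>x. f s x + g s x) \<in> borel_measurable lebesgue" using jetD(4)[OF f] jetD(4)[OF g] by simp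
qed

text \<open>Grouping by the first factor pairs each coefficient \<open>a j\<close> with a truncation
  of the second series of complementary order, hence in a product with a remainder of the right
  order.\<close>

lemma Cauchy_product_truncated:
  fixes s :: real
  shows "(\<Sum>m<k. s ^ m * (\<Sum>j\<le>m. a j * b (m - j))) = (\<Sum>j<k. s ^ j * a j * (\<Sum>i<k-j. s ^ i * b i))"
proof (induction k)
  case (Suc k)
  have "(\<Sum>j<Suc k. s ^ j * a j * (\<Sum>i<Suc k-j. s ^ i * b i)) =
      (\<Sum>j<k. s ^ j * a j * (\<Sum>i<k-j. s ^ i * b i) + s ^ k * (a j * b (k - j))) + s ^ k * (a k * b (k - k))"
  proof -
    have "s ^ j * a j * (\<Sum>i<Suc k-j. s ^ i * b i) = s ^ j * a j * (\<Sum>i<k-j. s ^ i * b i) + s ^ k * (a j * b (k - j))"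
      if "j < k" for j
    proof -
      have "s ^ j * s ^ (k - j) = s ^ k" using that by (simp add: power_add[symmetric])
      then have "s ^ j * a j * (s ^ (k - j) * b (k - j)) = s ^ k * (a j * b (k - j))"
        by (metis mult.assoc mult.commute)
      moreover have "(\<Sum>i<Suc k-j. s ^ i * b i) = (\<Sum>i<k-j. s ^ i * b i) + s ^ (k - j) * b (k - j)"
        using that by (simp add: Suc_diff_le)
      ultimately show ?thesis by (simp only: distrib_left)
    qed
    then show ?thesis by simp
  qed
  also have "\<dots> = (\<Sum>j<k. s ^ j * a j * (\<Sum>i<k-j. s ^ i * b i)) + s ^ k * ((\<Sum>j<k. a j * b (k - j)) + a k * b (k - k))"
    by (simp only: sum.distrib sum_distrib_left[symmetric] distrib_left add.assoc)
  also have "(\<Sum>j<k. a j * b (k - j)) + a k * b (k - k) = (\<Sum>j\<le>k. a j * b (k - j))"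
    by (simp only: lessThan_Suc_atMost[symmetric] sum.lessThan_Suc)
  also have "(\<Sum>j<k. s ^ j * a j * (\<Sum>i<k-j. s ^ i * b i)) = (\<Sum>m<k. s ^ m * (\<Sum>j\<le>m. a j * b (m - j)))"
    by (rule Suc.IH[symmetric])
  finally show ?case by simp
qed simp

lemma jet_mult:
  assumes f: "jet \<delta> C n f a M" and g: "jet \<delta> C n g b N" and C: "C > 0"
  shows "jet \<delta> C n (\<lambda>s x. f s x * g s x) (\<lambda>k x. \<Sum>j\<le>k. a j x * b (k - j) x) (8 * M * N)"
proof (rule jetI)
  have M: "M \<ge> 0" "N \<ge> 0" using jet_bounds(3)[OF f C] jet_bounds(3)[OF g C] by auto
  {
    fix k x assume k: "k \<le> n"
    have "\<bar>\<Sum>j\<le>k. a j x * b (k - j) x\<bar> \<le> (\<Sum>j\<le>k. \<bar>a j x * b (k - j) x\<bar>)" by (rule sum_abs)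
    also have "\<dots> \<le> (\<Sum>j\<le>k. (M * N * C ^ k) * (\<omega> j * \<omega> (k - j)))"
    proof (rule sum_mono)
      fix j assume j: "j \<in> {..k}"
      have "\<bar>a j x\<bar> * \<bar>b (k - j) x\<bar> \<le> (M * C ^ j * \<omega> j) * (N * C ^ (k - j) * \<omega> (k - j))"
        using jetD(1)[OF f, of j x] jetD(1)[OF g, of "k - j" x] j k M C \<omega>_nonneg
        by (intro mult_mono) auto
      also have "\<dots> = (M * N * (C ^ j * C ^ (k - j))) * (\<omega> j * \<omega> (k - j))" by (simp only: ac_simps)
      also have "C ^ j * C ^ (k - j) = C ^ k" using j by (simp add: power_add[symmetric])
      finally show "\<bar>a j x * b (k - j) x\<bar> \<le> (M * N * C ^ k) * (\<omega> j * \<omega> (k - j))" by (simp add: abs_mult)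
    qed
    also have "\<dots> = (M * N * C ^ k) * (\<Sum>j\<le>k. \<omega> j * \<omega> (k - j))" by (simp only: sum_distrib_left)
    also have "\<dots> \<le> (M * N * C ^ k) * (8 * \<omega> k)" using M C by (intro mult_left_mono \<omega>_convolution) auto
    finally show "\<bar>\<Sum>j\<le>k. a j x * b (k - j) x\<bar> \<le> 8 * M * N * C ^ k * \<omega> k" by (simp add: ac_simps)
  next
    fix k s x assume k: "k \<le> n" and s: "\<bar>s\<bar> \<le> \<delta>"
    define R where "R j = g s x - (\<Sum>i<j. s ^ i * b i x)" for j
    \<comment> \<open>Each coefficient of \<open>f\<close> multiplies a remainder of
      \<open>g\<close> of complementary order, and the remainder of \<open>f\<close> of order
      \<open>k\<close> multiplies \<open>g\<close> itself. Since \<open>\<omega> 0 = 1\<close>, the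
      latter fits the convolution sum as its term with \<open>j = k\<close>.\<close>
    have "f s x * g s x - (\<Sum>m<k. s ^ m * (\<Sum>j\<le>m. a j x * b (m - j) x)) =
        (\<Sum>j<k. s ^ j * a j x * R (k - j)) + (f s x - (\<Sum>j<k. s ^ j * a j x)) * g s x"
      unfolding Cauchy_product_truncated[where a = "\<lambda>j. a j x" and b = "\<lambda>j. b j x"] R_def
      by (simp add: right_diff_distrib sum_subtractf left_diff_distrib sum_distrib_right)
    also have "\<bar>\<dots>\<bar> \<le> (\<Sum>j<k. \<bar>s ^ j * a j x * R (k - j)\<bar>) + \<bar>(f s x - (\<Sum>j<k. s ^ j * a j x)) * g s x\<bar>"
      by (rule order_trans[OF abs_triangle_ineq add_right_mono[OF sum_abs]])
    also have "\<dots> \<le> (\<Sum>j<k. (M * N * (C * \<bar>s\<bar>) ^ k) * (\<omega> j * \<omega> (k - j))) + (M * N * (C * \<bar>s\<bar>) ^ k) * (\<omega> k * \<omega> (k - k))"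
    proof (rule add_mono[OF sum_mono])
      fix j assume j: "j \<in> {..<k}"
      have "\<bar>s\<bar> ^ j * \<bar>a j x\<bar> * \<bar>R (k - j)\<bar> \<le> \<bar>s\<bar> ^ j * (M * C ^ j * \<omega> j) * (N * (C * \<bar>s\<bar>) ^ (k - j) * \<omega> (k - j))"
        unfolding R_def using jetD(1)[OF f, of j x] jetD(2)[OF g, of "k - j" s x] j k s M C \<omega>_nonneg
        by (intro mult_mono mult_left_mono) auto
      also have "\<dots> = (M * N * ((C * \<bar>s\<bar>) ^ j * (C * \<bar>s\<bar>) ^ (k - j))) * (\<omega> j * \<omega> (k - j))"
        by (simp only: ac_simps power_mult_distrib)
      also have "(C * \<bar>s\<bar>) ^ j * (C * \<bar>s\<bar>) ^ (k - j) = (C * \<bar>s\<bar>) ^ k" using j by (simp add: power_add[symmetric])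
      finally show "\<bar>s ^ j * a j x * R (k - j)\<bar> \<le> (M * N * (C * \<bar>s\<bar>) ^ k) * (\<omega> j * \<omega> (k - j))"
        by (simp add: abs_mult power_abs)
    next
      have "\<bar>f s x - (\<Sum>j<k. s ^ j * a j x)\<bar> * \<bar>g s x\<bar> \<le> (M * (C * \<bar>s\<bar>) ^ k * \<omega> k) * N"
        using jetD(2)[OF f k s, of x] jet_bounds(2)[OF g C s, of x] M C \<omega>_nonneg by (intro mult_mono) auto
      then show "\<bar>(f s x - (\<Sum>j<k. s ^ j * a j x)) * g s x\<bar> \<le> (M * N * (C * \<bar>s\<bar>) ^ k) * (\<omega> k * \<omega> (k - k))"
        by (simp add: abs_mult \<omega>_0 ac_simps)
    qed
    also have "\<dots> = (M * N * (C * \<bar>s\<bar>) ^ k) * (\<Sum>j\<le>k. \<omega> j * \<omega> (k - j))"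
      by (simp only: sum_distrib_left[symmetric] distrib_left[symmetric] lessThan_Suc_atMost[symmetric] sum.lessThan_Suc)
    also have "\<dots> \<le> (M * N * (C * \<bar>s\<bar>) ^ k) * (8 * \<omega> k)"
      using M C by (intro mult_left_mono \<omega>_convolution) auto
    finally show "\<bar>f s x * g s x - (\<Sum>m<k. s ^ m * (\<Sum>j\<le>m. a j x * b (m - j) x))\<bar> \<le> 8 * M * N * (C * \<bar>s\<bar>) ^ k * \<omega> k"
      by (simp add: ac_simps)
  }
  show "(\<lambda>x. \<Sum>j\<le>k. a j x * b (k - j) x) \<in> borel_measurable lebesgue" if "k \<le> n" for k
    using jetD(3)[OF f] jetD(3)[OF g] that by (intro borel_measurable_sum borel_measurable_times) auto
  show "(\<lambda>x. f s x * g s x) \<in> borel_measurable lebesgue" if "\<bar>s\<bar> \<le> \<delta>" for s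
    using jetD(4)[OF f that] jetD(4)[OF g that] by simp
qed

lemma abs_le_of_derivative_power:
  fixes R :: "real \<Rightarrow> real"
  assumes der: "\<And>\<sigma>. \<bar>\<sigma>\<bar> \<le> \<delta> \<Longrightarrow> (R has_real_derivative R' \<sigma>) (at \<sigma>)"
    and bd: "\<And>\<sigma>. \<bar>\<sigma>\<bar> \<le> \<delta> \<Longrightarrow> \<bar>R' \<sigma>\<bar> \<le> A * \<bar>\<sigma>\<bar> ^ k"
    and R0: "R 0 = 0" and s: "\<bar>s\<bar> \<le> \<delta>"
  shows "\<bar>R s\<bar> \<le> A * \<bar>s\<bar> ^ Suc k / (real k + 1)"
proof -
  have pos: "\<bar>S t\<bar> \<le> A * t ^ Suc k / (real k + 1)"
    if t: "0 < t" "t \<le> \<delta>" and S: "\<And>\<sigma>. \<bar>\<sigma>\<bar> \<le> \<delta> \<Longrightarrow> (S has_real_derivative S' \<sigma>) (at \<sigma>)"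
      "\<And>\<sigma>. \<bar>\<sigma>\<bar> \<le> \<delta> \<Longrightarrow> \<bar>S' \<sigma>\<bar> \<le> A * \<bar>\<sigma>\<bar> ^ k" "S 0 = 0" for S S' :: "real \<Rightarrow> real" and t
  proof -
    have "norm (S t - S 0) \<le> (\<lambda>\<sigma>. A * \<sigma> ^ Suc k / (real k + 1)) t - (\<lambda>\<sigma>. A * \<sigma> ^ Suc k / (real k + 1)) 0"
    proof (rule differentiable_bound_general[OF t(1), where f' = S' and \<phi>' = "\<lambda>\<sigma>. A * \<sigma> ^ k"])
      show "continuous_on {0..t} S"
        using t by (intro continuous_at_imp_continuous_on ballI DERIV_isCont[OF S(1)]) auto
      show "continuous_on {0..t} (\<lambda>\<sigma>. A * \<sigma> ^ Suc k / (real k + 1))" by (intro continuous_intros) auto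
      fix \<sigma> assume \<sigma>: "0 < \<sigma>" "\<sigma> < t"
      show "(S has_vector_derivative S' \<sigma>) (at \<sigma>)"
        using S(1)[of \<sigma>] \<sigma> t by (simp add: has_real_derivative_iff_has_vector_derivative)
      have "((\<lambda>\<sigma>. A * \<sigma> ^ Suc k / (real k + 1)) has_real_derivative A * (real (Suc k) * \<sigma> ^ k) / (real k + 1)) (at \<sigma>)"
        using DERIV_pow[of "Suc k" \<sigma>] by (intro DERIV_cdivide DERIV_cmult) simp
      moreover have "A * (real (Suc k) * \<sigma> ^ k) / (real k + 1) = A * \<sigma> ^ k" by (simp add: field_simps)
      ultimately show "((\<lambda>\<sigma>. A * \<sigma> ^ Suc k / (real k + 1)) has_vector_derivative A * \<sigma> ^ k) (at \<sigma>)"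
        by (simp only: has_real_derivative_iff_has_vector_derivative)
      show "norm (S' \<sigma>) \<le> A * \<sigma> ^ k" using S(2)[of \<sigma>] \<sigma> t by simp
    qed
    then show ?thesis using S(3) by simp
  qed
  consider "s = 0" | "s > 0" | "s < 0" by linarith
  then show ?thesis
  proof cases
    case 1 then show ?thesis using R0 by simp
  next
    case 2 then show ?thesis using pos[of s R R'] der bd R0 s by simp
  next
    case 3
    have "\<bar>R (- (- s))\<bar> \<le> A * (- s) ^ Suc k / (real k + 1)"
    proof (rule pos[of "-s" "\<lambda>\<sigma>. R (- \<sigma>)" "\<lambda>\<sigma>. - R' (- \<sigma>)"])
      fix \<sigma> assume \<sigma>: "\<bar>\<sigma>\<bar> \<le> \<delta>"
      show "((\<lambda>\<sigma>. R (- \<sigma>)) has_real_derivative - R' (- \<sigma>)) (at \<sigma>)"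
        using DERIV_mirror[of R "R' (- \<sigma>)" \<sigma>] der[of "-\<sigma>"] \<sigma> by simp
      show "\<bar>- R' (- \<sigma>)\<bar> \<le> A * \<bar>\<sigma>\<bar> ^ k" using bd[of "-\<sigma>"] \<sigma> by simp
    qed (use 3 s R0 in auto)
    then show ?thesis using 3 by simp
  qed
qed

text \<open>The order rises by one while the constant \<open>M\<close> stays. Order 0 is the assumed
  sup bound; higher orders inherit \<open>N\<close> from the derivative and gain a factor
  \<open>1/C\<close> against the target, which \<open>4 * N \<le> C * M\<close> makes sufficient.
  Constants lost in products therefore do not accumulate.\<close>

lemma jet_integrate:
  assumes g: "jet \<delta> C n g b N" and C: "C > 0" and CM: "4 * N \<le> C * M"
    and der: "\<And>s x. \<bar>s\<bar> \<le> \<delta> \<Longrightarrow> ((\<lambda>s. f s x) has_real_derivative g s x) (at s)"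
    and bd: "\<And>s x. \<bar>s\<bar> \<le> \<delta> \<Longrightarrow> \<bar>f s x\<bar> \<le> M" and \<delta>: "\<delta> > 0"
    and meas: "\<And>s. \<bar>s\<bar> \<le> \<delta> \<Longrightarrow> f s \<in> borel_measurable lebesgue"
  shows "jet \<delta> C (Suc n) f (\<lambda>k. case k of 0 \<Rightarrow> f 0 | Suc j \<Rightarrow> (\<lambda>x. b j x / (real j + 1))) M"
proof -
  define a where "a = (\<lambda>k. case k of 0 \<Rightarrow> f 0 | Suc j \<Rightarrow> (\<lambda>x. b j x / (real j + 1)))"
  have a: "a 0 = f 0" "\<And>j x. a (Suc j) x = b j x / (real j + 1)" by (simp_all add: a_def)
  have N: "N \<ge> 0" by (rule jet_bounds(3)[OF g C])
  have step: "N * C ^ j * \<omega> j / (real j + 1) \<le> M * C ^ Suc j * \<omega> (Suc j)" for j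
  proof -
    have "N * C ^ j * (\<omega> j / (real j + 1)) \<le> N * C ^ j * (4 * \<omega> (Suc j))"
      using N C \<omega>_Suc_le by (intro mult_left_mono) auto
    also have "\<dots> = (4 * N) * (C ^ j * \<omega> (Suc j))" by (simp only: ac_simps)
    also have "\<dots> \<le> (C * M) * (C ^ j * \<omega> (Suc j))" using CM C \<omega>_nonneg by (intro mult_right_mono) auto
    finally show ?thesis by (simp add: ac_simps)
  qed
  have "jet \<delta> C (Suc n) f a M"
  proof (rule jetI)
    fix k x assume k: "k \<le> Suc n"
    show "\<bar>a k x\<bar> \<le> M * C ^ k * \<omega> k"
    proof (cases k)
      case 0 then show ?thesis using bd[of 0 x] \<delta> by (simp add: a \<omega>_0)
    next
      case (Suc j)
      have "\<bar>a k x\<bar> = \<bar>b j x\<bar> / (real j + 1)" by (simp add: Suc a)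
      also have "\<dots> \<le> N * C ^ j * \<omega> j / (real j + 1)"
        using jetD(1)[OF g, of j x] k Suc by (intro divide_right_mono) auto
      finally show ?thesis using step[of j] Suc by simp
    qed
    show "a k \<in> borel_measurable lebesgue"
    proof (cases k)
      case 0 then show ?thesis using meas[of 0] \<delta> by (simp add: a)
    next
      case (Suc j)
      have "a k = (\<lambda>x. b j x / (real j + 1))" by (simp add: Suc a_def)
      then show ?thesis using jetD(3)[OF g, of j] k Suc by simp
    qed
  next
    fix k s x assume k: "k \<le> Suc n" and s: "\<bar>s\<bar> \<le> \<delta>"
    show "\<bar>f s x - (\<Sum>j<k. s ^ j * a j x)\<bar> \<le> M * (C * \<bar>s\<bar>) ^ k * \<omega> k"
    proof (cases k)
      case 0 then show ?thesis using bd[OF s] by (simp add: \<omega>_0)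
    next
      case (Suc m)
      define R where "R \<sigma> = f \<sigma> x - (\<Sum>j<k. \<sigma> ^ j * a j x)" for \<sigma>
      have sum: "(\<Sum>j<k. \<sigma> ^ j * a j x) = f 0 x + (\<Sum>j<m. \<sigma> ^ Suc j * (b j x / (real j + 1)))" for \<sigma>
        unfolding Suc by (subst sum.lessThan_Suc_shift) (simp add: a)
      have "\<bar>R s\<bar> \<le> (N * C ^ m * \<omega> m) * \<bar>s\<bar> ^ Suc m / (real m + 1)"
      proof (rule abs_le_of_derivative_power[OF _ _ _ s])
        fix \<sigma> assume \<sigma>: "\<bar>\<sigma>\<bar> \<le> \<delta>"
        have "((\<lambda>\<sigma>. \<Sum>j<m. \<sigma> ^ Suc j * (b j x / (real j + 1))) has_real_derivative (\<Sum>j<m. \<sigma> ^ j * b j x)) (at \<sigma>)"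
        proof (rule DERIV_sum)
          fix j
          have "((\<lambda>\<sigma>. \<sigma> ^ Suc j * (b j x / (real j + 1))) has_real_derivative real (Suc j) * \<sigma> ^ j * (b j x / (real j + 1))) (at \<sigma>)"
            using DERIV_pow[of "Suc j" \<sigma>] by (intro DERIV_cmult_right) simp
          moreover have "real (Suc j) * \<sigma> ^ j * (b j x / (real j + 1)) = \<sigma> ^ j * b j x" by (simp add: field_simps)
          ultimately show "((\<lambda>\<sigma>. \<sigma> ^ Suc j * (b j x / (real j + 1))) has_real_derivative \<sigma> ^ j * b j x) (at \<sigma>)"
            by simp
        qed
        then have "((\<lambda>\<sigma>. f \<sigma> x - (f 0 x + (\<Sum>j<m. \<sigma> ^ Suc j * (b j x / (real j + 1))))) has_real_derivative
            g \<sigma> x - (0 + (\<Sum>j<m. \<sigma> ^ j * b j x))) (at \<sigma>)"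
          by (intro DERIV_diff der[OF \<sigma>] DERIV_add DERIV_const)
        then show "(R has_real_derivative g \<sigma> x - (\<Sum>j<m. \<sigma> ^ j * b j x)) (at \<sigma>)"
          unfolding R_def[abs_def] sum by simp
        show "\<bar>g \<sigma> x - (\<Sum>j<m. \<sigma> ^ j * b j x)\<bar> \<le> (N * C ^ m * \<omega> m) * \<bar>\<sigma>\<bar> ^ m"
          using jetD(2)[OF g, of m \<sigma> x] k Suc \<sigma> by (simp add: power_mult_distrib ac_simps)
      qed (simp add: R_def sum)
      also have "\<dots> = (N * C ^ m * \<omega> m / (real m + 1)) * \<bar>s\<bar> ^ Suc m" by simp
      also have "\<dots> \<le> (M * C ^ Suc m * \<omega> (Suc m)) * \<bar>s\<bar> ^ Suc m" by (intro mult_right_mono step) auto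
      finally show ?thesis unfolding R_def Suc by (simp add: power_mult_distrib ac_simps)
    qed
  qed (rule meas)
  then show ?thesis unfolding a_def .
qed

section \<open>The Green kernel acting on expansions\<close>

lemma loc_ess_bounded_bounded: "f \<in> borel_measurable lebesgue \<Longrightarrow> (\<And>x. \<bar>f x\<bar> \<le> B) \<Longrightarrow> loc_ess_bounded f"
  by (rule loc_ess_boundedI_bounded[of _ B]) auto

text \<open>For \<open>e\<close> equal to 1 or -1 these are the two exponential kernels of Green's
  formula at the identity. At a fixed time the kernel \<open>exp (e * (\<xi> y - \<xi> x))\<close>
  is this one times a function of \<open>x\<close> and a function of \<open>y\<close>, exponentials
  of the displacement; time enters through multiplications only.\<close>

definition kernel_op :: "real \<Rightarrow> (real \<Rightarrow> real) \<Rightarrow> real \<Rightarrow> real" where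
  "kernel_op e f x = exp (- (e * x)) * integral {x..x+1} (\<lambda>y. exp (e * y) * f y)"

lemma loc_ess_bounded_exp_mult:
  assumes "loc_ess_bounded f"
  shows "loc_ess_bounded (\<lambda>y. exp (e * y) * f y)"
  by (intro loc_ess_bounded_mult assms loc_ess_bounded_continuous continuous_intros)

lemma kernel_op_continuous:
  assumes "loc_ess_bounded f"
  shows "continuous_on UNIV (kernel_op e f)"
proof -
  define g where "g y = exp (e * y) * f y" for y
  have i: "g integrable_on {a..b}" for a b
    unfolding g_def by (intro loc_ess_bounded_integrable_on loc_ess_bounded_exp_mult assms)
  have "isCont (\<lambda>x. integral {x..x+1} g) z" for z
  proof -
    define J where "J y = integral {z-1..y} g" for y
    have J: "continuous_on {z-1..z+3} J" unfolding J_def by (rule indefinite_integral_continuous_1[OF i])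
    have "isCont J z" "isCont J (z + 1)"
      using J by (auto intro!: continuous_on_interior[OF J])
    then have "isCont (\<lambda>x. J (x + 1) - J x) z"
      by (intro continuous_intros isCont_o2[of z "\<lambda>x. x + 1" J]) auto
    moreover have "\<forall>\<^sub>F x in nhds z. J (x + 1) - J x = integral {x..x+1} g"
    proof (rule eventually_nhds_in_open[of "{z-1<..<z+1}" z, THEN eventually_mono])
      fix x assume x: "x \<in> {z-1<..<z+1}"
      have "integral {z-1..x} g + integral {x..x+1} g = integral {z-1..x+1} g"
        by (rule Henstock_Kurzweil_Integration.integral_combine) (use x i in auto)
      then show "J (x + 1) - J x = integral {x..x+1} g" by (simp add: J_def)
    qed auto
    ultimately show ?thesis by (rule isCont_cong[THEN iffD1, rotated])
  qed
  then have "continuous_on UNIV (\<lambda>x. exp (- (e * x)) * integral {x..x+1} g)"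
    by (intro continuous_intros continuous_at_imp_continuous_on ballI) auto
  then show ?thesis unfolding kernel_op_def[abs_def] g_def .
qed

lemma kernel_op_bound:
  assumes f: "f \<in> borel_measurable lebesgue" "\<And>x. \<bar>f x\<bar> \<le> B" and e: "\<bar>e\<bar> \<le> 1"
  shows "\<bar>kernel_op e f x\<bar> \<le> 3 * B"
proof -
  have lf: "loc_ess_bounded f" by (rule loc_ess_bounded_bounded[OF f])
  have B: "B \<ge> 0" using f(2)[of 0] by linarith
  have "kernel_op e f x = integral {x..x+1} (\<lambda>y. exp (- (e * x)) * (exp (e * y) * f y))"
    unfolding kernel_op_def by simp
  also have "\<bar>\<dots>\<bar> \<le> integral {x..x+1} (\<lambda>y. \<bar>exp (- (e * x)) * (exp (e * y) * f y)\<bar>)"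
    by (intro integral_abs_le loc_ess_bounded_mult[OF loc_ess_bounded_const] loc_ess_bounded_exp_mult lf)
  also have "\<dots> \<le> integral {x..x+1} (\<lambda>y. 3 * B)"
  proof (rule integral_mono_AE)
    show "AE y in lebesgue. y \<in> {x..x+1} \<longrightarrow> \<bar>exp (- (e * x)) * (exp (e * y) * f y)\<bar> \<le> 3 * B"
    proof (intro AE_I2 impI)
      fix y assume y: "y \<in> {x..x+1}"
      have "\<bar>e * (y - x)\<bar> \<le> 1 * 1" unfolding abs_mult using e y by (intro mult_mono) auto
      then have "exp (e * (y - x)) \<le> exp 1" by simp
      also have "\<dots> \<le> (3::real)" using exp_le by simp
      finally have E: "exp (e * (y - x)) \<le> 3" .
      have "exp (- (e * x)) * (exp (e * y) * f y) = exp (e * (y - x)) * f y"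
        by (simp add: mult.assoc[symmetric] exp_add[symmetric] right_diff_distrib)
      moreover have "\<bar>exp (e * (y - x)) * f y\<bar> \<le> 3 * B"
        using mult_mono[OF E f(2)[of y]] B by (simp add: abs_mult)
      ultimately show "\<bar>exp (- (e * x)) * (exp (e * y) * f y)\<bar> \<le> 3 * B" by (simp only:)
    qed
  qed (intro loc_ess_bounded_abs loc_ess_bounded_mult[OF loc_ess_bounded_const] loc_ess_bounded_exp_mult lf loc_ess_bounded_const)+
  finally show ?thesis by simp
qed

lemma kernel_op_diff_sum:
  fixes k :: nat
  assumes "loc_ess_bounded f" "\<And>j. j < k \<Longrightarrow> loc_ess_bounded (a j)"
  shows "kernel_op e (\<lambda>y. f y - (\<Sum>j<k. c j * a j y)) x = kernel_op e f x - (\<Sum>j<k. c j * kernel_op e (a j) x)"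
proof -
  let ?w = "\<lambda>y. exp (e * y)"
  have "((\<lambda>y. ?w y * f y - (\<Sum>j<k. c j * (?w y * a j y))) has_integral
     integral {x..x+1} (\<lambda>y. ?w y * f y) - (\<Sum>j<k. c j * integral {x..x+1} (\<lambda>y. ?w y * a j y))) {x..x+1}"
    using assms
    by (intro has_integral_diff has_integral_sum has_integral_mult_right integrable_integral
        loc_ess_bounded_integrable_on loc_ess_bounded_exp_mult) auto
  moreover have "(\<lambda>y. ?w y * f y - (\<Sum>j<k. c j * (?w y * a j y))) = (\<lambda>y. ?w y * (f y - (\<Sum>j<k. c j * a j y)))"
    by (simp add: right_diff_distrib sum_distrib_left mult.left_commute)
  ultimately have "integral {x..x+1} (\<lambda>y. ?w y * (f y - (\<Sum>j<k. c j * a j y))) =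
      integral {x..x+1} (\<lambda>y. ?w y * f y) - (\<Sum>j<k. c j * integral {x..x+1} (\<lambda>y. ?w y * a j y))"
    by (simp add: integral_unique)
  then show ?thesis unfolding kernel_op_def
    by (simp add: right_diff_distrib sum_distrib_left mult.left_commute)
qed

text \<open>A linear operator independent of time acts on coefficients and remainders alike; on
  bounded functions it costs at most \<open>exp 1\<close>, hence the factor 3.\<close>

lemma jet_kernel_op:
  assumes f: "jet \<delta> C n f a M" and C: "C > 0" and e: "\<bar>e\<bar> \<le> 1"
  shows "jet \<delta> C n (\<lambda>s. kernel_op e (f s)) (\<lambda>k. kernel_op e (a k)) (3 * M)"
proof (rule jetI)
  have la: "loc_ess_bounded (a k)" if "k \<le> n" for k
    by (rule loc_ess_bounded_bounded[OF jetD(3)[OF f that] jetD(1)[OF f that]])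
  have lf: "loc_ess_bounded (f s)" if "\<bar>s\<bar> \<le> \<delta>" for s
    by (rule loc_ess_bounded_bounded[OF jetD(4)[OF f that] jet_bounds(2)[OF f C that]])
  {
    fix k x assume k: "k \<le> n"
    have "\<bar>kernel_op e (a k) x\<bar> \<le> 3 * (M * C ^ k * \<omega> k)"
      by (rule kernel_op_bound[OF jetD(3)[OF f k] jetD(1)[OF f k] e])
    then show "\<bar>kernel_op e (a k) x\<bar> \<le> 3 * M * C ^ k * \<omega> k" by (simp add: mult.assoc)
    show "kernel_op e (a k) \<in> borel_measurable lebesgue"
      using loc_ess_bounded_continuous[OF kernel_op_continuous[OF la[OF k]]] by (simp add: loc_ess_bounded_def)
  next
    fix k s x assume k: "k \<le> n" and s: "\<bar>s\<bar> \<le> \<delta>"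
    have "kernel_op e (f s) x - (\<Sum>j<k. s ^ j * kernel_op e (a j) x) = kernel_op e (\<lambda>y. f s y - (\<Sum>j<k. s ^ j * a j y)) x"
      using k by (intro kernel_op_diff_sum[symmetric] lf s la) auto
    also have "\<bar>\<dots>\<bar> \<le> 3 * (M * (C * \<bar>s\<bar>) ^ k * \<omega> k)"
    proof (rule kernel_op_bound[OF _ jetD(2)[OF f k s] e])
      show "(\<lambda>y. f s y - (\<Sum>j<k. s ^ j * a j y)) \<in> borel_measurable lebesgue"
        using jetD(3)[OF f] jetD(4)[OF f s] k
        by (intro borel_measurable_diff borel_measurable_sum borel_measurable_times) auto
    qed
    finally show "\<bar>kernel_op e (f s) x - (\<Sum>j<k. s ^ j * kernel_op e (a j) x)\<bar> \<le> 3 * M * (C * \<bar>s\<bar>) ^ k * \<omega> k"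
      by (simp add: mult.assoc)
  next
    fix s assume "\<bar>s\<bar> \<le> \<delta>"
    from loc_ess_bounded_continuous[OF kernel_op_continuous[OF lf[OF this]]]
    show "kernel_op e (f s) \<in> borel_measurable lebesgue" by (simp add: loc_ess_bounded_def)
  }
qed

section \<open>From expansions of every order to a power series\<close>

text \<open>At the first possible disagreement the difference of the coefficients is bounded by a
  constant times \<open>s\<close>, after division by \<open>s ^ j\<close>. This consumes the
  remainder of order \<open>j + 1\<close>, hence \<open>j < n\<close>.\<close>

lemma power_expansion_unique:
  fixes F :: "real \<Rightarrow> real"
  assumes \<delta>: "\<delta> > 0"
    and a: "\<And>k s. k \<le> n \<Longrightarrow> \<bar>s\<bar> \<le> \<delta> \<Longrightarrow> \<bar>F s - (\<Sum>j<k. s ^ j * a j)\<bar> \<le> A k * \<bar>s\<bar> ^ k"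
    and b: "\<And>k s. k \<le> n \<Longrightarrow> \<bar>s\<bar> \<le> \<delta> \<Longrightarrow> \<bar>F s - (\<Sum>j<k. s ^ j * b j)\<bar> \<le> B k * \<bar>s\<bar> ^ k"
  shows "j < n \<Longrightarrow> a j = b j"
proof (induction j rule: less_induct)
  case (less j)
  have "\<bar>a j - b j\<bar> \<le> (A (Suc j) + B (Suc j)) * s" if s: "0 < s" "s \<le> \<delta>" for s
  proof -
    have S: "(\<Sum>i<j. s ^ i * a i) = (\<Sum>i<j. s ^ i * b i)" using less by (intro sum.cong) auto
    have 1: "\<bar>F s - ((\<Sum>i<j. s ^ i * b i) + s ^ j * a j)\<bar> \<le> A (Suc j) * s ^ Suc j"
      using a[of "Suc j" s] less.prems s S by simp
    have 2: "\<bar>F s - ((\<Sum>i<j. s ^ i * b i) + s ^ j * b j)\<bar> \<le> B (Suc j) * s ^ Suc j"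
      using b[of "Suc j" s] less.prems s by simp
    have "\<bar>s ^ j * a j - s ^ j * b j\<bar> \<le> A (Suc j) * s ^ Suc j + B (Suc j) * s ^ Suc j"
      using 1 2 by linarith
    then have "s ^ j * \<bar>a j - b j\<bar> \<le> s ^ j * ((A (Suc j) + B (Suc j)) * s)"
    proof -
      have "s ^ j * \<bar>a j - b j\<bar> = \<bar>s ^ j * a j - s ^ j * b j\<bar>"
        using s by (simp add: right_diff_distrib[symmetric] abs_mult)
      moreover have "A (Suc j) * s ^ Suc j + B (Suc j) * s ^ Suc j = s ^ j * ((A (Suc j) + B (Suc j)) * s)"
        by (simp add: algebra_simps)
      ultimately show ?thesis using \<open>\<bar>s ^ j * a j - s ^ j * b j\<bar> \<le> _\<close> by (simp only:)
    qed
    then show ?thesis using s by (subst (asm) mult_le_cancel_left_pos) auto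
  qed
  then have ev: "\<forall>\<^sub>F s in at_right 0. \<bar>a j - b j\<bar> \<le> (A (Suc j) + B (Suc j)) * s"
    unfolding eventually_at_right_field using \<delta> by (intro exI[of _ \<delta>]) auto
  have "((\<lambda>s. (A (Suc j) + B (Suc j)) * s) \<longlongrightarrow> (A (Suc j) + B (Suc j)) * 0) (at_right 0)"
    by (intro tendsto_intros)
  from tendsto_lowerbound[OF this ev] show ?case by simp
qed

lemma jet_cong:
  assumes "jet \<delta> C n f a M" "\<And>s. \<bar>s\<bar> \<le> \<delta> \<Longrightarrow> f s = f' s"
  shows "jet \<delta> C n f' a M"
  using assms unfolding jet_def by auto

lemma jet_all_orders:
  assumes \<delta>: "\<delta> > 0" and C: "C > 0" and ex: "\<And>n. \<exists>a. jet \<delta> C n f a M"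
  shows "\<exists>a. \<forall>n. jet \<delta> C n f a M"
proof -
  obtain A where A: "\<And>n. jet \<delta> C n f (A n) M" using ex by metis
  have M: "M \<ge> 0" by (rule jet_bounds(3)[OF A C])
  \<comment> \<open>Order \<open>k + 1\<close> is the first at which uniqueness determines the
    coefficient of index \<open>k\<close>.\<close>
  define a where "a k = A (Suc k) k" for k
  have bd: "\<bar>f s x - (\<Sum>j<k. s ^ j * A n j x)\<bar> \<le> (M * C ^ k * \<omega> k) * \<bar>s\<bar> ^ k" if "k \<le> n" "\<bar>s\<bar> \<le> \<delta>" for n k s x
    using jetD(2)[OF A that, of x] by (simp add: power_mult_distrib ac_simps)
  have eq: "A n j = a j" if j: "j < n" for n j
  proof
    fix x
    show "A n j x = a j x" unfolding a_def
      by (rule power_expansion_unique[OF \<delta>, of "Suc j" "\<lambda>s. f s x" "\<lambda>j. A n j x" "\<lambda>k. M * C ^ k * \<omega> k"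
            "\<lambda>i. A (Suc j) i x" "\<lambda>k. M * C ^ k * \<omega> k"])
        (use bd[of _ n _ x] bd[of _ "Suc j" _ x] j in auto)
  qed
  have "jet \<delta> C n f a M" for n
  proof (rule jetI)
    fix k x assume k: "k \<le> n"
    have e: "a k = A (Suc n) k" using eq[of k "Suc n"] k by simp
    show "\<bar>a k x\<bar> \<le> M * C ^ k * \<omega> k" unfolding e using jetD(1)[OF A, of k "Suc n" x] k by simp
    show "a k \<in> borel_measurable lebesgue" unfolding e using jetD(3)[OF A, of k "Suc n"] k by simp
  next
    fix k s x assume k: "k \<le> n" and s: "\<bar>s\<bar> \<le> \<delta>"
    have "(\<Sum>j<k. s ^ j * a j x) = (\<Sum>j<k. s ^ j * A (Suc n) j x)"
      using eq[of _ "Suc n"] k by (intro sum.cong) auto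
    then show "\<bar>f s x - (\<Sum>j<k. s ^ j * a j x)\<bar> \<le> M * (C * \<bar>s\<bar>) ^ k * \<omega> k"
      using jetD(2)[OF A, of k "Suc n" s x] k s by simp
  qed (rule jetD(4)[OF A])
  then show ?thesis by blast
qed

text \<open>Jets control sup norms only. Uniqueness of expansions identifies the increments of the
  coefficients of \<open>D\<close> with integrals of those of \<open>q\<close>, so sup bounds for
  the slopes become Lipschitz bounds, for the coefficients as well as for the remainders.
  Periodicity of the coefficients follows from uniqueness too.\<close>

lemma analytic_of_jets:
  assumes \<delta>: "\<delta> > 0" and C: "C > 0"
    and jD: "\<And>n. \<exists>a. jet \<delta> C n D a M" and jq: "\<And>n. \<exists>b. jet \<delta> C n q b M"
    and DL: "\<And>s. \<bar>s\<bar> \<le> \<delta> \<Longrightarrow> D s \<in> Lip_torus"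
    and incr: "\<And>s x y. \<bar>s\<bar> \<le> \<delta> \<Longrightarrow> x \<le> y \<Longrightarrow> D s y - D s x = integral {x..y} (q s) - (y - x)"
  shows "\<exists>a. (\<forall>k. a k \<in> Lip_torus) \<and> (\<forall>s. \<bar>s\<bar> \<le> \<delta> \<longrightarrow> C * \<bar>s\<bar> < 1 \<longrightarrow>
     (\<lambda>n. Lip_norm (\<lambda>x. D s x - (\<Sum>k<n. s ^ k * a k x))) \<longlonglongrightarrow> 0)"
proof -
  obtain a where a: "\<And>n. jet \<delta> C n D a M" using jet_all_orders[OF \<delta> C jD] by blast
  obtain b where b: "\<And>n. jet \<delta> C n q b M" using jet_all_orders[OF \<delta> C jq] by blast
  have M: "M \<ge> 0" by (rule jet_bounds(3)[OF a C])
  have A: "\<bar>D s x - (\<Sum>j<k. s ^ j * a j x)\<bar> \<le> M * (C * \<bar>s\<bar>) ^ k" if s: "\<bar>s\<bar> \<le> \<delta>" for s x k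
  proof -
    have "M * (C * \<bar>s\<bar>) ^ k * \<omega> k \<le> M * (C * \<bar>s\<bar>) ^ k * 1" using M C \<omega>_le_1 by (intro mult_left_mono) auto
    then show ?thesis using jetD(2)[OF a[of k] order_refl s, of x] by simp
  qed
  have B: "\<bar>q s x - (\<Sum>j<k. s ^ j * b j x)\<bar> \<le> M * (C * \<bar>s\<bar>) ^ k" if s: "\<bar>s\<bar> \<le> \<delta>" for s x k
  proof -
    have "M * (C * \<bar>s\<bar>) ^ k * \<omega> k \<le> M * (C * \<bar>s\<bar>) ^ k * 1" using M C \<omega>_le_1 by (intro mult_left_mono) auto
    then show ?thesis using jetD(2)[OF b[of k] order_refl s, of x] by simp
  qed
  have lb: "loc_ess_bounded (b k)" for k
    by (rule loc_ess_bounded_bounded[OF jetD(3)[OF b[of k] order_refl] jetD(1)[OF b[of k] order_refl]])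
  have lq: "loc_ess_bounded (q s)" if "\<bar>s\<bar> \<le> \<delta>" for s
    by (rule loc_ess_bounded_bounded[OF jetD(4)[OF b[of 0] that] jet_bounds(2)[OF b[of 0] C that]])
  have ib: "\<bar>integral {x..y} (\<lambda>z. q s z - (\<Sum>j<k. s ^ j * b j z))\<bar> \<le> M * (C * \<bar>s\<bar>) ^ k * (y - x)"
    if s: "\<bar>s\<bar> \<le> \<delta>" and xy: "x \<le> y" for s k x y
  proof -
    have l: "loc_ess_bounded (\<lambda>z. q s z - (\<Sum>j<k. s ^ j * b j z))"
    proof (rule loc_ess_bounded_bounded[OF _ B[OF s]])
      show "(\<lambda>z. q s z - (\<Sum>j<k. s ^ j * b j z)) \<in> borel_measurable lebesgue"
        using lq[OF s] lb by (intro borel_measurable_diff borel_measurable_sum borel_measurable_times) (auto simp: loc_ess_bounded_def)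
    qed
    have "\<bar>integral {x..y} (\<lambda>z. q s z - (\<Sum>j<k. s ^ j * b j z))\<bar> \<le> integral {x..y} (\<lambda>z. \<bar>q s z - (\<Sum>j<k. s ^ j * b j z)\<bar>)"
      by (rule integral_abs_le[OF l])
    also have "\<dots> \<le> integral {x..y} (\<lambda>z. M * (C * \<bar>s\<bar>) ^ k)"
      by (rule integral_mono_AE[OF loc_ess_bounded_abs[OF l] loc_ess_bounded_const]) (use B[OF s] in auto)
    finally show ?thesis using xy by (simp add: ac_simps)
  qed
  \<comment> \<open>The displacement has slope \<open>q - 1\<close>, and the constant 1 belongs to
    the coefficient of index 0. Truncations must contain that coefficient, hence
    \<open>k > 0\<close> in the identity that follows.\<close>
  define \<beta> where "\<beta> x y k = integral {x..y} (b k) - (if k = 0 then y - x else 0)" for x y k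
  have incr': "D s y - D s x - (\<Sum>j<k. s ^ j * \<beta> x y j) = integral {x..y} (\<lambda>z. q s z - (\<Sum>j<k. s ^ j * b j z))"
    if s: "\<bar>s\<bar> \<le> \<delta>" and xy: "x \<le> y" and k: "k > 0" for s x y k
  proof -
    have "((\<lambda>z. q s z - (\<Sum>j<k. s ^ j * b j z)) has_integral integral {x..y} (q s) - (\<Sum>j<k. s ^ j * integral {x..y} (b j))) {x..y}"
      by (intro has_integral_diff has_integral_sum has_integral_mult_right integrable_integral
          loc_ess_bounded_integrable_on lq s lb) auto
    then have I: "integral {x..y} (\<lambda>z. q s z - (\<Sum>j<k. s ^ j * b j z)) = integral {x..y} (q s) - (\<Sum>j<k. s ^ j * integral {x..y} (b j))"
      by (rule integral_unique)
    have "(\<Sum>j<k. s ^ j * \<beta> x y j) = (\<Sum>j<k. s ^ j * integral {x..y} (b j)) - (\<Sum>j<k. if j = 0 then y - x else 0)"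
      unfolding \<beta>_def sum_subtractf[symmetric] by (intro sum.cong) (auto simp: right_diff_distrib)
    also have "(\<Sum>j<k. if j = 0 then y - x else 0) = y - x" using k by (simp add: sum.delta)
    finally show ?thesis unfolding I incr[OF s xy] by simp
  qed
  have a_incr: "a k y - a k x = \<beta> x y k" if xy: "x \<le> y" for k x y
  proof (rule power_expansion_unique[OF \<delta>, of "Suc k" "\<lambda>s. D s y - D s x" "\<lambda>k. a k y - a k x" "\<lambda>k. 2 * M * C ^ k" "\<beta> x y"
        "\<lambda>k. (2 * M + M * (y - x)) * C ^ k"])
    fix i s assume s: "\<bar>s\<bar> \<le> \<delta>"
    have "D s y - D s x - (\<Sum>j<i. s ^ j * (a j y - a j x)) = (D s y - (\<Sum>j<i. s ^ j * a j y)) - (D s x - (\<Sum>j<i. s ^ j * a j x))"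
      by (simp add: right_diff_distrib sum_subtractf)
    then show "\<bar>D s y - D s x - (\<Sum>j<i. s ^ j * (a j y - a j x))\<bar> \<le> 2 * M * C ^ i * \<bar>s\<bar> ^ i"
      using A[OF s, of y i] A[OF s, of x i] by (simp add: power_mult_distrib mult.assoc)
    show "\<bar>D s y - D s x - (\<Sum>j<i. s ^ j * \<beta> x y j)\<bar> \<le> (2 * M + M * (y - x)) * C ^ i * \<bar>s\<bar> ^ i"
    proof (cases "i = 0")
      case True
      have "0 \<le> M * (y - x)" using M xy by simp
      then show ?thesis using A[OF s, of y 0] A[OF s, of x 0] True by simp
    next
      case False
      have "M * (C * \<bar>s\<bar>) ^ i * (y - x) \<le> (2 * M + M * (y - x)) * (C ^ i * \<bar>s\<bar> ^ i)"
        using M C xy by (simp add: power_mult_distrib algebra_simps)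
      then show ?thesis using ib[OF s xy, of i] incr'[OF s xy, of i] False by (simp add: mult.assoc)
    qed
  qed simp
  have per: "a k (x + 1) = a k x" for k x
  proof (rule power_expansion_unique[OF \<delta>, of "Suc k" "\<lambda>s. D s x" "\<lambda>k. a k (x + 1)" "\<lambda>k. M * C ^ k" "\<lambda>k. a k x" "\<lambda>k. M * C ^ k"])
    fix i s assume s: "\<bar>s\<bar> \<le> \<delta>"
    have "D s (x + 1) = D s x" using DL[OF s] by (simp add: Lip_torus_def)
    then show "\<bar>D s x - (\<Sum>j<i. s ^ j * a j (x + 1))\<bar> \<le> M * C ^ i * \<bar>s\<bar> ^ i"
      using A[OF s, of "x + 1" i] by (simp add: power_mult_distrib mult.assoc)
    show "\<bar>D s x - (\<Sum>j<i. s ^ j * a j x)\<bar> \<le> M * C ^ i * \<bar>s\<bar> ^ i"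
      using A[OF s, of x i] by (simp add: power_mult_distrib mult.assoc)
  qed simp
  have lipI: "L-lipschitz_on UNIV f" if "L \<ge> 0" "\<And>x y. x \<le> y \<Longrightarrow> \<bar>f y - f x\<bar> \<le> L * (y - x)" for L and f :: "real \<Rightarrow> real"
  proof (rule lipschitz_onI[OF _ that(1)])
    fix x y show "dist (f x) (f y) \<le> L * dist x y"
      using that(2)[of x y] that(2)[of y x] by (cases "x \<le> y") (auto simp: dist_real_def abs_minus_commute)
  qed
  have aL: "a k \<in> Lip_torus" for k
  proof -
    have "(M * C ^ k + 1)-lipschitz_on UNIV (a k)"
    proof (rule lipI)
      fix x y :: real assume xy: "x \<le> y"
      have "\<bar>integral {x..y} (b k)\<bar> \<le> integral {x..y} (\<lambda>z. \<bar>b k z\<bar>)" by (rule integral_abs_le[OF lb])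
      also have "\<dots> \<le> integral {x..y} (\<lambda>z. M * C ^ k)"
      proof (rule integral_mono_AE[OF loc_ess_bounded_abs[OF lb] loc_ess_bounded_const])
        have "\<bar>b k z\<bar> \<le> M * C ^ k" for z
        proof -
          have "M * C ^ k * \<omega> k \<le> M * C ^ k * 1" using M C \<omega>_le_1 by (intro mult_left_mono) auto
          then show ?thesis using jetD(1)[OF b[of k] order_refl, of z] by simp
        qed
        then show "AE z in lebesgue. z \<in> {x..y} \<longrightarrow> \<bar>b k z\<bar> \<le> M * C ^ k" by simp
      qed
      also have "\<dots> = M * C ^ k * (y - x)" using xy by (simp add: mult.commute)
      finally have "\<bar>\<beta> x y k\<bar> \<le> M * C ^ k * (y - x) + (y - x)" using xy by (auto simp: \<beta>_def)
      then show "\<bar>a k y - a k x\<bar> \<le> (M * C ^ k + 1) * (y - x)" unfolding a_incr[OF xy] by (simp add: distrib_right)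
    qed (use M C in simp)
    then show ?thesis using per unfolding Lip_torus_def by blast
  qed
  have lim: "(\<lambda>n. Lip_norm (\<lambda>x. D s x - (\<Sum>k<n. s ^ k * a k x))) \<longlonglongrightarrow> 0" if s: "\<bar>s\<bar> \<le> \<delta>" "C * \<bar>s\<bar> < 1" for s
  proof (rule tendsto_sandwich[of "\<lambda>_. 0" _ _ "\<lambda>n. 2 * (M * (C * \<bar>s\<bar>) ^ n)"])
    have SL: "(\<lambda>x. \<Sum>k<n. s ^ k * a k x) \<in> Lip_torus" for n
    proof (induction n)
      case 0 show ?case by (auto simp: Lip_torus_def lipschitz_on_def intro!: exI[of _ 0])
    next
      case (Suc n) then show ?case using Lip_torus_add[OF Suc Lip_torus_scale[OF aL]] by simp
    qed
    show "\<forall>\<^sub>F n in sequentially. 0 \<le> Lip_norm (\<lambda>x. D s x - (\<Sum>k<n. s ^ k * a k x))"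
      by (intro always_eventually allI Lip_norm_nonneg Lip_torus_diff DL s SL)
    show "\<forall>\<^sub>F n in sequentially. Lip_norm (\<lambda>x. D s x - (\<Sum>k<n. s ^ k * a k x)) \<le> 2 * (M * (C * \<bar>s\<bar>) ^ n)"
      using eventually_gt_at_top[of 0]
    proof eventually_elim
      case (elim n)
      show ?case
      proof (rule Lip_norm_le[OF A[OF s(1)]], rule lipI)
        fix x y :: real assume xy: "x \<le> y"
        have "(D s y - (\<Sum>k<n. s ^ k * a k y)) - (D s x - (\<Sum>k<n. s ^ k * a k x)) = D s y - D s x - (\<Sum>k<n. s ^ k * \<beta> x y k)"
          unfolding a_incr[OF xy, symmetric] by (simp add: right_diff_distrib sum_subtractf)
        then show "\<bar>(D s y - (\<Sum>k<n. s ^ k * a k y)) - (D s x - (\<Sum>k<n. s ^ k * a k x))\<bar> \<le> M * (C * \<bar>s\<bar>) ^ n * (y - x)"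
          using ib[OF s(1) xy, of n] incr'[OF s(1) xy elim] by simp
      qed (use M C in simp)
    qed
    have "(\<lambda>n. (C * \<bar>s\<bar>) ^ n) \<longlonglongrightarrow> 0" using s C by (intro LIMSEQ_realpow_zero) auto
    then show "(\<lambda>n. 2 * (M * (C * \<bar>s\<bar>) ^ n)) \<longlonglongrightarrow> 0" by (intro tendsto_mult_right_zero)
  qed auto
  show ?thesis using aL lim by blast
qed

section \<open>Induction on the order for the whole system\<close>

text \<open>All unknowns are treated at once: jets of order \<open>n\<close> with bound
  \<open>M\<close> give jets of the right-hand sides whose bounds are at most \<open>N\<close>,
  which depends on \<open>M\<close>, \<open>c1\<close>, \<open>c2\<close> only, and integration
  returns order \<open>n + 1\<close> with bound \<open>M\<close>. \<open>\<Phi>\<close> and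
  \<open>\<Psi>\<close>, meant as exponentials of the displacement and its negative, are adjoined
  because they too obey polynomial equations.\<close>

lemma jets_of_system:
  fixes v q w h \<Phi> \<Psi> p r :: "real \<Rightarrow> real \<Rightarrow> real"
  defines "m \<equiv> \<lambda>s x. v s x * v s x * q s x + (1/2) * h s x"
  assumes \<delta>: "\<delta> > 0" and M: "M > 0"
    and bd: "\<And>s x. \<bar>s\<bar> \<le> \<delta> \<Longrightarrow> \<bar>v s x\<bar> \<le> M" "\<And>s x. \<bar>s\<bar> \<le> \<delta> \<Longrightarrow> \<bar>q s x\<bar> \<le> M"
      "\<And>s x. \<bar>s\<bar> \<le> \<delta> \<Longrightarrow> \<bar>w s x\<bar> \<le> M" "\<And>s x. \<bar>s\<bar> \<le> \<delta> \<Longrightarrow> \<bar>h s x\<bar> \<le> M"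
      "\<And>s x. \<bar>s\<bar> \<le> \<delta> \<Longrightarrow> \<bar>\<Phi> s x\<bar> \<le> M" "\<And>s x. \<bar>s\<bar> \<le> \<delta> \<Longrightarrow> \<bar>\<Psi> s x\<bar> \<le> M"
    and ms: "\<And>s. \<bar>s\<bar> \<le> \<delta> \<Longrightarrow> v s \<in> borel_measurable lebesgue" "\<And>s. \<bar>s\<bar> \<le> \<delta> \<Longrightarrow> q s \<in> borel_measurable lebesgue"
      "\<And>s. \<bar>s\<bar> \<le> \<delta> \<Longrightarrow> w s \<in> borel_measurable lebesgue" "\<And>s. \<bar>s\<bar> \<le> \<delta> \<Longrightarrow> h s \<in> borel_measurable lebesgue"
      "\<And>s. \<bar>s\<bar> \<le> \<delta> \<Longrightarrow> \<Phi> s \<in> borel_measurable lebesgue" "\<And>s. \<bar>s\<bar> \<le> \<delta> \<Longrightarrow> \<Psi> s \<in> borel_measurable lebesgue"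
    and p: "\<And>s x. \<bar>s\<bar> \<le> \<delta> \<Longrightarrow> p s x = c1 * (\<Psi> s x * kernel_op 1 (\<lambda>y. \<Phi> s y * m s y) x)
          + c2 * (\<Phi> s x * kernel_op (-1) (\<lambda>y. \<Psi> s y * m s y) x)"
    and r: "\<And>s x. \<bar>s\<bar> \<le> \<delta> \<Longrightarrow> r s x = (-c1) * (\<Psi> s x * kernel_op 1 (\<lambda>y. \<Phi> s y * m s y) x)
          + c2 * (\<Phi> s x * kernel_op (-1) (\<lambda>y. \<Psi> s y * m s y) x)"
    and der: "\<And>s x. \<bar>s\<bar> \<le> \<delta> \<Longrightarrow> ((\<lambda>s. v s x) has_real_derivative (-1) * r s x) (at s)"
      "\<And>s x. \<bar>s\<bar> \<le> \<delta> \<Longrightarrow> ((\<lambda>s. q s x) has_real_derivative w s x) (at s)"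
      "\<And>s x. \<bar>s\<bar> \<le> \<delta> \<Longrightarrow> ((\<lambda>s. w s x) has_real_derivative
          (v s x * v s x + (-1) * p s x) * q s x + (1/2) * h s x) (at s)"
      "\<And>s x. \<bar>s\<bar> \<le> \<delta> \<Longrightarrow> ((\<lambda>s. h s x) has_real_derivative
          2 * ((v s x * v s x + (-1) * p s x) * w s x)) (at s)"
      "\<And>s x. \<bar>s\<bar> \<le> \<delta> \<Longrightarrow> ((\<lambda>s. \<Phi> s x) has_real_derivative v s x * \<Phi> s x) (at s)"
      "\<And>s x. \<bar>s\<bar> \<le> \<delta> \<Longrightarrow> ((\<lambda>s. \<Psi> s x) has_real_derivative (-1) * (v s x * \<Psi> s x)) (at s)"
  shows "\<exists>C\<ge>4. \<forall>n. (\<exists>a. jet \<delta> C n v a M) \<and> (\<exists>a. jet \<delta> C n q a M)"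
proof -
  \<comment> \<open>The constants mirror the formulas of the right-hand sides: every product costs a
    factor 8, every kernel a factor 3.\<close>
  define Nm where "Nm = 8 * (8 * M * M) * M + \<bar>1/2\<bar> * M"
  define NA where "NA = 8 * M * (3 * (8 * M * Nm))"
  define Np where "Np = \<bar>c1\<bar> * NA + \<bar>c2\<bar> * NA"
  define NW where "NW = 8 * M * M + \<bar>-1\<bar> * Np"
  define N where "N = \<bar>-1\<bar> * Np + (8 * NW * M + \<bar>1/2\<bar> * M) + \<bar>2\<bar> * (8 * NW * M) + 8 * M * M + M"
  \<comment> \<open>Large enough for \<open>4 * N \<le> C * M\<close>; the summand 4 gives
    \<open>C \<ge> 4\<close>, which serves later to integrate the velocity into the
    displacement.\<close>
  define C where "C = 4 + 4 * N / M"
  have pos: "0 \<le> Nm" "0 \<le> NA" "0 \<le> Np" "0 \<le> NW" using M by (auto simp: Nm_def NA_def Np_def NW_def)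
  have le: "\<bar>-1\<bar> * Np \<le> N" "M \<le> N" "8 * NW * M + \<bar>1/2\<bar> * M \<le> N" "\<bar>2\<bar> * (8 * NW * M) \<le> N" "8 * M * M \<le> N"
    "\<bar>-1\<bar> * (8 * M * M) \<le> N"
  proof -
    have "0 \<le> 8 * NW * M" "0 \<le> 8 * M * M" using pos M by auto
    then show "\<bar>-1\<bar> * Np \<le> N" "M \<le> N" "8 * NW * M + \<bar>1/2\<bar> * M \<le> N" "\<bar>2\<bar> * (8 * NW * M) \<le> N" "8 * M * M \<le> N"
      "\<bar>-1\<bar> * (8 * M * M) \<le> N" using pos M unfolding N_def by linarith+
  qed
  have N0: "N \<ge> 0" using le(2) M by linarith
  have C4: "C \<ge> 4" using N0 M by (simp add: C_def)
  then have C: "C > 0" by linarith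
  have CM: "4 * K \<le> C * M" if "K \<le> N" for K
    using that M by (simp add: C_def distrib_right)
  define J where "J n f \<longleftrightarrow> (\<exists>a. jet \<delta> C n f a M)" for n f
  have base: "J 0 f" if "\<And>s x. \<bar>s\<bar> \<le> \<delta> \<Longrightarrow> \<bar>f s x\<bar> \<le> M" "\<And>s. \<bar>s\<bar> \<le> \<delta> \<Longrightarrow> f s \<in> borel_measurable lebesgue" for f
    unfolding J_def jet_def using that \<delta> by (intro exI[of _ "\<lambda>_. f 0"]) (auto simp: \<omega>_0)
  have "J n v \<and> J n q \<and> J n w \<and> J n h \<and> J n \<Phi> \<and> J n \<Psi>" for n
  proof (induction n)
    case 0
    show ?case by (intro conjI base bd ms)
  next
    case (Suc n)
    obtain av aq aw ah a\<Phi> a\<Psi> where j: "jet \<delta> C n v av M" "jet \<delta> C n q aq M" "jet \<delta> C n w aw M"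
      "jet \<delta> C n h ah M" "jet \<delta> C n \<Phi> a\<Phi> M" "jet \<delta> C n \<Psi> a\<Psi> M"
      using Suc unfolding J_def by blast
    obtain am where m: "jet \<delta> C n m am Nm" unfolding Nm_def m_def
      using jet_add[OF jet_mult[OF jet_mult[OF j(1) j(1) C] j(2) C] jet_cmult[OF j(4)]] by blast
    obtain aA where A: "jet \<delta> C n (\<lambda>s x. \<Psi> s x * kernel_op 1 (\<lambda>y. \<Phi> s y * m s y) x) aA NA" unfolding NA_def
      using jet_mult[OF j(6) jet_kernel_op[OF jet_mult[OF j(5) m C] C, of 1] C] by fastforce
    obtain aB where B: "jet \<delta> C n (\<lambda>s x. \<Phi> s x * kernel_op (-1) (\<lambda>y. \<Psi> s y * m s y) x) aB NA" unfolding NA_def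
      using jet_mult[OF j(5) jet_kernel_op[OF jet_mult[OF j(6) m C] C, of "-1"] C] by fastforce
    obtain ap where jp: "jet \<delta> C n p ap Np"
      using jet_cong[OF jet_add[OF jet_cmult[OF A, of c1] jet_cmult[OF B, of c2]], of p] p unfolding Np_def by fastforce
    obtain ar where jr: "jet \<delta> C n r ar Np"
      using jet_cong[OF jet_add[OF jet_cmult[OF A, of "-c1"] jet_cmult[OF B, of c2]], of r] r unfolding Np_def
      by (fastforce simp: abs_minus_cancel)
    obtain aW where W: "jet \<delta> C n (\<lambda>s x. v s x * v s x + (-1) * p s x) aW NW" unfolding NW_def
      using jet_add[OF jet_mult[OF j(1) j(1) C] jet_cmult[OF jp, of "-1"]] by blast
    note int = jet_integrate[OF _ C CM _ _ \<delta>]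
    have "J (Suc n) v" unfolding J_def
      by (rule exI, rule int[OF jet_cmult[OF jr] le(1) der(1) bd(1) ms(1)])
    moreover have "J (Suc n) q" unfolding J_def
      by (rule exI, rule int[OF j(3) le(2) der(2) bd(2) ms(2)])
    moreover have "J (Suc n) w" unfolding J_def
      by (rule exI, rule int[OF jet_add[OF jet_mult[OF W j(2) C] jet_cmult[OF j(4)]] le(3) der(3) bd(3) ms(3)])
    moreover have "J (Suc n) h" unfolding J_def
      by (rule exI, rule int[OF jet_cmult[OF jet_mult[OF W j(3) C]] le(4) der(4) bd(4) ms(4)])
    moreover have "J (Suc n) \<Phi>" unfolding J_def
      by (rule exI, rule int[OF jet_mult[OF j(1) j(5) C] le(5) der(5) bd(5) ms(5)])
    moreover have "J (Suc n) \<Psi>" unfolding J_def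
      by (rule exI, rule int[OF jet_cmult[OF jet_mult[OF j(1) j(6) C]] le(6) der(6) bd(6) ms(6)])
    ultimately show ?case by blast
  qed
  then show ?thesis using C4 unfolding J_def by blast
qed

section \<open>Analyticity\<close>

context CH_flow
begin

lemma displacement_analytic_at:
  assumes t0: "t0 \<in> I"
  shows "\<exists>d>0. \<exists>a. (\<forall>k. a k \<in> Lip_torus) \<and> (\<forall>t\<in>I. \<bar>t - t0\<bar> < d \<longrightarrow>
     (\<lambda>n. Lip_norm (\<lambda>x. \<xi> t x - x - (\<Sum>k<n. (t - t0) ^ k * a k x))) \<longlonglongrightarrow> 0)"
proof -
  have st: "\<forall>t\<in>I. stretched t" using stretched_all by blast
  obtain N where N: "negligible N"
    "\<And>x t. x \<notin> N \<Longrightarrow> t \<in> I \<Longrightarrow> (\<xi> t has_real_derivative q t x) (at x)"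
    "\<And>x t. x \<notin> N \<Longrightarrow> t \<in> I \<Longrightarrow> (\<eta> t has_real_derivative w t x) (at x)"
    "\<And>x t. x \<notin> N \<Longrightarrow> t \<in> I \<Longrightarrow> (r t has_real_derivative \<rho> t x) (at x)"
    "\<And>x t. x \<notin> N \<Longrightarrow> t \<in> I \<Longrightarrow> q t x > 0"
    "\<And>x t. x \<notin> N \<Longrightarrow> t \<in> I \<Longrightarrow> ((\<lambda>s. q s x) has_real_derivative w t x) (at t)"
    "\<And>x t. x \<notin> N \<Longrightarrow> t \<in> I \<Longrightarrow> ((\<lambda>s. w s x) has_real_derivative - \<rho> t x) (at t)"
    "\<And>x t. x \<notin> N \<Longrightarrow> t \<in> I \<Longrightarrow> ((\<lambda>s. h s x) has_real_derivative 2 * (\<eta> t x * \<eta> t x - p t x) * w t x) (at t)"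
    using characteristic_system[OF order_refl st] by blast
  have AEN: "AE x in lebesgue. x \<notin> N" using N(1) by (simp add: AE_lebesgue_iff_negligible)
  obtain c where c: "c > 0" "\<forall>x y. x \<le> y \<longrightarrow> c * (y - x) \<le> \<xi> t0 y - \<xi> t0 x" using st t0 unfolding stretched_def by blast
  \<comment> \<open>Lipschitz closeness \<open>c/2\<close> to time \<open>t0\<close> keeps the
    slopes above \<open>c/2\<close>; closeness 1 enters the sup bounds collected in
    \<open>M\<close>.\<close>
  define c' where "c' = min 1 (c/2)"
  have c': "c' > 0" "c' \<le> 1" "c' \<le> c/2" using c by (auto simp: c'_def)
  obtain B1 where B1: "\<And>x. \<bar>\<eta> t0 x\<bar> \<le> B1" using Lip_torus_bounded[OF \<eta>_Lip[OF t0]] by blast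
  obtain B2 where B2: "\<And>x. \<bar>\<xi> t0 x - x\<bar> \<le> B2" using Lip_torus_bounded[OF displacement_Lip[OF t0]] by blast
  obtain B3 where B3: "B3-lipschitz_on UNIV (\<xi> t0)" using \<xi>_lipschitz[OF t0] by blast
  obtain B4 where B4: "B4-lipschitz_on UNIV (\<eta> t0)" using \<eta>_Lip[OF t0] by (rule Lip_torusE)
  have nn: "B1 \<ge> 0" "B2 \<ge> 0" "B3 \<ge> 0" "B4 \<ge> 0"
    using B1[of 0] B2[of 0] lipschitz_on_nonneg[OF B3] lipschitz_on_nonneg[OF B4] by linarith+
  \<comment> \<open>The summands bound, in this order, velocity, displacement, \<open>q\<close>,
    \<open>w\<close>, \<open>h\<close> and the exponentials of the displacement near
    \<open>t0\<close>. The 1 added to each base constant allows for the deviation from time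
    \<open>t0\<close>.\<close>
  define M where "M = (B1 + 1) + (B2 + 1) + (B3 + 1) + (B4 + 1) + (B4 + 1) * (B4 + 1) / (c/2) + exp (B2 + 1)"
  have Mterm: "0 \<le> (B4 + 1) * (B4 + 1) / (c/2)" using nn c by simp
  have MB: "B1 + 1 \<le> M" "B2 + 1 \<le> M" "B3 + 1 \<le> M" "B4 + 1 \<le> M" "(B4 + 1) * (B4 + 1) / (c/2) \<le> M" "exp (B2 + 1) \<le> M" "M > 0"
    using nn Mterm exp_gt_zero[of "B2 + 1"] unfolding M_def by linarith+
  obtain d0 where d0: "d0 > 0" "\<And>s. s \<noteq> t0 \<Longrightarrow> dist s t0 < d0 \<Longrightarrow> s \<in> I \<and>
      ((\<forall>x. \<bar>\<eta> s x - \<eta> t0 x\<bar> \<le> 1) \<and> 1-lipschitz_on UNIV (\<lambda>x. \<eta> s x - \<eta> t0 x)) \<and>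
      ((\<forall>x. \<bar>\<xi> s x - \<xi> t0 x\<bar> \<le> c') \<and> c'-lipschitz_on UNIV (\<lambda>x. \<xi> s x - \<xi> t0 x))"
    using eventually_conj[OF eventually_I[OF t0] eventually_conj[OF \<eta>_uniform[OF t0 zero_less_one] \<xi>_uniform[OF t0 c'(1)]]]
    unfolding eventually_at by auto
  have near: "s \<in> I \<and>
      ((\<forall>x. \<bar>\<eta> s x - \<eta> t0 x\<bar> \<le> 1) \<and> 1-lipschitz_on UNIV (\<lambda>x. \<eta> s x - \<eta> t0 x)) \<and>
      ((\<forall>x. \<bar>\<xi> s x - \<xi> t0 x\<bar> \<le> c') \<and> c'-lipschitz_on UNIV (\<lambda>x. \<xi> s x - \<xi> t0 x))" if "dist s t0 < d0" for s
  proof (cases "s = t0")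
    case True
    then show ?thesis using t0 c'(1) by (auto simp: lipschitz_on_def)
  qed (use d0(2) that in blast)
  define \<delta> where "\<delta> = d0 / 2"
  have \<delta>: "\<delta> > 0" using d0 by (simp add: \<delta>_def)
  have nr: "s + t0 \<in> I" "\<bar>\<eta> (s + t0) x - \<eta> t0 x\<bar> \<le> 1" "1-lipschitz_on UNIV (\<lambda>x. \<eta> (s + t0) x - \<eta> t0 x)"
      "\<bar>\<xi> (s + t0) x - \<xi> t0 x\<bar> \<le> c'" "c'-lipschitz_on UNIV (\<lambda>x. \<xi> (s + t0) x - \<xi> t0 x)" if "\<bar>s\<bar> \<le> \<delta>" for s x
    using near[of "s + t0"] that d0(1) by (auto simp: dist_real_def \<delta>_def)
  define V where "V s x = \<eta> (s + t0) x" for s x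
  \<comment> \<open>The jets need bounds and time derivatives at every \<open>x\<close>. On the null
    set the slopes are replaced by 0, which solves the equations for \<open>q\<close>,
    \<open>w\<close>, \<open>h\<close> and changes no integral; \<open>H\<close> vanishes there by
    the convention \<open>0 / 0 = 0\<close>.\<close>
  define Q where "Q s x = (if x \<in> N then 0 else q (s + t0) x)" for s x
  define W where "W s x = (if x \<in> N then 0 else w (s + t0) x)" for s x
  define H where "H s x = W s x * W s x / Q s x" for s x
  define D where "D s x = \<xi> (s + t0) x - x" for s x
  define \<Phi> where "\<Phi> s x = exp (D s x)" for s x
  define \<Psi> where "\<Psi> s x = exp (- D s x)" for s x
  \<comment> \<open>Half the reciprocals of the factors in Green's formula, so that \<open>p\<close>
    and \<open>r\<close> are recovered from \<open>p - r\<close> and \<open>p + r\<close>.\<close>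
  define c1 where "c1 = 1 / (2 * (exp 1 - 1 :: real))"
  define c2 where "c2 = 1 / (2 * (1 - exp (-1) :: real))"
  define m where "m s x = V s x * V s x * Q s x + (1/2) * H s x" for s x
  have HN: "H s x = (if x \<in> N then 0 else h (s + t0) x)" for s x
    by (simp add: H_def Q_def W_def h_def)
  have qb: "\<bar>q (s + t0) x - q t0 x\<bar> \<le> c'" "\<bar>w (s + t0) x - w t0 x\<bar> \<le> 1" "\<bar>q t0 x\<bar> \<le> B3" "\<bar>w t0 x\<bar> \<le> B4" "c \<le> q t0 x"
    if "\<bar>s\<bar> \<le> \<delta>" "x \<notin> N" for s x
    using deriv_lipschitz_diff_le[OF nr(5)[OF that(1)] N(2)[OF that(2) t0] N(2)[OF that(2) nr(1)[OF that(1)]]]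
      deriv_lipschitz_diff_le[OF nr(3)[OF that(1)] N(3)[OF that(2) t0] N(3)[OF that(2) nr(1)[OF that(1)]]]
      lipschitz_DERIV_abs_le[OF B3 N(2)[OF that(2) t0]] lipschitz_DERIV_abs_le[OF B4 N(3)[OF that(2) t0]]
      stretched_q_ge[OF c N(2)[OF that(2) t0]] by blast+
  have DL: "D s \<in> Lip_torus" if "\<bar>s\<bar> \<le> \<delta>" for s unfolding D_def[abs_def] by (rule displacement_Lip[OF nr(1)[OF that]])
  have bD: "\<bar>D s x\<bar> \<le> B2 + 1" if "\<bar>s\<bar> \<le> \<delta>" for s x
    using nr(4)[OF that, of x] B2[of x] c'(2) unfolding D_def by linarith
  have bds: "\<bar>V s x\<bar> \<le> M" "\<bar>Q s x\<bar> \<le> M" "\<bar>W s x\<bar> \<le> M" "\<bar>H s x\<bar> \<le> M" "\<bar>\<Phi> s x\<bar> \<le> M" "\<bar>\<Psi> s x\<bar> \<le> M"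
    if s: "\<bar>s\<bar> \<le> \<delta>" for s x
  proof -
    show "\<bar>V s x\<bar> \<le> M" using nr(2)[OF s, of x] B1[of x] MB(1) unfolding V_def by linarith
    show "\<bar>\<Phi> s x\<bar> \<le> M" "\<bar>\<Psi> s x\<bar> \<le> M"
      using bD[OF s, of x] MB(6) unfolding \<Phi>_def \<Psi>_def by (auto intro: order_trans[OF _ MB(6)])
    show "\<bar>Q s x\<bar> \<le> M" "\<bar>W s x\<bar> \<le> M"
    proof -
      have "\<bar>Q s x\<bar> \<le> M \<and> \<bar>W s x\<bar> \<le> M"
      proof (cases "x \<in> N")
        case False
        note b = qb[OF s False]
        have "\<bar>q (s + t0) x\<bar> \<le> M" "\<bar>w (s + t0) x\<bar> \<le> M" using b(1-4) c'(2) MB(3,4) by linarith+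
        then show ?thesis using False by (simp add: Q_def W_def)
      qed (use MB in \<open>simp add: Q_def W_def\<close>)
      then show "\<bar>Q s x\<bar> \<le> M" "\<bar>W s x\<bar> \<le> M" by blast+
    qed
    show "\<bar>H s x\<bar> \<le> M"
    proof (cases "x \<in> N")
      case False
      note b = qb[OF s False]
      have w: "\<bar>w (s + t0) x\<bar> \<le> B4 + 1" using b by linarith
      have q: "c/2 \<le> q (s + t0) x" using b c'(3) by linarith
      have "\<bar>w (s + t0) x\<bar> * \<bar>w (s + t0) x\<bar> / \<bar>q (s + t0) x\<bar> \<le> (B4 + 1) * (B4 + 1) / (c/2)"
        using w q c by (intro frac_le mult_mono) auto
      then have "\<bar>H s x\<bar> \<le> (B4 + 1) * (B4 + 1) / (c/2)" using False by (simp add: HN h_def abs_mult abs_divide)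
      then show ?thesis using MB(5) by linarith
    qed (use MB in \<open>simp add: HN\<close>)
  qed
  have Vc: "V s \<in> Lip_torus" if "\<bar>s\<bar> \<le> \<delta>" for s unfolding V_def[abs_def] by (rule \<eta>_Lip[OF nr(1)[OF that]])
  have cont\<xi>: "continuous_on UNIV (\<xi> t)" if "t \<in> I" for t using \<xi>_lipschitz[OF that] lipschitz_on_continuous_on by blast
  have QD: "AE x in lebesgue. (\<xi> (s + t0) has_real_derivative Q s x) (at x)" if "\<bar>s\<bar> \<le> \<delta>" for s
    using AEN by eventually_elim (use N(2) nr(1)[OF that] in \<open>simp add: Q_def\<close>)
  have WD: "AE x in lebesgue. (\<eta> (s + t0) has_real_derivative W s x) (at x)" if "\<bar>s\<bar> \<le> \<delta>" for s
    using AEN by eventually_elim (use N(3) nr(1)[OF that] in \<open>simp add: W_def\<close>)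
  have ms: "V s \<in> borel_measurable lebesgue" "Q s \<in> borel_measurable lebesgue" "W s \<in> borel_measurable lebesgue"
     "H s \<in> borel_measurable lebesgue" "\<Phi> s \<in> borel_measurable lebesgue" "\<Psi> s \<in> borel_measurable lebesgue" if s: "\<bar>s\<bar> \<le> \<delta>" for s
  proof -
    show "V s \<in> borel_measurable lebesgue" using Lip_torus_loc_ess_bounded[OF Vc[OF s]] by (simp add: loc_ess_bounded_def)
    show Qm: "Q s \<in> borel_measurable lebesgue" by (rule borel_measurable_AE_derivative[OF cont\<xi>[OF nr(1)[OF s]] QD[OF s]])
    show Wm: "W s \<in> borel_measurable lebesgue"
      by (rule borel_measurable_AE_derivative[OF Lip_torus_continuous[OF \<eta>_Lip[OF nr(1)[OF s]]] WD[OF s]])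
    show "H s \<in> borel_measurable lebesgue" unfolding H_def[abs_def] using Qm Wm by simp
    have Dm: "continuous_on UNIV (D s)" by (rule Lip_torus_continuous[OF DL[OF s]])
    have "loc_ess_bounded (\<Phi> s)" "loc_ess_bounded (\<Psi> s)" unfolding \<Phi>_def[abs_def] \<Psi>_def[abs_def]
      by (intro loc_ess_bounded_continuous continuous_intros Dm)+
    then show "\<Phi> s \<in> borel_measurable lebesgue" "\<Psi> s \<in> borel_measurable lebesgue" by (auto simp: loc_ess_bounded_def)
  qed
  have green: "(exp 1 - 1) * (p (s + t0) x - r (s + t0) x) = \<Psi> s x * kernel_op 1 (\<lambda>y. \<Phi> s y * m s y) x \<and>
      (1 - exp (-1)) * (p (s + t0) x + r (s + t0) x) = \<Phi> s x * kernel_op (-1) (\<lambda>y. \<Psi> s y * m s y) x"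
    if s: "\<bar>s\<bar> \<le> \<delta>" for s x
  proof -
    define t where "t = s + t0"
    have tI: "t \<in> I" using nr(1)[OF s] by (simp add: t_def)
    obtain Lx where Lx: "Lx-lipschitz_on UNIV (\<xi> t)" using \<xi>_lipschitz[OF tI] by blast
    obtain Lp where Lp: "Lp-lipschitz_on UNIV (p t)" "\<forall>x. p t (x + 1) = p t x" using p_Lip[OF tI] by (rule Lip_torusE)
    obtain Lr where Lr: "Lr-lipschitz_on UNIV (r t)" "\<forall>x. r t (x + 1) = r t x" using r_Lip[OF tI] by (rule Lip_torusE)
    have d1: "AE y in lebesgue. (\<xi> t has_real_derivative Q s y) (at y)" using QD[OF s] by (simp add: t_def)
    have d2: "AE y in lebesgue. (p t has_real_derivative r t y * Q s y) (at y)"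
      using d1 by eventually_elim (rule p_DERIV_space[OF tI])
    have d3: "AE y in lebesgue. (r t has_real_derivative p t y * Q s y - m s y) (at y)"
      using AEN
    proof eventually_elim
      case (elim y)
      have "\<rho> t y = p t y * Q s y - m s y"
        using elim by (simp add: \<rho>_def m_def V_def HN h_def Q_def t_def left_diff_distrib)
      then show ?case using N(4)[OF elim tI] by simp
    qed
    note G = Green_torus[OF Lx Lp(1) Lr(1) \<xi>_periodic[OF tI] Lp(2)[rule_format] Lr(2)[rule_format] d1 d2 d3, THEN integral_unique]
    \<comment> \<open>The exponential of an increment of the flow separates into
      \<open>\<Psi>\<close> at \<open>x\<close>, \<open>\<Phi>\<close> at \<open>y\<close> and the
      kernel \<open>exp (y - x)\<close>.\<close>
    have e1: "exp (\<xi> t y - \<xi> t x) * m s y = \<Psi> s x * exp (- (1 * x)) * (exp (1 * y) * (\<Phi> s y * m s y))" for y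
    proof -
      have "\<Psi> s x * exp (- (1 * x)) * (exp (1 * y) * \<Phi> s y) = exp (\<xi> t y - \<xi> t x)"
        unfolding \<Phi>_def \<Psi>_def D_def t_def exp_add[symmetric] by simp
      then show ?thesis by (metis mult.assoc)
    qed
    have e2: "exp (\<xi> t x - \<xi> t y) * m s y = \<Phi> s x * exp (- (-1 * x)) * (exp (-1 * y) * (\<Psi> s y * m s y))" for y
    proof -
      have "\<Phi> s x * exp (- (-1 * x)) * (exp (-1 * y) * \<Psi> s y) = exp (\<xi> t x - \<xi> t y)"
        unfolding \<Phi>_def \<Psi>_def D_def t_def exp_add[symmetric] by simp
      then show ?thesis by (metis mult.assoc)
    qed
    have "(exp 1 - 1) * (p t x - r t x) = \<Psi> s x * kernel_op 1 (\<lambda>y. \<Phi> s y * m s y) x"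
      unfolding G(1)[symmetric] e1 kernel_op_def by (simp only: integral_mult_right mult.assoc)
    moreover have "(1 - exp (-1)) * (p t x + r t x) = \<Phi> s x * kernel_op (-1) (\<lambda>y. \<Psi> s y * m s y) x"
      unfolding G(2)[symmetric] e2 kernel_op_def by (simp only: integral_mult_right mult.assoc)
    ultimately show ?thesis unfolding t_def by blast
  qed
  have e: "exp 1 \<noteq> (1::real)" "exp (-1) \<noteq> (1::real)" by simp_all
  have half: "p (s + t0) x = c1 * ((exp 1 - 1) * (p (s + t0) x - r (s + t0) x)) + c2 * ((1 - exp (-1)) * (p (s + t0) x + r (s + t0) x))"
    "r (s + t0) x = (-c1) * ((exp 1 - 1) * (p (s + t0) x - r (s + t0) x)) + c2 * ((1 - exp (-1)) * (p (s + t0) x + r (s + t0) x))" for s x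
  proof -
    have k: "c1 * ((exp 1 - 1) * z) = z / 2" "c2 * ((1 - exp (-1)) * z) = z / 2" for z
    proof -
      have aux: "1 / (2 * d) * (d * z) = z / 2" if "d \<noteq> 0" for d :: real using that by simp
      show "c1 * ((exp 1 - 1) * z) = z / 2" unfolding c1_def by (rule aux) (use e in simp)
      show "c2 * ((1 - exp (-1)) * z) = z / 2" unfolding c2_def by (rule aux) (use e in simp)
    qed
    show "p (s + t0) x = c1 * ((exp 1 - 1) * (p (s + t0) x - r (s + t0) x)) + c2 * ((1 - exp (-1)) * (p (s + t0) x + r (s + t0) x))"
      unfolding k by (simp add: field_simps)
    show "r (s + t0) x = (-c1) * ((exp 1 - 1) * (p (s + t0) x - r (s + t0) x)) + c2 * ((1 - exp (-1)) * (p (s + t0) x + r (s + t0) x))"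
      unfolding minus_mult_left[symmetric] k by (simp add: field_simps)
  qed
  have "\<exists>C\<ge>4. \<forall>n. (\<exists>a. jet \<delta> C n V a M) \<and> (\<exists>a. jet \<delta> C n Q a M)"
  proof (rule jets_of_system[where p = "\<lambda>s. p (s + t0)" and r = "\<lambda>s. r (s + t0)" and ?c1.0 = c1 and ?c2.0 = c2, OF \<delta> MB(7) bds ms])
    fix s x assume s: "\<bar>s\<bar> \<le> \<delta>"
    note sI = nr(1)[OF s]
    show "p (s + t0) x = c1 * (\<Psi> s x * kernel_op 1 (\<lambda>y. \<Phi> s y * (V s y * V s y * Q s y + 1 / 2 * H s y)) x) +
        c2 * (\<Phi> s x * kernel_op (- 1) (\<lambda>y. \<Psi> s y * (V s y * V s y * Q s y + 1 / 2 * H s y)) x)"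
      using half(1)[of s x] green[OF s, of x] unfolding m_def by (simp only:)
    show "r (s + t0) x = - c1 * (\<Psi> s x * kernel_op 1 (\<lambda>y. \<Phi> s y * (V s y * V s y * Q s y + 1 / 2 * H s y)) x) +
        c2 * (\<Phi> s x * kernel_op (- 1) (\<lambda>y. \<Psi> s y * (V s y * V s y * Q s y + 1 / 2 * H s y)) x)"
      using half(2)[of s x] green[OF s, of x] unfolding m_def by (simp only:)
    show "((\<lambda>s. V s x) has_real_derivative - 1 * r (s + t0) x) (at s)"
      unfolding V_def using \<eta>_DERIV[OF sI, of x] by (simp add: DERIV_shift)
    show "((\<lambda>s. Q s x) has_real_derivative W s x) (at s)"
    proof (cases "x \<in> N")
      case False
      then show ?thesis using N(6)[OF False sI] by (simp add: Q_def W_def DERIV_shift)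
    qed (simp add: Q_def W_def)
    show "((\<lambda>s. W s x) has_real_derivative (V s x * V s x + - 1 * p (s + t0) x) * Q s x + 1 / 2 * H s x) (at s)"
    proof (cases "x \<in> N")
      case False
      have "- \<rho> (s + t0) x = (V s x * V s x + - 1 * p (s + t0) x) * Q s x + 1 / 2 * H s x"
        using False by (simp add: \<rho>_def V_def HN h_def Q_def algebra_simps)
      then show ?thesis using N(7)[OF False sI] False by (simp add: W_def DERIV_shift)
    qed (simp add: W_def Q_def HN)
    show "((\<lambda>s. H s x) has_real_derivative 2 * ((V s x * V s x + - 1 * p (s + t0) x) * W s x)) (at s)"
    proof (cases "x \<in> N")
      case False
      have "2 * (\<eta> (s + t0) x * \<eta> (s + t0) x - p (s + t0) x) * w (s + t0) x = 2 * ((V s x * V s x + - 1 * p (s + t0) x) * W s x)"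
        using False by (simp add: V_def W_def)
      then show ?thesis using N(8)[OF False sI] False unfolding HN by (simp add: DERIV_shift)
    qed (simp add: HN W_def)
    have Dd: "((\<lambda>s. D s x) has_real_derivative V s x) (at s)"
    proof -
      have "((\<lambda>s. \<xi> (s + t0) x) has_real_derivative \<eta> (s + t0) x) (at s)"
        using \<xi>_DERIV_\<eta>[OF sI, of x] by (simp add: DERIV_shift)
      from DERIV_diff[OF this DERIV_const[of x]] show ?thesis unfolding D_def V_def by simp
    qed
    show "((\<lambda>s. \<Phi> s x) has_real_derivative V s x * \<Phi> s x) (at s)"
      unfolding \<Phi>_def by (rule DERIV_cong[OF DERIV_chain2[OF DERIV_exp Dd]]) simp
    show "((\<lambda>s. \<Psi> s x) has_real_derivative - 1 * (V s x * \<Psi> s x)) (at s)"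
      unfolding \<Psi>_def by (rule DERIV_cong[OF DERIV_chain2[OF DERIV_exp DERIV_minus[OF Dd]]]) simp
  qed
  then obtain C where C4: "C \<ge> 4" and jV: "\<And>n. \<exists>a. jet \<delta> C n V a M" and jQ: "\<And>n. \<exists>a. jet \<delta> C n Q a M" by blast
  have C: "C > 0" using C4 by linarith
  have dm: "D s \<in> borel_measurable lebesgue" if "\<bar>s\<bar> \<le> \<delta>" for s
    using Lip_torus_loc_ess_bounded[OF DL[OF that]] by (simp add: loc_ess_bounded_def)
  have Dd: "((\<lambda>s. D s x) has_real_derivative V s x) (at s)" if s: "\<bar>s\<bar> \<le> \<delta>" for s x
  proof -
    have "((\<lambda>s. \<xi> (s + t0) x) has_real_derivative \<eta> (s + t0) x) (at s)"
      using \<xi>_DERIV_\<eta>[OF nr(1)[OF s], of x] by (simp add: DERIV_shift)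
    from DERIV_diff[OF this DERIV_const[of x]] show ?thesis unfolding D_def V_def by simp
  qed
  have bDM: "\<bar>D s x\<bar> \<le> M" if "\<bar>s\<bar> \<le> \<delta>" for s x
    using bD[OF that, of x] MB(2) by linarith
  \<comment> \<open>The displacement integrates \<open>V\<close>, with the same \<open>C\<close> and
    \<open>M\<close>; order 0 is its sup bound.\<close>
  have jD: "\<exists>a. jet \<delta> C n D a M" for n
  proof -
    have "jet \<delta> C 0 D (\<lambda>_. D 0) M"
      unfolding jet_def using bDM \<delta> dm by (auto simp: \<omega>_0)
    moreover have "\<exists>a. jet \<delta> C (Suc k) D a M" for k
    proof -
      obtain a where a: "jet \<delta> C k V a M" using jV by blast
      show ?thesis
        by (rule exI, rule jet_integrate[OF a C _ Dd _ \<delta> dm]) (use C4 MB bDM in \<open>auto intro: mult_right_mono\<close>)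
    qed
    ultimately show ?thesis by (cases n) auto
  qed
  have incr: "D s y - D s x = integral {x..y} (Q s) - (y - x)" if s: "\<bar>s\<bar> \<le> \<delta>" and xy: "x \<le> y" for s x y
  proof -
    obtain L where L: "L-lipschitz_on UNIV (\<xi> (s + t0))" using \<xi>_lipschitz[OF nr(1)[OF s]] by blast
    have "(Q s has_integral \<xi> (s + t0) y - \<xi> (s + t0) x) {x..y}"
      by (rule fundamental_theorem_lipschitz_on[OF lipschitz_on_subset[OF L] QD[OF s] xy]) simp
    then show ?thesis by (simp add: integral_unique D_def)
  qed
  obtain a where a: "\<forall>k. a k \<in> Lip_torus" "\<And>s. \<bar>s\<bar> \<le> \<delta> \<Longrightarrow> C * \<bar>s\<bar> < 1 \<Longrightarrow>
     (\<lambda>n. Lip_norm (\<lambda>x. D s x - (\<Sum>k<n. s ^ k * a k x))) \<longlonglongrightarrow> 0"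
    using analytic_of_jets[OF \<delta> C jD jQ DL incr] by blast
  show ?thesis
  \<comment> \<open>Within \<open>\<delta>\<close> the jets are available, and below
    \<open>1 / C\<close> their remainders form a geometric null sequence.\<close>
  proof (intro exI[of _ "min \<delta> (1 / C)"] conjI exI[of _ a] ballI impI)
    show "min \<delta> (1 / C) > 0" using \<delta> C by simp
    fix t assume "t \<in> I" and t: "\<bar>t - t0\<bar> < min \<delta> (1 / C)"
    have "C * \<bar>t - t0\<bar> < 1" using t C by (simp add: field_simps)
    then show "(\<lambda>n. Lip_norm (\<lambda>x. \<xi> t x - x - (\<Sum>k<n. (t - t0) ^ k * a k x))) \<longlonglongrightarrow> 0"
      using a(2)[of "t - t0"] t by (simp add: D_def)
  qed (use a in blast)
qed

lemma displacement_analytic: "analytic_into Lip_torus Lip_norm I (\<lambda>t x. \<xi> t x - x)"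
  unfolding analytic_into_def using displacement_Lip displacement_analytic_at by blast

end

theorem theorem2:
  fixes T :: real and u0 :: "real \<Rightarrow> real" and u \<xi> :: "real \<Rightarrow> real \<Rightarrow> real"
  assumes "u0 \<in> Lip_torus"
    and "CH_local_wellposed T u0 u"
    and "flow_map T u \<xi>"
  shows "analytic_into Lip_torus Lip_norm {-T<..<T} (\<lambda>t x. \<xi> t x - x)"
proof -
  have sol: "T > 0" "CH_solution T u0 u" using assms(2) unfolding CH_local_wellposed_def by blast+
  \<comment> \<open>Local well-posedness asserts the regularity in time for every flow map, in
    particular for the given \<open>\<xi>\<close>.\<close>
  obtain \<eta> where \<eta>: "C1_into Lip_torus Lip_norm {-T<..<T} (\<lambda>t x. \<xi> t x - x) \<eta>"
    using assms(2,3) unfolding CH_local_wellposed_def by blast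
  obtain ut P where sys: "C1_into Linf_torus L2_norm_torus {-T<..<T} u ut"
    "\<forall>t\<in>{-T<..<T}. P t \<in> W2inf_torus \<and>
       (AE x in lebesgue. ut t x + deriv (\<lambda>y. (u t y)\<^sup>2 / 2 + P t y) x = 0) \<and>
       (AE x in lebesgue. - (deriv (deriv (P t)) x - P t x) = (u t x)\<^sup>2 + (deriv (u t) x)\<^sup>2 / 2)"
    using sol(2) unfolding CH_solution_def by blast
  have "C0_into Lip_torus H1_norm_torus {-T<..<T} u" using sol(2) unfolding CH_solution_def by blast
  then interpret CH_flow T u ut P \<xi> \<eta>
    using sol(1) sys \<eta> assms(3) by unfold_locales blast+
  show ?thesis by (rule displacement_analytic)
qed

end
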